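(* Let $W\in\mathrm{Gr}^{\mathrm{ad}}$ and let $(X,\mathcal L)$ be the corresponding pair of a framed affine curve and a line bundle on it. Then there are canonical identifications $$\mathcal F_z(\psi_W)=\mathcal D(W)=\mathcal D_{\mathcal L}(X).$$
   Context: Adelic Grassmannian. For $a\in\mathbb{C}$ let $\mathscr C_a$ be the $\mathbb{C}$-span of the distributions $\delta^{(k)}(z-a)$, $k\ge0$, and $\mathscr C=\bigoplus_a\mathscr C_a$. A finite-dimensional subspace $C\subset\mathscr C$ is homogeneous if $C=\bigoplus_a(C\cap\mathscr C_a)$. Put $V_C=\{f\in\mathbb{C}[z]:\langle\chi,f\rangle=0\ \forall\chi\in C\}$. $\mathrm{Gr}^{\mathrm{ad}}$ is the set of all subspaces $W=q(z)^{-1}V_C\subset\mathbb{C}(z)$, where $C$ is finite-dimensional homogeneous and $q(z)=\prod_a(z-a)^{\dim(C\cap\mathscr C_a)}$. Wave function. For $W=q^{-1}V_C$, $\psi_W(x,z)=\frac{1}{q(z)}D_C(x,\partial_x)\cdot e^{xz}$, where $D_C$ is the unique monic differential operator of order $\dim C$ with kernel $\{\langle\chi(z),e^{xz}\rangle:\chi\in C\}$; it does not depend on the presentation. Right Fourier algebra: $\mathcal F_z(\psi)$ is the algebra of differential operators $R(z,\partial_z)$ with rational coefficients for which there is a differential operator $S(x,\partial_x)$ with rational coefficients such that $S(x,\partial_x)\cdot\psi(x,z)=R(z,\partial_z)\cdot\psi(x,z)$. Differential operators on $W$: $\mathcal D(W)=\{D\in\mathbb{C}(z)[\partial_z]:D\cdot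 W\subseteq W\}$, for the natural action of $\mathbb{C}(z)[\partial_z]$ on $\mathbb{C}(z)$. Curve and line bundle. $A_W=\{f\in\mathbb{C}((z^{-1})):fW\subseteq W\}$, which is a subalgebra of $\mathbb{C}[z]$ with fraction field $\mathbb{C}(z)$; $X=\mathrm{Spec}(A_W)$, framed by the bijective morphism $\iota:\mathbb{A}^1_{\mathbb{C}}\to X$ induced by $A_W\subseteq\mathbb{C}[z]$. "Line bundle" means a torsion-free, generically rank one sheaf; $\mathcal L=\widetilde W$ is the sheaf on $X$ associated to the $A_W$-module $W$. Differential operators on a module: for a commutative $\mathbb{C}$-algebra $R$ and an $R$-module $M$, $\mathcal D^m(M)=\{\varphi\in\mathrm{Hom}_{\mathbb{C}}(M,M):\mathrm{ad}_r^{m+1}(\varphi)=0\ \forall r\in R\}$ and $\mathcal D(M)=\bigcup_m\mathcal D^m(M)$; this sheafifies, and $\mathcal D_{\mathcal L}(X)$ denotes the (global) differential operators on $\mathcal L$, i.e. the algebra of differential operators on the $A_W$-module $W$. Via $W\otimes_{A_W}\mathbb{C}(z)=\mathbb{C}(z)$, each such operator extends uniquely to a differential operator on the field $\mathbb{C}(z)$, giving the canonical embedding of $\mathcal D_{\mathcal L}(X)$ in $\mathbb{C}(z)[\partial_z]$ with respect to which the identification is made. *)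

theory Defs
  imports
    "HOL-Analysis.Analysis"
    "HOL-Computational_Algebra.Computational_Algebra"
    "HOL-Computational_Algebra.Field_as_Ring"
    "HOL-Library.Function_Algebras"
begin

section \<open>Rational functions\<close>

type_synonym ratfun = "complex poly fract"

definition rat_const :: "complex \<Rightarrow> ratfun" where
  "rat_const c = to_fract [:c:]"

text \<open>\<^const>\<open>quot_of_fract\<close> returns a representation in lowest terms, so the following is
  the value of \<open>r\<close> away from its poles; at a pole it is the default value 0.\<close>

definition rat_eval :: "ratfun \<Rightarrow> complex \<Rightarrow> complex" where
  "rat_eval r x = (let (p, q) = quot_of_fract r in poly p x / poly q x)"

definition rat_deriv :: "ratfun \<Rightarrow> ratfun" where
  "rat_deriv r = (let (p, q) = quot_of_fract r in Fract (pderiv p * q - p * pderiv q) (q * q))"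

text \<open>The embedding of \<open>\<complex>(z)\<close> into \<open>\<complex>((z\<^sup>-\<^sup>1))\<close>. The variable of the
  Laurent series stands for \<open>z\<^sup>-\<^sup>1\<close>, so \<open>z\<close> itself is \<^const>\<open>fls_X_inv\<close>.\<close>

definition poly_to_laurent :: "complex poly \<Rightarrow> complex fls" where
  "poly_to_laurent p = poly (map_poly fls_const p) fls_X_inv"

definition rat_to_laurent :: "ratfun \<Rightarrow> complex fls" where
  "rat_to_laurent r =
     (let (p, q) = quot_of_fract r in poly_to_laurent p / poly_to_laurent q)"


section \<open>Differential operators with rational coefficients\<close>

text \<open>The operator \<open>\<Sum>i. r\<^sub>i \<partial>\<^sup>i\<close> is encoded by the polynomial with coefficients
  \<open>r\<^sub>i\<close>. Addition and multiplication by a function from the left are those of the polynomial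
  type, but its (commutative) multiplication is \<^emph>\<open>not\<close> the composition of operators; that is
  \<open>op_mult\<close> below.\<close>

type_synonym diffop = "ratfun poly"

definition op_apply :: "diffop \<Rightarrow> ratfun \<Rightarrow> ratfun" where
  "op_apply D f = (\<Sum>i\<le>degree D. coeff D i * (rat_deriv ^^ i) f)"

definition op_eval :: "diffop \<Rightarrow> (complex \<Rightarrow> complex) \<Rightarrow> complex \<Rightarrow> complex" where
  "op_eval D f x = (\<Sum>i\<le>degree D. rat_eval (coeff D i) x * (deriv ^^ i) f x)"

text \<open>Left multiplication by \<open>\<partial>\<close> follows \<open>\<partial> r = r' + r \<partial>\<close>.\<close>

definition op_partial_mult :: "diffop \<Rightarrow> diffop" where
  "op_partial_mult E = map_poly rat_deriv E + pCons 0 E"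

definition op_mult :: "diffop \<Rightarrow> diffop \<Rightarrow> diffop" where
  "op_mult D E = (\<Sum>i\<le>degree D. smult (coeff D i) ((op_partial_mult ^^ i) E))"

text \<open>Identities between meromorphic functions are read off a finite set containing the poles.\<close>

definition op_kernel :: "diffop \<Rightarrow> (complex \<Rightarrow> complex) set" where
  "op_kernel D = {f. f holomorphic_on UNIV \<and>
     (\<exists>F. finite F \<and> (\<forall>x. x \<notin> F \<longrightarrow> op_eval D f x = 0))}"


section \<open>The adelic Grassmannian\<close>

text \<open>Distributions are represented as functionals on entire functions; the value at functions
  that are not entire is irrelevant and set to 0.\<close>

type_synonym dist = "(complex \<Rightarrow> complex) \<Rightarrow> complex"

definition delta :: "nat \<Rightarrow> complex \<Rightarrow> dist" where
  "delta k a f = (if f holomorphic_on UNIV then (-1) ^ k * (deriv ^^ k) f a else 0)"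

definition dist_scale :: "complex \<Rightarrow> dist \<Rightarrow> dist" where
  "dist_scale c \<xi> = (\<lambda>f. c * \<xi> f)"

global_interpretation dist: vector_space dist_scale
  by unfold_locales (auto simp: dist_scale_def fun_eq_iff algebra_simps)

definition dists_at :: "complex \<Rightarrow> dist set" where
  "dists_at a = dist.span (range (\<lambda>k. delta k a))"

text \<open>The sum of the spaces \<open>dists_at a\<close> over all \<open>a\<close> is direct, hence so is the sum of the
  subspaces \<open>C \<inter> dists_at a\<close>.\<close>

definition homogeneous :: "dist set \<Rightarrow> bool" where
  "homogeneous C \<longleftrightarrow> C = dist.span (\<Union>a. C \<inter> dists_at a)"

definition finite_dimensional :: "dist set \<Rightarrow> bool" where
  "finite_dimensional C \<longleftrightarrow> (\<exists>B. finite B \<and> C = dist.span B)"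

definition V_space :: "dist set \<Rightarrow> complex poly set" where
  "V_space C = {p. \<forall>\<xi>\<in>C. \<xi> (poly p) = 0}"

text \<open>For \<open>C\<close> finite-dimensional the index set is finite.\<close>

definition q_poly :: "dist set \<Rightarrow> complex poly" where
  "q_poly C = (\<Prod>a\<in>{a. dist.dim (C \<inter> dists_at a) \<noteq> 0}. [:- a, 1:] ^ dist.dim (C \<inter> dists_at a))"

definition presents :: "dist set \<Rightarrow> ratfun set \<Rightarrow> bool" where
  "presents C W \<longleftrightarrow> finite_dimensional C \<and> homogeneous C \<and>
     W = (\<lambda>p. to_fract p / to_fract (q_poly C)) ` V_space C"

definition Gr_ad :: "ratfun set set" where
  "Gr_ad = {W. \<exists>C. presents C W}"


section \<open>Wave functions and Fourier algebras\<close>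

text \<open>By homogeneity the prescribed kernel is spanned by functions
  \<open>p(x) exp(a x)\<close> with \<open>p\<close> polynomial. Hence the coefficients of the operator,
  which are quotients of Wronskians, are rational functions.\<close>

definition D_op :: "dist set \<Rightarrow> diffop" where
  "D_op C = (THE D. lead_coeff D = 1 \<and> degree D = dist.dim C \<and>
     op_kernel D = (\<lambda>\<xi> x. \<xi> (\<lambda>z. exp (x * z))) ` C)"

definition wave_function :: "dist set \<Rightarrow> complex \<Rightarrow> complex \<Rightarrow> complex" where
  "wave_function C x z = 1 / poly (q_poly C) z * op_eval (D_op C) (\<lambda>x. exp (x * z)) x"

text \<open>As a meromorphic function \<open>\<psi>\<close> depends only on \<open>W\<close>, but different presentations may give
  different default values at zeros of \<open>q\<close>. We therefore use a relation between \<open>W\<close> and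
  \<open>\<psi>\<close>, allowing every presentation.\<close>

definition is_wave_function :: "ratfun set \<Rightarrow> (complex \<Rightarrow> complex \<Rightarrow> complex) \<Rightarrow> bool" where
  "is_wave_function W \<psi> \<longleftrightarrow> (\<exists>C. presents C W \<and> \<psi> = wave_function C)"

definition right_fourier_algebra :: "(complex \<Rightarrow> complex \<Rightarrow> complex) \<Rightarrow> diffop set" where
  "right_fourier_algebra \<psi> = {R. \<exists>S F. finite F \<and>
     (\<forall>x z. x \<notin> F \<longrightarrow> z \<notin> F \<longrightarrow> op_eval S (\<lambda>x. \<psi> x z) x = op_eval R (\<lambda>z. \<psi> x z) z)}"

definition diffops_preserving :: "ratfun set \<Rightarrow> diffop set" where
  "diffops_preserving W = {D. \<forall>w\<in>W. op_apply D w \<in> W}"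


section \<open>Differential operators on a module\<close>

text \<open>Maps \<open>M \<rightarrow> M\<close> are represented as extensional functions on the carrier \<open>M\<close>. The parameter
  \<open>sc\<close> is the action of \<open>\<complex>\<close>, and \<open>act\<close> the action of the algebra with carrier \<open>R\<close>.\<close>

definition linear_endos ::
    "(complex \<Rightarrow> 'm \<Rightarrow> 'm) \<Rightarrow> 'm::ab_group_add set \<Rightarrow> ('m \<Rightarrow> 'm) set" where
  "linear_endos sc M = {\<phi> \<in> M \<rightarrow>\<^sub>E M.
     (\<forall>u\<in>M. \<forall>v\<in>M. \<phi> (u + v) = \<phi> u + \<phi> v) \<and> (\<forall>c. \<forall>u\<in>M. \<phi> (sc c u) = sc c (\<phi> u))}"

definition ad_op :: "'m::ab_group_add set \<Rightarrow> ('m \<Rightarrow> 'm) \<Rightarrow> ('m \<Rightarrow> 'm) \<Rightarrow> 'm \<Rightarrow> 'm" where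
  "ad_op M \<rho> \<phi> = (\<lambda>m\<in>M. \<rho> (\<phi> m) - \<phi> (\<rho> m))"

definition module_diffops_le ::
    "(complex \<Rightarrow> 'm \<Rightarrow> 'm) \<Rightarrow> 'r set \<Rightarrow> ('r \<Rightarrow> 'm \<Rightarrow> 'm) \<Rightarrow> 'm::ab_group_add set \<Rightarrow> nat \<Rightarrow> ('m \<Rightarrow> 'm) set"
  where
  "module_diffops_le sc R act M m =
     {\<phi> \<in> linear_endos sc M. \<forall>r\<in>R. (ad_op M (act r) ^^ Suc m) \<phi> = (\<lambda>u\<in>M. 0)}"

definition module_diffops ::
    "(complex \<Rightarrow> 'm \<Rightarrow> 'm) \<Rightarrow> 'r set \<Rightarrow> ('r \<Rightarrow> 'm \<Rightarrow> 'm) \<Rightarrow> 'm::ab_group_add set \<Rightarrow> ('m \<Rightarrow> 'm) set"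
  where
  "module_diffops sc R act M = (\<Union>m. module_diffops_le sc R act M m)"


section \<open>The curve and the line bundle\<close>

definition A_ring :: "ratfun set \<Rightarrow> complex fls set" where
  "A_ring W = {f. \<forall>w\<in>W. f * rat_to_laurent w \<in> rat_to_laurent ` W}"

text \<open>The product of \<open>f\<close> and \<open>w\<close> in \<open>\<complex>((z\<^sup>-\<^sup>1))\<close>, as an element of \<open>\<complex>(z)\<close>; only
  used when it lies in the image of \<open>W\<close>.\<close>

definition A_act :: "complex fls \<Rightarrow> ratfun \<Rightarrow> ratfun" where
  "A_act f w = inv rat_to_laurent (f * rat_to_laurent w)"

text \<open>The curve \<open>Spec A\<^sub>W\<close> is affine, and the global differential operators on the sheaf
  associated to the \<open>A\<^sub>W\<close>-module \<open>W\<close> are the differential operators on that module.\<close>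

definition line_bundle_diffops :: "ratfun set \<Rightarrow> (ratfun \<Rightarrow> ratfun) set" where
  "line_bundle_diffops W = module_diffops (\<lambda>c f. rat_const c * f) (A_ring W) A_act W"

definition op_extends :: "ratfun set \<Rightarrow> (ratfun \<Rightarrow> ratfun) \<Rightarrow> diffop \<Rightarrow> bool" where
  "op_extends W \<phi> D \<longleftrightarrow> (\<forall>w\<in>W. op_apply D w = \<phi> w)"

definition canonical_embedding :: "ratfun set \<Rightarrow> (ratfun \<Rightarrow> ratfun) \<Rightarrow> diffop" where
  "canonical_embedding W \<phi> = (THE D. op_extends W \<phi> D)"

text \<open>The algebra structures are composition of maps on \<open>W\<close> and composition of differential
  operators.\<close>

definition is_algebra_hom_into_diffops ::
    "ratfun set \<Rightarrow> (ratfun \<Rightarrow> ratfun) set \<Rightarrow> ((ratfun \<Rightarrow> ratfun) \<Rightarrow> diffop) \<Rightarrow> bool" where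
  "is_algebra_hom_into_diffops W A h \<longleftrightarrow>
     h (\<lambda>w\<in>W. w) = 1 \<and>
     (\<forall>\<phi>\<in>A. \<forall>\<phi>'\<in>A. h (\<lambda>w\<in>W. \<phi> w + \<phi>' w) = h \<phi> + h \<phi>' \<and>
                    h (compose W \<phi> \<phi>') = op_mult (h \<phi>) (h \<phi>')) \<and>
     (\<forall>c. \<forall>\<phi>\<in>A. h (\<lambda>w\<in>W. rat_const c * \<phi> w) = smult (rat_const c) (h \<phi>))"

end

theory Submission
  imports Defs "HOL-Complex_Analysis.Complex_Analysis"
begin

text \<open>
  Let \<open>q = q_poly C\<close> and \<open>P = D_op C\<close>, so that \<open>W = q\<^sup>-\<^sup>1 V\<^sub>C\<close> and
  \<open>\<psi>(x,z) = q(z)\<^sup>-\<^sup>1 f\<^sub>x(z)\<close> with \<open>f\<^sub>x(z) = P\<cdot>e\<^sup>x\<^sup>z\<close>, a polynomial in \<open>z\<close> times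
  \<open>e\<^sup>x\<^sup>z\<close>.

  The equality of the Fourier algebra with the operators that preserve \<open>W\<close> holds because the
  functions \<open>f\<^sub>x\<close> and the polynomials in \<open>V\<^sub>C\<close> are equally good test functions: among all
  distributions, the elements of \<open>C\<close> are exactly those that kill \<open>V\<^sub>C\<close>
  (\<open>V_space_duality\<close>, finite-dimensional linear algebra), and also exactly those that kill
  \<open>f\<^sub>x\<close> for almost all \<open>x\<close> (\<open>wave_numerator_duality\<close>). The second
  statement holds because \<open>\<langle>\<xi>, f\<^sub>x\<rangle> = P\<cdot>\<langle>\<xi>, e\<^sup>x\<^sup>z\<rangle>\<close>, the kernel of \<open>P\<close> is by
  construction the set of functions \<open>\<langle>\<chi>, e\<^sup>x\<^sup>z\<rangle>\<close> with \<open>\<chi> \<in> C\<close>, and a distribution is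
  determined by its values on exponentials.

  Clear denominators in \<open>q R q\<^sup>-\<^sup>1 = b\<^sup>-\<^sup>1 T\<close>, where \<open>b\<close> and the coefficients of \<open>T\<close> are
  polynomials. Then \<open>R\<close> preserves \<open>W\<close> iff \<open>T V\<^sub>C \<subseteq> b V\<^sub>C\<close>. An entire function is \<open>b\<close> times
  an entire function killed by \<open>C\<close> iff it is killed by every distribution \<open>\<xi>\<close> with
  \<open>\<xi> \<circ> b \<in> C\<close> (\<open>divisible_with_killed_quotient\<close>). So \<open>R\<close> preserves \<open>W\<close> iff the transpose
  of \<open>T\<close> maps these \<open>\<xi>\<close> into \<open>C\<close>, and by the two dualities this can be tested on \<open>V\<^sub>C\<close>
  or on the \<open>f\<^sub>x\<close>. If it holds, then \<open>b\<^sup>-\<^sup>1 T f\<^sub>x\<close> is again a polynomial in \<open>z\<close> times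
  \<open>e\<^sup>x\<^sup>z\<close>, hence of the form \<open>G(x,\<partial>\<^sub>x)\<cdot>e\<^sup>x\<^sup>z\<close>; being killed by \<open>C\<close> it gives
  \<open>G\<cdot>\<langle>\<chi>, e\<^sup>x\<^sup>z\<rangle> = 0\<close> for \<open>\<chi> \<in> C\<close>, so \<open>G = S P\<close> is right divisible by \<open>P\<close>
  (\<open>D_op_properties\<close>), which says \<open>R\<cdot>\<psi> = S\<cdot>\<psi>\<close>. Conversely \<open>R\<cdot>\<psi> = S\<cdot>\<psi>\<close> shows at once
  that \<open>T f\<^sub>x\<close> is \<open>b\<close> times a function killed by \<open>C\<close>.

  The identification with the differential operators on the module \<open>W\<close> rests on the fact that
  \<open>W\<close> lies between \<open>g q\<^sup>-\<^sup>1 \<complex>[z]\<close> and \<open>q\<^sup>-\<^sup>1 \<complex>[z]\<close> for some \<open>g \<noteq> 0\<close>; then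
  \<open>g \<complex>[z] \<subseteq> A\<^sub>W\<close>. An operator on \<open>W\<close> becomes a linear map \<open>\<complex>[z] \<rightarrow> \<complex>(z)\<close> on which
  the commutators with \<open>g\<close> and \<open>g z\<close> are nilpotent. Since \<open>g\<close> is invertible in \<open>\<complex>(z)\<close>, the
  commutator with \<open>z\<close> is nilpotent too (\<open>poly_ad_nilpotent_localize\<close>), and then the map is a
  differential operator (\<open>poly_ad_nilpotent_imp_op\<close>), because bracketing with \<open>z\<close> is
  formal differentiation in the symbol \<open>\<partial>\<close> and can be integrated.
\<close>

section \<open>Values and derivatives of rational functions\<close>

text \<open>At a point without a pole evaluation is a ring homomorphism compatible with differentiation, and
  all but finitely many points are of this kind.\<close>

definition rat_regular :: "ratfun \<Rightarrow> complex \<Rightarrow> bool" where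
  "rat_regular r x \<longleftrightarrow> (\<exists>p q. poly q x \<noteq> 0 \<and> r = Fract p q)"

lemma rat_regularE:
  assumes "rat_regular r x"
  obtains p q where "poly q x \<noteq> 0" "q \<noteq> 0" "r = Fract p q"
  using assms unfolding rat_regular_def by fastforce

lemma rat_eval_Fract:
  assumes "poly q x \<noteq> 0"
  shows "rat_eval (Fract p q) x = poly p x / poly q x"
proof -
  obtain a b where ab: "quot_of_fract (Fract p q) = (a, b)" by (cases "quot_of_fract (Fract p q)")
  have co: "coprime a b" using coprime_quot_of_fract[of "Fract p q"] ab by simp
  have b0: "b \<noteq> 0" using snd_quot_of_fract_nonzero[of "Fract p q"] ab by simp
  have q0: "q \<noteq> 0" using assms by auto
  have "Fract a b = Fract p q" using Fract_quot_of_fract[of "Fract p q"] ab by simp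
  then have e: "a * q = p * b" using b0 q0 by (simp add: eq_fract)
  then have "b dvd a * q" by simp
  then have "b dvd q" using co by (simp add: coprime_commute coprime_dvd_mult_right_iff)
  then have bx: "poly b x \<noteq> 0" using assms by (auto elim!: dvdE)
  have "poly a x * poly q x = poly p x * poly b x" using e by (metis poly_mult)
  then show ?thesis using bx assms ab by (simp add: rat_eval_def frac_eq_eq)
qed

text \<open>The definition uses the representation in lowest terms; the quotient rule holds for every
  representation, which is what makes the derivation laws computable.\<close>

lemma rat_deriv_Fract:
  assumes "q \<noteq> 0"
  shows "rat_deriv (Fract p q) = Fract (pderiv p * q - p * pderiv q) (q * q)"
proof -
  obtain a b where ab: "quot_of_fract (Fract p q) = (a, b)" by (cases "quot_of_fract (Fract p q)")
  have b0: "b \<noteq> 0" using snd_quot_of_fract_nonzero[of "Fract p q"] ab by simp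
  have "Fract a b = Fract p q" using Fract_quot_of_fract[of "Fract p q"] ab by simp
  then have e: "a * q = p * b" using b0 assms by (simp add: eq_fract)
  then have e': "pderiv a * q + a * pderiv q = pderiv p * b + p * pderiv b"
    by (metis pderiv_mult add.commute mult.commute)
  have "(pderiv a * b - a * pderiv b) * (q * q) = (pderiv p * q - p * pderiv q) * (b * b)"
  proof -
    have "(pderiv a * b - a * pderiv b) * (q * q)
        = (pderiv a * q + a * pderiv q) * (b * q) - (a * q) * (b * pderiv q) - (a * q) * (pderiv b * q)"
      by (simp add: algebra_simps)
    also have "\<dots> = (pderiv p * b + p * pderiv b) * (b * q) - (p * b) * (b * pderiv q) - (p * b) * (pderiv b * q)"
      by (simp only: e e')
    also have "\<dots> = (pderiv p * q - p * pderiv q) * (b * b)"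
      by (simp add: algebra_simps)
    finally show ?thesis .
  qed
  then show ?thesis using ab b0 assms by (simp add: rat_deriv_def eq_fract)
qed

lemma rat_deriv_to_fract [simp]: "rat_deriv (to_fract p) = to_fract (pderiv p)"
  by (simp add: to_fract_def rat_deriv_Fract)

lemma rat_deriv_0 [simp]: "rat_deriv 0 = 0"
  using rat_deriv_to_fract[of 0] by (simp del: rat_deriv_to_fract)

lemma rat_deriv_1 [simp]: "rat_deriv 1 = 0"
  using rat_deriv_to_fract[of 1] by (simp del: rat_deriv_to_fract)

lemma rat_deriv_add: "rat_deriv (r + s) = rat_deriv r + rat_deriv s"
proof (cases r; cases s)
  fix a b c d assume "r = Fract a b" "b \<noteq> 0" "s = Fract c d" "d \<noteq> 0"
  then show ?thesis
    by (simp add: rat_deriv_Fract eq_fract pderiv_mult pderiv_add algebra_simps)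
qed

lemma rat_deriv_mult: "rat_deriv (r * s) = rat_deriv r * s + r * rat_deriv s"
proof (cases r; cases s)
  fix a b c d assume "r = Fract a b" "b \<noteq> 0" "s = Fract c d" "d \<noteq> 0"
  then show ?thesis
    by (simp add: rat_deriv_Fract eq_fract pderiv_mult pderiv_add algebra_simps)
qed

lemma rat_deriv_const [simp]: "rat_deriv (rat_const c) = 0"
  by (simp add: rat_const_def pderiv_pCons)

lemma rat_deriv_const_mult: "rat_deriv (rat_const c * r) = rat_const c * rat_deriv r"
  by (simp add: rat_deriv_mult)

lemma rat_deriv_minus: "rat_deriv (- r) = - rat_deriv r"
  using rat_deriv_add[of r "- r"] by (simp add: eq_neg_iff_add_eq_0 add.commute)

lemma rat_regular_Fract: "poly q x \<noteq> 0 \<Longrightarrow> rat_regular (Fract p q) x"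
  unfolding rat_regular_def by blast

lemma rat_regular_to_fract [simp]: "rat_regular (to_fract p) x"
  by (simp add: to_fract_def rat_regular_Fract)

lemma rat_regular_const [simp]: "rat_regular (rat_const c) x"
  by (simp add: rat_const_def)

lemma rat_eval_to_fract [simp]: "rat_eval (to_fract p) x = poly p x"
  by (simp add: to_fract_def rat_eval_Fract)

lemma rat_eval_const [simp]: "rat_eval (rat_const c) x = c"
  by (simp add: rat_const_def)

lemma rat_eval_0 [simp]: "rat_eval 0 x = 0"
  using rat_eval_to_fract[of 0] by (simp del: rat_eval_to_fract)

lemma rat_eval_1 [simp]: "rat_eval 1 x = 1"
  using rat_eval_to_fract[of 1] by (simp del: rat_eval_to_fract)

lemma rat_regular_0 [simp]: "rat_regular 0 x"
  using rat_regular_to_fract[of 0] by (simp del: rat_regular_to_fract)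

lemma rat_regular_1 [simp]: "rat_regular 1 x"
  using rat_regular_to_fract[of 1] by (simp del: rat_regular_to_fract)

lemma
  assumes "rat_regular r x" "rat_regular s x"
  shows rat_regular_add: "rat_regular (r + s) x"
    and rat_eval_add: "rat_eval (r + s) x = rat_eval r x + rat_eval s x"
    and rat_regular_mult: "rat_regular (r * s) x"
    and rat_eval_mult: "rat_eval (r * s) x = rat_eval r x * rat_eval s x"
proof -
  obtain a b where 1: "poly b x \<noteq> 0" "b \<noteq> 0" "r = Fract a b" using assms(1) by (rule rat_regularE)
  obtain c d where 2: "poly d x \<noteq> 0" "d \<noteq> 0" "s = Fract c d" using assms(2) by (rule rat_regularE)
  have 3: "poly (b * d) x \<noteq> 0" using 1 2 by simp
  show "rat_regular (r + s) x" "rat_regular (r * s) x"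
    using 1 2 3 by (simp_all add: rat_regular_Fract)
  show "rat_eval (r + s) x = rat_eval r x + rat_eval s x"
    "rat_eval (r * s) x = rat_eval r x * rat_eval s x"
    using 1 2 3 by (simp_all add: rat_eval_Fract add_frac_eq)
qed

lemma rat_regular_deriv:
  assumes "rat_regular r x" shows "rat_regular (rat_deriv r) x"
proof -
  obtain a b where 1: "poly b x \<noteq> 0" "b \<noteq> 0" "r = Fract a b" using assms by (rule rat_regularE)
  then show ?thesis by (simp add: rat_deriv_Fract rat_regular_Fract)
qed

lemma rat_regular_inverse:
  assumes "rat_regular r x" "rat_eval r x \<noteq> 0"
  shows "rat_regular (inverse r) x"
proof -
  obtain a b where 1: "poly b x \<noteq> 0" "b \<noteq> 0" "r = Fract a b" using assms(1) by (rule rat_regularE)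
  then show ?thesis using assms(2) by (simp add: rat_eval_Fract rat_regular_Fract)
qed

lemma rat_eval_inverse:
  assumes "rat_regular r x" "rat_eval r x \<noteq> 0"
  shows "rat_eval (inverse r) x = inverse (rat_eval r x)"
proof -
  obtain a b where 1: "poly b x \<noteq> 0" "b \<noteq> 0" "r = Fract a b" using assms(1) by (rule rat_regularE)
  then show ?thesis using assms(2) by (simp add: rat_eval_Fract)
qed

lemma finite_not_rat_regular: "finite {x. \<not> rat_regular r x}"
proof (cases r)
  case (Fract a b)
  then have "{x. \<not> rat_regular r x} \<subseteq> {x. poly b x = 0}" using rat_regular_Fract by auto
  then show ?thesis using poly_roots_finite[OF \<open>b \<noteq> 0\<close>] finite_subset by blast
qed

lemma open_rat_regular: "open {x. rat_regular r x}"
proof -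
  have "closed {x. \<not> rat_regular r x}" by (intro finite_imp_closed finite_not_rat_regular)
  moreover have "{x. rat_regular r x} = - {x. \<not> rat_regular r x}" by auto
  ultimately show ?thesis by (simp add: closed_def)
qed

lemma finite_rat_zeros:
  assumes "r \<noteq> 0" shows "finite {x. rat_eval r x = 0}"
proof (cases r)
  case (Fract a b)
  then have "a \<noteq> 0" using assms by (auto simp: fract_collapse)
  have "{x. rat_eval r x = 0} \<subseteq> {x. poly b x = 0} \<union> {x. poly a x = 0}"
  proof safe
    fix x assume "rat_eval r x = 0" "poly a x \<noteq> 0"
    then show "poly b x = 0" using rat_eval_Fract[of b x a] Fract(1) by force
  qed
  then show ?thesis
    using poly_roots_finite[OF \<open>b \<noteq> 0\<close>] poly_roots_finite[OF \<open>a \<noteq> 0\<close>] finite_subset by blast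
qed

lemma ratfun_eq_0I:
  assumes "finite F" "\<And>x. x \<notin> F \<Longrightarrow> rat_eval r x = 0"
  shows "r = 0"
proof (rule ccontr)
  assume "r \<noteq> 0"
  then have "finite {x. rat_eval r x = 0}" by (rule finite_rat_zeros)
  moreover have "UNIV = F \<union> {x. rat_eval r x = 0}" using assms(2) by auto
  ultimately have "finite (UNIV :: complex set)" using assms(1) by (metis finite_UnI)
  then show False by (simp add: infinite_UNIV_char_0)
qed

lemma has_field_derivative_rat_eval:
  assumes "rat_regular r x"
  shows "(rat_eval r has_field_derivative rat_eval (rat_deriv r) x) (at x)"
proof -
  obtain a b where 1: "poly b x \<noteq> 0" "b \<noteq> 0" "r = Fract a b" using assms by (rule rat_regularE)
  have "open {y. poly b y \<noteq> 0}" by (intro open_Collect_neq continuous_intros)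
  then have ev: "\<forall>\<^sub>F y in nhds x. rat_eval r y = poly a y / poly b y"
    using 1 by (auto simp: eventually_nhds rat_eval_Fract)
  have e: "rat_eval (rat_deriv r) x
      = (poly (pderiv a) x * poly b x - poly a x * poly (pderiv b) x) / (poly b x * poly b x)"
    using 1 by (simp add: rat_deriv_Fract rat_eval_Fract)
  have "((\<lambda>y. poly a y / poly b y) has_field_derivative
     rat_eval (rat_deriv r) x) (at x)"
    unfolding e using 1(1) by (intro DERIV_divide poly_DERIV)
  then show ?thesis using ev by (simp add: DERIV_cong_ev[OF refl ev refl])
qed

lemma rat_eval_sum:
  assumes "\<And>i. i \<in> A \<Longrightarrow> rat_regular (f i) x"
  shows "rat_regular (\<Sum>i\<in>A. f i) x \<and> rat_eval (\<Sum>i\<in>A. f i) x = (\<Sum>i\<in>A. rat_eval (f i) x)"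
  using assms
  by (induction A rule: infinite_finite_induct) (auto simp: rat_regular_add rat_eval_add)

lemma to_fract_of_nat: "to_fract (of_nat n) = of_nat n"
  by (induction n) auto

lemma of_nat_ratfun_eq_0_iff [simp]: "(of_nat n :: ratfun) = 0 \<longleftrightarrow> n = 0"
  by (metis of_nat_eq_0_iff of_nat_0 to_fract_eq_0_iff to_fract_of_nat)

section \<open>The embedding into Laurent series\<close>

lemma poly_to_laurent_pCons:
  "poly_to_laurent (pCons a p) = fls_const a + fls_X_inv * poly_to_laurent p"
  by (simp add: poly_to_laurent_def map_poly_pCons)

lemma poly_to_laurent_0 [simp]: "poly_to_laurent 0 = 0"
  by (simp add: poly_to_laurent_def)

lemma poly_to_laurent_add: "poly_to_laurent (p + q) = poly_to_laurent p + poly_to_laurent q"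
proof (induction p q rule: poly_induct2)
  case (pCons a p b q)
  then show ?case by (simp add: poly_to_laurent_pCons fls_plus_const[symmetric] algebra_simps del: fls_plus_const)
qed simp

lemma poly_to_laurent_smult: "poly_to_laurent (smult c p) = fls_const c * poly_to_laurent p"
  by (induction p) (simp_all add: poly_to_laurent_pCons fls_const_mult_const[symmetric] algebra_simps del: fls_const_mult_const)

lemma poly_to_laurent_mult: "poly_to_laurent (p * q) = poly_to_laurent p * poly_to_laurent q"
  by (induction p)
    (simp_all add: poly_to_laurent_pCons poly_to_laurent_add poly_to_laurent_smult algebra_simps)

text \<open>The coefficients of the polynomial can be read off, so the embedding is injective. As the
  series variable is \<open>z\<^sup>-\<^sup>1\<close>, the coefficient of \<open>z\<^sup>n\<close> sits at index \<open>-n\<close>.\<close>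

lemma poly_to_laurent_nth:
  "fls_nth (poly_to_laurent p) k = (if k \<le> 0 then coeff p (nat (- k)) else 0)"
proof (induction p arbitrary: k)
  case 0 then show ?case by simp
next
  case (pCons a p)
  show ?case using pCons.IH[of "k + 1"]
    by (auto simp: poly_to_laurent_pCons fls_X_inv_times_conv_shift coeff_pCons nat_diff_distrib'
        split: nat.splits)
qed

lemma poly_to_laurent_inj: "poly_to_laurent p = poly_to_laurent q \<Longrightarrow> p = q"
proof (rule poly_eqI)
  fix n assume "poly_to_laurent p = poly_to_laurent q"
  then show "coeff p n = coeff q n"
    using poly_to_laurent_nth[of p "- int n"] poly_to_laurent_nth[of q "- int n"] by simp
qed

lemma poly_to_laurent_eq_0_iff [simp]: "poly_to_laurent p = 0 \<longleftrightarrow> p = 0"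
  using poly_to_laurent_inj[of p 0] by auto

lemma rat_to_laurent_Fract:
  assumes "q \<noteq> 0"
  shows "rat_to_laurent (Fract p q) = poly_to_laurent p / poly_to_laurent q"
proof -
  obtain a b where ab: "quot_of_fract (Fract p q) = (a, b)" by (cases "quot_of_fract (Fract p q)")
  have b0: "b \<noteq> 0" using snd_quot_of_fract_nonzero[of "Fract p q"] ab by simp
  have "Fract a b = Fract p q" using Fract_quot_of_fract[of "Fract p q"] ab by simp
  then have "a * q = p * b" using b0 assms by (simp add: eq_fract)
  then have "poly_to_laurent a * poly_to_laurent q = poly_to_laurent p * poly_to_laurent b"
    by (metis poly_to_laurent_mult)
  then show ?thesis using ab b0 assms by (simp add: rat_to_laurent_def frac_eq_eq)
qed

lemma rat_to_laurent_mult: "rat_to_laurent (r * s) = rat_to_laurent r * rat_to_laurent s"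
proof (cases r; cases s)
  fix a b c d assume "r = Fract a b" "b \<noteq> 0" "s = Fract c d" "d \<noteq> 0"
  then show ?thesis by (simp add: rat_to_laurent_Fract poly_to_laurent_mult)
qed

lemma inj_rat_to_laurent: "inj rat_to_laurent"
proof (rule injI)
  fix r s assume e: "rat_to_laurent r = rat_to_laurent s"
  obtain a b where 1: "r = Fract a b" "b \<noteq> 0" by (cases r)
  obtain c d where 2: "s = Fract c d" "d \<noteq> 0" by (cases s)
  have "poly_to_laurent a * poly_to_laurent d = poly_to_laurent c * poly_to_laurent b"
    using e 1 2 by (simp add: rat_to_laurent_Fract frac_eq_eq)
  then have "a * d = c * b" by (metis poly_to_laurent_inj poly_to_laurent_mult)
  then show "r = s" using 1 2 by (simp add: eq_fract)
qed

lemma A_act_rat_to_laurent: "A_act (rat_to_laurent a) w = a * w"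
  unfolding A_act_def rat_to_laurent_mult[symmetric] by (simp add: inj_rat_to_laurent)

section \<open>The algebra of differential operators\<close>

lemma op_apply_upto:
  assumes "degree D \<le> n"
  shows "op_apply D f = (\<Sum>i\<le>n. coeff D i * (rat_deriv ^^ i) f)"
  unfolding op_apply_def using assms
  by (intro sum.mono_neutral_left) (auto simp: coeff_eq_0)

lemma op_apply_0 [simp]: "op_apply 0 f = 0"
  by (simp add: op_apply_def)

lemma op_apply_add: "op_apply (D + E) f = op_apply D f + op_apply E f"
proof -
  define n where "n = max (degree D) (degree E)"
  have "degree (D + E) \<le> n" by (simp add: n_def degree_add_le_max)
  then show ?thesis
    using op_apply_upto[of D n f] op_apply_upto[of E n f] op_apply_upto[of "D + E" n f]
    by (simp add: n_def sum.distrib algebra_simps)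
qed

lemma op_apply_smult: "op_apply (smult r D) f = r * op_apply D f"
  using op_apply_upto[of "smult r D" "degree D" f]
  by (simp add: op_apply_def sum_distrib_left mult.assoc)

lemma op_apply_minus: "op_apply (- D) f = - op_apply D f"
  using op_apply_smult[of "-1" D f] by simp

lemma op_apply_diff: "op_apply (D - E) f = op_apply D f - op_apply E f"
  using op_apply_add[of D "- E" f] by (simp add: op_apply_minus)

lemma op_apply_sum: "op_apply (\<Sum>i\<in>A. D i) f = (\<Sum>i\<in>A. op_apply (D i) f)"
  by (induction A rule: infinite_finite_induct) (auto simp: op_apply_add)

lemma op_apply_pCons: "op_apply (pCons r D) f = r * f + op_apply D (rat_deriv f)"
proof -
  have "op_apply (pCons r D) f = (\<Sum>i\<le>Suc (degree D). coeff (pCons r D) i * (rat_deriv ^^ i) f)"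
    by (intro op_apply_upto degree_pCons_le)
  also have "\<dots> = r * f + (\<Sum>i\<le>degree D. coeff D i * (rat_deriv ^^ Suc i) f)"
    by (subst sum.atMost_Suc_shift) simp
  finally show ?thesis by (simp add: op_apply_def funpow_swap1)
qed

lemma op_apply_1 [simp]: "op_apply 1 f = f"
  by (simp add: one_pCons op_apply_pCons)

lemma op_apply_add_right: "op_apply D (f + g) = op_apply D f + op_apply D g"
  by (induction D arbitrary: f g) (auto simp: op_apply_pCons rat_deriv_add algebra_simps)

lemma op_apply_const_mult: "op_apply D (rat_const c * f) = rat_const c * op_apply D f"
  by (induction D arbitrary: f) (auto simp: op_apply_pCons rat_deriv_const_mult distrib_left mult.left_commute)

lemma op_apply_minus_right: "op_apply D (- f) = - op_apply D f"
  by (induction D arbitrary: f) (auto simp: op_apply_pCons rat_deriv_minus algebra_simps)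

lemma op_apply_diff_right: "op_apply D (f - g) = op_apply D f - op_apply D g"
  using op_apply_add_right[of D f "- g"] by (simp add: op_apply_minus_right)

lemma op_apply_0_right [simp]: "op_apply D 0 = 0"
  using op_apply_diff_right[of D 0 0] by simp

lemma coeff_op_partial_mult:
  "coeff (op_partial_mult E) i = rat_deriv (coeff E i) + coeff (pCons 0 E) i"
  by (simp add: op_partial_mult_def coeff_map_poly)

lemma op_partial_mult_pCons:
  "op_partial_mult (pCons r E) = pCons (rat_deriv r) (pCons r 0 + op_partial_mult E)"
  by (rule poly_eqI) (auto simp: coeff_op_partial_mult coeff_pCons split: nat.splits)

lemma op_apply_partial_mult: "op_apply (op_partial_mult E) f = rat_deriv (op_apply E f)"
proof (induction E arbitrary: f)
  case 0
  then show ?case by (simp add: op_partial_mult_def)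
next
  case (pCons r E)
  then show ?case
    by (simp add: op_partial_mult_pCons op_apply_pCons op_apply_add rat_deriv_add rat_deriv_mult)
qed

lemma op_apply_partial_mult_funpow:
  "op_apply ((op_partial_mult ^^ i) E) f = (rat_deriv ^^ i) (op_apply E f)"
  by (induction i) (auto simp: op_apply_partial_mult)

lemma op_apply_mult: "op_apply (op_mult D E) f = op_apply D (op_apply E f)"
  by (simp add: op_mult_def op_apply_sum op_apply_smult op_apply_partial_mult_funpow)
    (simp add: op_apply_def)

lemma rat_deriv_funpow_monom:
  "(rat_deriv ^^ i) (to_fract (monom 1 n)) = to_fract ((pderiv ^^ i) (monom 1 n))"
  by (induction i) auto

lemma pderiv_funpow_monom:
  "(pderiv ^^ i) (monom 1 n :: complex poly) = (if i \<le> n then monom (fact n / fact (n - i)) (n - i) else 0)"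
proof (induction i)
  case 0 then show ?case by simp
next
  case (Suc i)
  show ?case
  proof (cases "Suc i \<le> n")
    case True
    then have "n - i = Suc (n - Suc i)" by simp
    then have f: "(fact (n - i) :: complex) = of_nat (n - i) * fact (n - Suc i)"
      by (simp only: fact_Suc)
    have "(of_nat (n - i) :: complex) \<noteq> 0" using True by simp
    then show ?thesis using True Suc by (simp add: pderiv_monom f del: of_nat_diff)
  next
    case False
    then show ?thesis using Suc by (cases "i = n") (auto simp: pderiv_monom)
  qed
qed

text \<open>An operator is determined by its action on polynomials: if \<open>n\<close> is the least index with a nonzero
  coefficient, then \<open>z\<^sup>n\<close> only sees that coefficient. Consequently the laws of
  composition, stated next, follow from those for composition of maps.\<close>

lemma op_eq_0I:
  assumes "\<And>p. op_apply D (to_fract p) = 0"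
  shows "D = 0"
proof (rule ccontr)
  assume D: "D \<noteq> 0"
  define n where "n = (LEAST i. coeff D i \<noteq> 0)"
  have n: "coeff D n \<noteq> 0"
    unfolding n_def by (rule LeastI[of _ "degree D"]) (use D in simp)
  have less: "coeff D i = 0" if "i < n" for i
    using not_less_Least[of i "\<lambda>i. coeff D i \<noteq> 0"] that unfolding n_def by blast
  have nd: "n \<le> degree D" using n by (rule le_degree)
  have t: "(if i = n then coeff D i * to_fract [:fact n:] else 0)
      = coeff D i * (rat_deriv ^^ i) (to_fract (monom 1 n))" for i
    using less[of i] by (auto simp: rat_deriv_funpow_monom pderiv_funpow_monom monom_0)
  have "coeff D n * to_fract [:fact n:] = op_apply D (to_fract (monom 1 n))"
    unfolding op_apply_def t[symmetric] using nd by simp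
  then show False using assms n by simp
qed

lemma op_eqI:
  assumes "\<And>f. op_apply D f = op_apply E f"
  shows "D = E"
proof -
  have "D - E = 0" by (rule op_eq_0I) (simp add: op_apply_diff assms)
  then show ?thesis by simp
qed

lemma op_mult_assoc: "op_mult (op_mult A B) D = op_mult A (op_mult B D)"
  by (rule op_eqI) (simp add: op_apply_mult)

lemma op_mult_add_left: "op_mult (A + B) D = op_mult A D + op_mult B D"
  by (rule op_eqI) (simp add: op_apply_mult op_apply_add)

lemma op_mult_smult_left: "op_mult (smult r A) B = smult r (op_mult A B)"
  by (rule op_eqI) (simp add: op_apply_mult op_apply_smult)

lemma op_mult_1_right [simp]: "op_mult D 1 = D"
  by (rule op_eqI) (simp add: op_apply_mult)

lemma op_mult_0_left [simp]: "op_mult 0 D = 0"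
  by (rule op_eqI) (simp add: op_apply_mult)

lemma op_mult_0_right [simp]: "op_mult D 0 = 0"
  by (rule op_eqI) (simp add: op_apply_mult)

lemma op_mult_fun_left: "op_mult [:r:] D = smult r D"
  by (rule op_eqI) (simp add: op_apply_mult op_apply_pCons op_apply_smult)

text \<open>Composing with \<open>\<partial>\<close> on the left raises the order by one and keeps the leading coefficient.\<close>

lemma coeff_op_partial_mult_funpow:
  "(i + degree E < n \<longrightarrow> coeff ((op_partial_mult ^^ i) E) n = 0) \<and>
    coeff ((op_partial_mult ^^ i) E) (i + degree E) = lead_coeff E"
proof (induction i arbitrary: n)
  case 0 then show ?case by (simp add: coeff_eq_0)
next
  case (Suc i)
  show ?case
  proof
    show "Suc i + degree E < n \<longrightarrow> coeff ((op_partial_mult ^^ Suc i) E) n = 0"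
    proof
      assume "Suc i + degree E < n"
      then obtain k where "n = Suc k" "i + degree E < k" by (cases n) auto
      then show "coeff ((op_partial_mult ^^ Suc i) E) n = 0"
        using Suc[of k] Suc[of n] by (simp add: coeff_op_partial_mult)
    qed
    show "coeff ((op_partial_mult ^^ Suc i) E) (Suc i + degree E) = lead_coeff E"
      using Suc[of "Suc (i + degree E)"] by (simp add: coeff_op_partial_mult)
  qed
qed

lemma coeff_op_mult_top:
  "coeff (op_mult D E) (degree D + degree E) = lead_coeff D * lead_coeff E"
proof -
  have t: "lead_coeff D * lead_coeff E * (if i = degree D then 1 else 0)
      = coeff D i * coeff ((op_partial_mult ^^ i) E) (degree D + degree E)" if "i \<le> degree D" for i
    using coeff_op_partial_mult_funpow[of i E "degree D + degree E"] that by auto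
  have "coeff (op_mult D E) (degree D + degree E)
      = (\<Sum>i\<le>degree D. coeff D i * coeff ((op_partial_mult ^^ i) E) (degree D + degree E))"
    by (simp add: op_mult_def coeff_sum)
  also have "\<dots> = (\<Sum>i\<le>degree D. lead_coeff D * lead_coeff E * (if i = degree D then 1 else 0))"
    by (intro sum.cong refl) (simp only: atMost_iff t[symmetric])
  finally show ?thesis by (simp add: sum_distrib_left[symmetric])
qed

lemma degree_op_mult_le: "degree (op_mult D E) \<le> degree D + degree E"
proof (rule degree_le, intro allI impI)
  fix n assume "degree D + degree E < n"
  then show "coeff (op_mult D E) n = 0"
    using coeff_op_partial_mult_funpow[of _ E n]
    by (simp add: op_mult_def coeff_sum)
qed

lemma degree_op_mult: "D \<noteq> 0 \<Longrightarrow> E \<noteq> 0 \<Longrightarrow> degree (op_mult D E) = degree D + degree E"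
  using coeff_op_mult_top[of D E] degree_op_mult_le[of D E]
  by (metis le_antisym le_degree leading_coeff_0_iff mult_eq_0_iff)

text \<open>Multiplication by a nonzero function is an invertible operator.\<close>

lemma op_mult_right_cancel_fun:
  assumes "r \<noteq> 0" "op_mult D [:r:] = op_mult E [:r:]"
  shows "D = E"
proof -
  have "op_mult [:r:] [:inverse r:] = 1" using assms(1) by (simp add: op_mult_fun_left one_pCons)
  then show ?thesis using assms(2) by (metis op_mult_assoc op_mult_1_right)
qed

lemma op_eqI_on_multiples:
  assumes "r \<noteq> 0" "\<And>p. op_apply D (r * to_fract p) = op_apply E (r * to_fract p)"
  shows "D = E"
proof -
  have "op_mult (D - E) [:r:] = 0"
    by (rule op_eq_0I) (simp add: op_apply_mult op_apply_diff op_apply_pCons assms(2))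
  then have "op_mult (D - E) [:r:] = op_mult 0 [:r:]" by simp
  then have "D - E = 0" by (rule op_mult_right_cancel_fun[OF assms(1)])
  then show ?thesis by simp
qed

text \<open>The operators with such a representation are closed under sums, left multiplication by functions
  and left composition with \<open>\<partial>\<close>: from \<open>E = Q L + c\<close> and \<open>\<partial> = L - u\<close> one gets
  \<open>\<partial> E = (\<partial> Q + c) L + (c' - c u)\<close>.\<close>

lemma op_right_division_first_order:
  "\<exists>Q c. E = op_mult Q [:u, 1:] + [:c:]"
proof -
  let ?ok = "\<lambda>E. \<exists>Q c. E = op_mult Q [:u, 1:] + [:c:]"
  have add: "?ok (A + B)" if A: "?ok A" and B: "?ok B" for A B
  proof -
    obtain Q c where "A = op_mult Q [:u, 1:] + [:c:]" using A by blast
    moreover obtain Q' c' where "B = op_mult Q' [:u, 1:] + [:c':]" using B by blast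
    ultimately have "A + B = op_mult (Q + Q') [:u, 1:] + [:c + c':]"
      by (simp add: op_mult_add_left)
    then show ?thesis by blast
  qed
  have smult: "?ok (smult r A)" if "?ok A" for A r
    using that by (metis op_mult_smult_left smult_add_right smult_pCons smult_0_right)
  have funpow: "?ok ((op_partial_mult ^^ i) 1)" for i
  proof (induction i)
    case 0
    show ?case by (intro exI[of _ 0] exI[of _ 1]) (simp add: one_pCons)
  next
    case (Suc i)
    then obtain Q c where e: "(op_partial_mult ^^ i) 1 = op_mult Q [:u, 1:] + [:c:]" by blast
    have "(op_partial_mult ^^ Suc i) 1 = op_mult (op_partial_mult Q + [:c:]) [:u, 1:] + [:rat_deriv c - c * u:]"
      by (rule op_eqI)
        (simp add: e op_apply_partial_mult op_apply_mult op_apply_add op_apply_pCons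
          rat_deriv_add rat_deriv_mult algebra_simps)
    then show ?case by blast
  qed
  have "?ok (\<Sum>i\<in>A. smult (coeff E i) ((op_partial_mult ^^ i) 1))" for A
  proof (induction A rule: infinite_finite_induct)
    case (infinite A)
    then show ?case by (intro exI[of _ 0] exI[of _ 0]) simp
  next
    case empty
    show ?case by (intro exI[of _ 0] exI[of _ 0]) simp
  next
    case (insert i A)
    show ?case unfolding sum.insert[OF insert.hyps] by (intro add smult funpow insert.IH)
  qed
  then have "?ok (op_mult E 1)" unfolding op_mult_def .
  then show ?thesis by simp
qed

text \<open>The bracket with \<open>z\<close> is the formal derivative with respect to \<open>\<partial>\<close>.\<close>

lemma op_apply_X_mult:
  "op_apply D (to_fract [:0, 1:] * f) = to_fract [:0, 1:] * op_apply D f + op_apply (pderiv D) f"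
proof (induction D arbitrary: f)
  case 0 then show ?case by simp
next
  case (pCons r D)
  have "rat_deriv (to_fract [:0, 1:] * f) = f + to_fract [:0, 1:] * rat_deriv f"
    by (simp add: rat_deriv_mult pderiv_pCons one_pCons[symmetric])
  then show ?case
    by (simp add: op_apply_pCons pCons.IH op_apply_add_right op_apply_add pderiv_pCons
        distrib_left mult.left_commute del: to_fract_mult)
qed

text \<open>Formal integration with respect to \<open>\<partial>\<close>; possible since the coefficients have characteristic 0.\<close>

lemma ex_pderiv_eq: "\<exists>D. pderiv D = (E :: ratfun poly)"
proof -
  define D where "D = (\<Sum>i\<le>degree E. monom (coeff E i / of_nat (Suc i)) (Suc i))"
  have "coeff D (Suc n) = coeff E n / of_nat (Suc n)" for n
    by (auto simp: D_def coeff_sum coeff_eq_0 simp del: of_nat_Suc)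
  then have "coeff (pderiv D) n = coeff E n" for n
    by (simp add: coeff_pderiv del: of_nat_Suc)
  then show ?thesis by (blast intro: poly_eqI)
qed

definition op_ad :: "ratfun \<Rightarrow> diffop \<Rightarrow> diffop" where
  "op_ad a D = smult a D - op_mult D [:a:]"

lemma op_apply_ad: "op_apply (op_ad a D) f = a * op_apply D f - op_apply D (a * f)"
  by (simp add: op_ad_def op_apply_diff op_apply_smult op_apply_mult op_apply_pCons)

text \<open>The leading coefficients of \<open>a D\<close> and \<open>D a\<close> agree, so a commutator with a function has lower
  order; this is why differential operators in the usual sense are differential operators on modules.\<close>

lemma degree_op_ad: "op_ad a D = 0 \<or> degree (op_ad a D) < degree D"
proof (cases "D = 0 \<or> a = 0")
  case True
  then show ?thesis by (auto simp: op_ad_def)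
next
  case False
  have "coeff (op_ad a D) n = 0" if "degree D \<le> n" for n
  proof (cases "n = degree D")
    case True
    then show ?thesis using coeff_op_mult_top[of D "[:a:]"] by (simp add: op_ad_def)
  next
    case False
    then have "degree (op_mult D [:a:]) < n" "degree D < n"
      using that degree_op_mult_le[of D "[:a:]"] by auto
    then show ?thesis by (simp add: op_ad_def coeff_eq_0)
  qed
  then show ?thesis
    by (metis leading_coeff_0_iff linorder_not_le)
qed

lemma op_ad_nilpotent: "degree D < k \<Longrightarrow> (op_ad a ^^ k) D = 0"
proof (induction k arbitrary: D)
  case 0 then show ?case by simp
next
  case (Suc k)
  have z: "(op_ad a ^^ k) 0 = 0" for k by (induction k) (auto simp: op_ad_def)
  consider "op_ad a D = 0" | "degree (op_ad a D) < degree D" using degree_op_ad by blast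
  then show ?case
  proof cases
    case 1 then show ?thesis using z by (simp add: funpow_swap1)
  next
    case 2
    then have "(op_ad a ^^ k) (op_ad a D) = 0" using Suc by simp
    then show ?thesis by (simp add: funpow_swap1)
  qed
qed

section \<open>Differential operators acting on analytic functions\<close>

definition op_regular :: "diffop \<Rightarrow> complex \<Rightarrow> bool" where
  "op_regular D x \<longleftrightarrow> (\<forall>i. rat_regular (coeff D i) x)"

lemma op_regular_0 [simp]: "op_regular 0 x"
  by (simp add: op_regular_def)

lemma op_regular_pCons: "op_regular (pCons r D) x \<longleftrightarrow> rat_regular r x \<and> op_regular D x"
proof
  assume *: "op_regular (pCons r D) x"
  show "rat_regular r x \<and> op_regular D x"
    unfolding op_regular_def
  proof (intro conjI allI)
    show "rat_regular r x" using * unfolding op_regular_def by (metis coeff_pCons_0)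
    show "rat_regular (coeff D i) x" for i
      using * unfolding op_regular_def by (metis coeff_pCons_Suc)
  qed
qed (auto simp: op_regular_def coeff_pCons split: nat.splits)

lemma op_regular_1 [simp]: "op_regular 1 x"
  by (simp add: one_pCons op_regular_pCons)

lemma op_regular_add: "op_regular D x \<Longrightarrow> op_regular E x \<Longrightarrow> op_regular (D + E) x"
  by (simp add: op_regular_def rat_regular_add)

lemma op_regular_smult: "rat_regular r x \<Longrightarrow> op_regular E x \<Longrightarrow> op_regular (smult r E) x"
  by (simp add: op_regular_def rat_regular_mult)

lemma op_regular_partial_mult: "op_regular E x \<Longrightarrow> op_regular (op_partial_mult E) x"
  by (auto simp: op_regular_def coeff_op_partial_mult coeff_pCons rat_regular_deriv
      intro!: rat_regular_add split: nat.splits)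

lemma op_regular_funpow: "op_regular E x \<Longrightarrow> op_regular ((op_partial_mult ^^ i) E) x"
  by (induction i) (auto simp: op_regular_partial_mult)

lemma op_regular_sum: "(\<And>i. i \<in> A \<Longrightarrow> op_regular (D i) x) \<Longrightarrow> op_regular (\<Sum>i\<in>A. D i) x"
  by (induction A rule: infinite_finite_induct) (auto simp: op_regular_add)

lemma op_regular_mult: "op_regular D x \<Longrightarrow> op_regular E x \<Longrightarrow> op_regular (op_mult D E) x"
  unfolding op_mult_def
  by (intro op_regular_sum op_regular_smult op_regular_funpow) (auto simp: op_regular_def)

lemma finite_not_op_regular: "finite {x. \<not> op_regular D x}"
proof -
  have "{x. \<not> op_regular D x} \<subseteq> (\<Union>i\<le>degree D. {x. \<not> rat_regular (coeff D i) x})"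
    by (auto simp: op_regular_def) (metis atMost_iff coeff_eq_0 linorder_not_le rat_regular_0)
  then show ?thesis by (rule finite_subset) (auto intro: finite_not_rat_regular)
qed

lemma eventually_op_regular: "op_regular D x \<Longrightarrow> \<forall>\<^sub>F y in nhds x. op_regular D y"
proof -
  assume *: "op_regular D x"
  have "closed {x. \<not> op_regular D x}" by (intro finite_imp_closed finite_not_op_regular)
  then have "open (- {x. \<not> op_regular D x})" by (simp add: closed_def)
  moreover have "x \<in> - {x. \<not> op_regular D x}" using * by simp
  ultimately show ?thesis unfolding eventually_nhds by blast
qed

lemma eventually_analytic_at: 
  "f analytic_on {x} \<Longrightarrow> \<forall>\<^sub>F y in nhds x. f analytic_on {y :: complex}"
  unfolding analytic_at eventually_nhds by blast

lemma analytic_rat_eval: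
  assumes "rat_regular r x" shows "rat_eval r analytic_on {x}"
proof -
  have "rat_eval r holomorphic_on {x. rat_regular r x}"
    using open_rat_regular by (subst holomorphic_on_open) (auto intro: has_field_derivative_rat_eval)
  then show ?thesis using open_rat_regular assms unfolding analytic_at by blast
qed

lemma op_eval_0 [simp]: "op_eval 0 f x = 0"
  by (simp add: op_eval_def)

lemma op_eval_upto:
  assumes "degree D \<le> n"
  shows "op_eval D f x = (\<Sum>i\<le>n. rat_eval (coeff D i) x * (deriv ^^ i) f x)"
  unfolding op_eval_def using assms
  by (intro sum.mono_neutral_left) (auto simp: coeff_eq_0)

lemma op_eval_pCons: "op_eval (pCons r D) f x = rat_eval r x * f x + op_eval D (deriv f) x"
proof -
  have "op_eval (pCons r D) f x
      = (\<Sum>i\<le>Suc (degree D). rat_eval (coeff (pCons r D) i) x * (deriv ^^ i) f x)"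
    by (intro op_eval_upto degree_pCons_le)
  also have "\<dots> = rat_eval r x * f x
      + (\<Sum>i\<le>degree D. rat_eval (coeff D i) x * (deriv ^^ Suc i) f x)"
    by (subst sum.atMost_Suc_shift) simp
  finally show ?thesis by (simp add: op_eval_def funpow_swap1)
qed

lemma op_eval_1 [simp]: "op_eval 1 f x = f x"
  by (simp add: one_pCons op_eval_pCons)

lemma op_eval_add:
  assumes "op_regular D x" "op_regular E x"
  shows "op_eval (D + E) f x = op_eval D f x + op_eval E f x"
proof -
  define n where "n = max (degree D) (degree E)"
  have "degree (D + E) \<le> n" by (simp add: n_def degree_add_le_max)
  then show ?thesis
    using op_eval_upto[of D n f] op_eval_upto[of E n f] op_eval_upto[of "D + E" n f] assms
    by (simp add: n_def sum.distrib algebra_simps rat_eval_add op_regular_def)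
qed

lemma op_eval_smult:
  assumes "rat_regular r x" "op_regular D x"
  shows "op_eval (smult r D) f x = rat_eval r x * op_eval D f x"
  using op_eval_upto[of "smult r D" "degree D" f] assms
  by (simp add: op_eval_def sum_distrib_left mult.assoc rat_eval_mult op_regular_def)

lemma op_eval_sum:
  assumes "\<And>i. i \<in> A \<Longrightarrow> op_regular (D i) x"
  shows "op_eval (\<Sum>i\<in>A. D i) f x = (\<Sum>i\<in>A. op_eval (D i) f x)"
  using assms
  by (induction A rule: infinite_finite_induct) (auto simp: op_eval_add op_regular_sum)

text \<open>Only the germ of the function at the point matters.\<close>

lemma op_eval_cong_ev:
  "\<forall>\<^sub>F y in nhds x. f y = g y \<Longrightarrow> op_eval D f x = op_eval D g x"
  unfolding op_eval_def by (intro sum.cong refl arg_cong2[of _ _ _ _ "(*)"] higher_deriv_cong_ev) auto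

lemma op_eval_add_right:
  assumes "f analytic_on {x}" "g analytic_on {x}"
  shows "op_eval D (\<lambda>y. f y + g y) x = op_eval D f x + op_eval D g x"
proof -
  have "(deriv ^^ i) (\<lambda>y. f y + g y) x = (deriv ^^ i) f x + (deriv ^^ i) g x" for i
    using assms higher_deriv_add analytic_at_two by metis
  then show ?thesis by (simp add: op_eval_def sum.distrib algebra_simps)
qed

lemma op_eval_cmult_right:
  assumes "f analytic_on {x}"
  shows "op_eval D (\<lambda>y. c * f y) x = c * op_eval D f x"
  by (simp add: op_eval_def higher_deriv_cmult'[OF assms] sum_distrib_left mult.left_commute)

lemma op_eval_zero_right [simp]: "op_eval D (\<lambda>y. 0) x = 0"
  using op_eval_cmult_right[of "\<lambda>_. 0" x D 0] by simp

lemma analytic_op_eval: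
  assumes "op_regular D x" "f analytic_on {x}"
  shows "op_eval D f analytic_on {x}"
  unfolding op_eval_def
  using assms by (intro analytic_intros analytic_rat_eval analytic_higher_deriv) (auto simp: op_regular_def)

lemma op_eval_partial_mult:
  assumes "op_regular E x" "f analytic_on {x}"
  shows "(op_eval E f has_field_derivative op_eval (op_partial_mult E) f x) (at x)"
  using assms
proof (induction E arbitrary: f)
  case 0
  have "op_eval 0 f = (\<lambda>_. 0)" by auto
  then show ?case by (simp add: op_partial_mult_def)
next
  case (pCons r E)
  have r: "rat_regular r x" and E: "op_regular E x" using pCons.prems by (auto simp: op_regular_pCons)
  have f': "deriv f analytic_on {x}" using pCons.prems by (simp add: analytic_deriv)
  have df: "(f has_field_derivative deriv f x) (at x)"
    using pCons.prems(2) analytic_on_imp_differentiable_at DERIV_deriv_iff_field_differentiable by blast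
  have e: "op_eval (pCons r E) f = (\<lambda>y. rat_eval r y * f y + op_eval E (deriv f) y)"
    by (auto simp: op_eval_pCons)
  have "(op_eval (pCons r E) f has_field_derivative
     (rat_eval (rat_deriv r) x * f x + deriv f x * rat_eval r x + op_eval (op_partial_mult E) (deriv f) x)) (at x)"
    unfolding e
    by (intro DERIV_add DERIV_mult has_field_derivative_rat_eval r df pCons.IH E f')
  also have "rat_eval (rat_deriv r) x * f x + deriv f x * rat_eval r x + op_eval (op_partial_mult E) (deriv f) x
     = op_eval (op_partial_mult (pCons r E)) f x"
    unfolding op_partial_mult_pCons op_eval_pCons
    by (subst op_eval_add) (auto simp: op_regular_pCons r E op_regular_partial_mult op_eval_pCons)
  finally show ?case .
qed

lemma op_eval_partial_mult_funpow:
  assumes "op_regular E x" "f analytic_on {x}"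
  shows "op_eval ((op_partial_mult ^^ i) E) f x = (deriv ^^ i) (op_eval E f) x"
  using assms
proof (induction i arbitrary: x)
  case 0 then show ?case by simp
next
  case (Suc i)
  have "\<forall>\<^sub>F y in nhds x. op_eval ((op_partial_mult ^^ i) E) f y = (deriv ^^ i) (op_eval E f) y"
    using eventually_op_regular[OF Suc.prems(1)] eventually_analytic_at[OF Suc.prems(2)]
    by eventually_elim (rule Suc.IH)
  then have "deriv (op_eval ((op_partial_mult ^^ i) E) f) x = deriv ((deriv ^^ i) (op_eval E f)) x"
    by (intro deriv_cong_ev refl)
  moreover have "deriv (op_eval ((op_partial_mult ^^ i) E) f) x = op_eval ((op_partial_mult ^^ Suc i) E) f x"
    using op_eval_partial_mult[OF op_regular_funpow[OF Suc.prems(1), of i] Suc.prems(2)]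
    by (simp add: DERIV_imp_deriv)
  ultimately show ?case by simp
qed

text \<open>Composition of operators is composition of their actions, but only away from the poles of the
  coefficients. The exceptional points do not depend on the function, which is needed because
  the wave function is a family of functions of \<open>x\<close> with parameter \<open>z\<close>.\<close>

lemma op_eval_mult:
  assumes "op_regular D x" "op_regular E x" "f analytic_on {x}"
  shows "op_eval (op_mult D E) f x = op_eval D (op_eval E f) x"
proof -
  have d: "rat_regular (coeff D i) x" for i using assms(1) by (simp add: op_regular_def)
  have "op_eval (op_mult D E) f x = (\<Sum>i\<le>degree D. op_eval (smult (coeff D i) ((op_partial_mult ^^ i) E)) f x)"
    unfolding op_mult_def using assms
    by (intro op_eval_sum op_regular_smult op_regular_funpow d)
  also have "\<dots> = (\<Sum>i\<le>degree D. rat_eval (coeff D i) x * (deriv ^^ i) (op_eval E f) x)"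
    by (intro sum.cong refl)
      (simp add: op_eval_smult d op_regular_funpow assms op_eval_partial_mult_funpow)
  finally show ?thesis by (simp add: op_eval_def)
qed

lemma op_regular_polynomial [simp]: "op_regular (map_poly to_fract T) x"
  by (simp add: op_regular_def coeff_map_poly)

lemma map_poly_to_fract_pCons:
  "map_poly to_fract (pCons t T) = pCons (to_fract t) (map_poly to_fract T)"
  by (rule map_poly_pCons) auto

lemma deriv_poly: "deriv (poly p) = poly (pderiv p)"
  by (rule ext) (simp add: DERIV_imp_deriv poly_DERIV)

text \<open>On polynomials the formal and the analytic action agree; this transports conditions between
  rational functions and distributions.\<close>

lemma op_polynomial_on_polynomial:
  "\<exists>u. op_apply (map_poly to_fract T) (to_fract v) = to_fract u \<and>
       poly u = op_eval (map_poly to_fract T) (poly v)"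
proof (induction T arbitrary: v)
  case 0
  then show ?case by (intro exI[of _ 0]) (auto simp: op_eval_def)
next
  case (pCons t T)
  obtain u where "op_apply (map_poly to_fract T) (to_fract (pderiv v)) = to_fract u"
     "poly u = op_eval (map_poly to_fract T) (poly (pderiv v))" using pCons.IH by blast
  then show ?case
    by (intro exI[of _ "t * v + u"])
      (auto simp: map_poly_to_fract_pCons op_apply_pCons op_eval_pCons deriv_poly)
qed

lemma common_denominator:
  "\<exists>b T. b \<noteq> 0 \<and> smult (to_fract b) E = map_poly to_fract T"
proof (induction E)
  case 0
  then show ?case by (intro exI[of _ 1] exI[of _ 0]) auto
next
  case (pCons r E)
  obtain b T where b: "b \<noteq> 0" "smult (to_fract b) E = map_poly to_fract T" using pCons.IH by blast
  obtain a d where r: "r = Fract a d" "d \<noteq> 0" by (cases r)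
  have "smult (to_fract (b * d)) (pCons r E) = pCons (to_fract (b * d) * r) (smult (to_fract d) (smult (to_fract b) E))"
    by (simp add: mult.commute)
  also have "to_fract (b * d) * r = to_fract (b * a)"
    using r by (simp add: Fract_conv_to_fract)
  also have "smult (to_fract d) (smult (to_fract b) E) = map_poly to_fract (smult d T)"
    unfolding b(2) by (rule poly_eqI) (simp add: coeff_map_poly)
  finally show ?case using b r
    by (intro exI[of _ "b * d"] exI[of _ "pCons (b * a) (smult d T)"]) (simp add: map_poly_to_fract_pCons)
qed

section \<open>Distributions with finite support\<close>

abbreviation entire :: "(complex \<Rightarrow> complex) \<Rightarrow> bool" where
  "entire f \<equiv> f holomorphic_on UNIV"

definition all_dists :: "dist set" where
  "all_dists = dist.span (\<Union>a. range (\<lambda>k. delta k a))"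

lemma delta_in_all_dists [simp]: "delta k a \<in> all_dists"
  unfolding all_dists_def by (rule dist.span_base) auto

lemma dists_at_subset: "dists_at a \<subseteq> all_dists"
  unfolding dists_at_def all_dists_def by (rule dist.span_mono) auto

lemma all_dists_add: "\<xi> \<in> all_dists \<Longrightarrow> \<eta> \<in> all_dists \<Longrightarrow> \<xi> + \<eta> \<in> all_dists"
  unfolding all_dists_def by (rule dist.span_add)

lemma all_dists_diff: "\<xi> \<in> all_dists \<Longrightarrow> \<eta> \<in> all_dists \<Longrightarrow> \<xi> - \<eta> \<in> all_dists"
  unfolding all_dists_def by (rule dist.span_diff)

lemma all_dists_scale: "\<xi> \<in> all_dists \<Longrightarrow> dist_scale c \<xi> \<in> all_dists"
  unfolding all_dists_def by (rule dist.span_scale)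

lemma all_dists_0 [simp]: "0 \<in> all_dists"
  unfolding all_dists_def by (rule dist.span_zero)

lemma dist_scale_apply [simp]: "dist_scale c \<xi> f = c * \<xi> f"
  by (simp add: dist_scale_def)

text \<open>The properties proved by this rule pass to linear combinations, so they only have to be checked on
  the derivatives of delta functions.\<close>

lemma all_dists_induct [consumes 1, case_names zero add scale delta]:
  assumes "\<xi> \<in> all_dists" "P 0"
    "\<And>\<xi> \<eta>. \<xi> \<in> all_dists \<Longrightarrow> \<eta> \<in> all_dists \<Longrightarrow> P \<xi> \<Longrightarrow> P \<eta> \<Longrightarrow> P (\<xi> + \<eta>)"
    "\<And>c \<xi>. \<xi> \<in> all_dists \<Longrightarrow> P \<xi> \<Longrightarrow> P (dist_scale c \<xi>)"
    "\<And>k a. P (delta k a)"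
  shows "P \<xi>"
proof -
  have "\<xi> \<in> all_dists \<and> P \<xi>"
    using assms(1) unfolding all_dists_def
  proof (induction rule: dist.span_induct_alt)
    case base
    show ?case by (intro conjI dist.span_zero assms(2))
  next
    case (step c x y)
    have x: "x \<in> all_dists" "P x" using step(1) assms(5) by auto
    have y: "y \<in> all_dists" "P y" using step(2) unfolding all_dists_def by blast+
    have "dist_scale c x + y \<in> all_dists \<and> P (dist_scale c x + y)"
      using x y by (auto intro!: all_dists_add all_dists_scale assms(3,4))
    then show ?case unfolding all_dists_def .
  qed
  then show ?thesis ..
qed

lemma entire_deriv: "entire f \<Longrightarrow> entire (deriv f)"
  by (rule holomorphic_deriv) auto

lemma entire_poly [simp]: "entire (poly p)"
  by (intro holomorphic_intros)

lemma entire_analytic_at: "entire f \<Longrightarrow> f analytic_on {x}"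
  using analytic_at by blast

lemma dist_not_entire: "\<xi> \<in> all_dists \<Longrightarrow> \<not> entire f \<Longrightarrow> \<xi> f = 0"
  by (induction rule: all_dists_induct) (auto simp: delta_def)

lemma dist_add_right:
  "\<xi> \<in> all_dists \<Longrightarrow> entire f \<Longrightarrow> entire g \<Longrightarrow> \<xi> (\<lambda>z. f z + g z) = \<xi> f + \<xi> g"
proof (induction rule: all_dists_induct)
  case (delta k a)
  then have "entire (\<lambda>z. f z + g z)" by (intro holomorphic_intros)
  then show ?case using delta by (simp add: delta_def higher_deriv_add[of f UNIV g a] algebra_simps)
qed (auto simp: algebra_simps)

lemma dist_cmult_right:
  "\<xi> \<in> all_dists \<Longrightarrow> entire f \<Longrightarrow> \<xi> (\<lambda>z. c * f z) = c * \<xi> f"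
proof (induction rule: all_dists_induct)
  case (delta k a)
  then have "entire (\<lambda>z. c * f z)" by (intro holomorphic_intros)
  then show ?case using delta by (simp add: delta_def higher_deriv_cmult[of f UNIV a] algebra_simps)
qed (auto simp: algebra_simps)

lemma dist_zero_right [simp]: "\<xi> \<in> all_dists \<Longrightarrow> \<xi> (\<lambda>z. 0) = 0"
  using dist_cmult_right[of \<xi> "\<lambda>_. 0" 0] by simp

lemma delta_deriv: "entire f \<Longrightarrow> delta k a (deriv f) = - delta (Suc k) a f"
  by (simp add: delta_def entire_deriv funpow_swap1)

lemma higher_deriv_shift_mult:
  assumes "entire f"
  shows "(deriv ^^ k) (\<lambda>z. (z - c) * f z) = (\<lambda>z. (z - c) * (deriv ^^ k) f z + of_nat k * (deriv ^^ (k - 1)) f z)"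
proof (induction k)
  case 0 then show ?case by simp
next
  case (Suc k)
  have d: "((deriv ^^ j) f has_field_derivative (deriv ^^ Suc j) f z) (at z)" for j z
    using assms by (intro has_field_derivative_higher_deriv) auto
  show ?case
  proof
    fix z
    have "((\<lambda>z. (z - c) * (deriv ^^ k) f z + of_nat k * (deriv ^^ (k - 1)) f z) has_field_derivative
       ((1 - 0) * (deriv ^^ k) f z + (deriv ^^ Suc k) f z * (z - c)) + (deriv ^^ Suc (k - 1)) f z * of_nat k) (at z)"
      by (intro DERIV_add DERIV_mult DERIV_diff DERIV_ident DERIV_const DERIV_cmult_right d
            DERIV_cmult[where c="of_nat k", THEN DERIV_cong, OF d] ) simp_all
    moreover have "(deriv ^^ Suc (k - 1)) f z * of_nat k = of_nat k * (deriv ^^ k) f z" by (cases k) auto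
    ultimately show "(deriv ^^ Suc k) (\<lambda>z. (z - c) * f z) z
       = (z - c) * (deriv ^^ Suc k) f z + of_nat (Suc k) * (deriv ^^ (Suc k - 1)) f z"
      using Suc by (simp add: DERIV_imp_deriv algebra_simps)
  qed
qed

text \<open>Multiplication by \<open>z - c\<close> acts on the derivatives of a delta function at \<open>a\<close> triangularly:
  it lowers the order if \<open>c = a\<close> and has a nonzero diagonal otherwise. For \<open>k = 0\<close> the last term
  vanishes because of its factor.\<close>

lemma delta_shift_mult:
  assumes "entire f"
  shows "delta k a (\<lambda>z. (z - c) * f z) = (a - c) * delta k a f - of_nat k * delta (k - 1) a f"
proof -
  have e: "entire (\<lambda>z. (z - c) * f z)" using assms by (intro holomorphic_intros)
  show ?thesis
    unfolding delta_def higher_deriv_shift_mult[OF assms] if_P[OF assms] if_P[OF e]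
    by (cases k) (simp_all add: algebra_simps del: funpow.simps(2))
qed

lemma deriv_transpose:
  "\<xi> \<in> all_dists \<Longrightarrow> \<exists>\<eta>\<in>all_dists. \<forall>f. entire f \<longrightarrow> \<eta> f = \<xi> (deriv f)"
proof (induction rule: all_dists_induct)
  case zero
  show ?case by (rule bexI[of _ 0]) auto
next
  case (add \<xi> \<eta>)
  then obtain \<xi>' \<eta>' where "\<xi>' \<in> all_dists" "\<forall>f. entire f \<longrightarrow> \<xi>' f = \<xi> (deriv f)"
    "\<eta>' \<in> all_dists" "\<forall>f. entire f \<longrightarrow> \<eta>' f = \<eta> (deriv f)" by blast
  then show ?case by (intro bexI[of _ "\<xi>' + \<eta>'"]) (auto intro: all_dists_add)
next
  case (scale c \<xi>)
  then obtain \<xi>' where "\<xi>' \<in> all_dists" "\<forall>f. entire f \<longrightarrow> \<xi>' f = \<xi> (deriv f)" by blast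
  then show ?case by (intro bexI[of _ "dist_scale c \<xi>'"]) (auto intro: all_dists_scale)
next
  case (delta k a)
  show ?case
  proof (rule bexI[of _ "dist_scale (-1) (delta (Suc k) a)"])
    show "dist_scale (-1) (delta (Suc k) a) \<in> all_dists" by (intro all_dists_scale delta_in_all_dists)
  qed (simp add: delta_deriv)
qed

lemma shift_transpose:
  "\<xi> \<in> all_dists \<Longrightarrow> \<exists>\<eta>\<in>all_dists. \<forall>f. entire f \<longrightarrow> \<eta> f = \<xi> (\<lambda>z. (z - c) * f z)"
proof (induction rule: all_dists_induct)
  case zero
  show ?case by (rule bexI[of _ 0]) auto
next
  case (add \<xi> \<eta>)
  then obtain \<xi>' \<eta>' where "\<xi>' \<in> all_dists" "\<forall>f. entire f \<longrightarrow> \<xi>' f = \<xi> (\<lambda>z. (z - c) * f z)"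
    "\<eta>' \<in> all_dists" "\<forall>f. entire f \<longrightarrow> \<eta>' f = \<eta> (\<lambda>z. (z - c) * f z)" by blast
  then show ?case by (intro bexI[of _ "\<xi>' + \<eta>'"]) (auto intro: all_dists_add)
next
  case (scale d \<xi>)
  then obtain \<xi>' where "\<xi>' \<in> all_dists" "\<forall>f. entire f \<longrightarrow> \<xi>' f = \<xi> (\<lambda>z. (z - c) * f z)" by blast
  then show ?case by (intro bexI[of _ "dist_scale d \<xi>'"]) (auto intro: all_dists_scale)
next
  case (delta k a)
  show ?case
  proof (rule bexI[of _ "dist_scale (a - c) (delta k a) - dist_scale (of_nat k) (delta (k - 1) a)"])
    show "dist_scale (a - c) (delta k a) - dist_scale (of_nat k) (delta (k - 1) a) \<in> all_dists"
      by (intro all_dists_diff all_dists_scale delta_in_all_dists)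
  qed (simp add: delta_shift_mult)
qed

lemma poly_mult_transpose:
  "\<xi> \<in> all_dists \<Longrightarrow> \<exists>\<eta>\<in>all_dists. \<forall>f. entire f \<longrightarrow> \<eta> f = \<xi> (\<lambda>z. poly p z * f z)"
proof (induction p arbitrary: \<xi>)
  case 0
  then show ?case by (intro bexI[of _ 0]) auto
next
  case (pCons a p)
  obtain \<xi>1 where 1: "\<xi>1 \<in> all_dists" "\<forall>f. entire f \<longrightarrow> \<xi>1 f = \<xi> (\<lambda>z. (z - 0) * f z)"
    using shift_transpose[OF pCons.prems] by blast
  obtain \<xi>2 where 2: "\<xi>2 \<in> all_dists" "\<forall>f. entire f \<longrightarrow> \<xi>2 f = \<xi>1 (\<lambda>z. poly p z * f z)"
    using pCons.IH[OF 1(1)] by blast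
  show ?case
  proof (intro bexI[of _ "dist_scale a \<xi> + \<xi>2"] allI impI)
    fix f assume f: "entire f"
    have e: "entire (\<lambda>z. poly p z * f z)" "entire (\<lambda>z. a * f z)" "entire (\<lambda>z. z * (poly p z * f z))"
      using f by (auto intro!: holomorphic_intros)
    have "(\<lambda>z. poly (pCons a p) z * f z) = (\<lambda>z. a * f z + z * (poly p z * f z))"
      by (simp add: algebra_simps)
    then have "\<xi> (\<lambda>z. poly (pCons a p) z * f z) = a * \<xi> f + \<xi> (\<lambda>z. z * (poly p z * f z))"
      using dist_add_right[OF pCons.prems e(2,3)] dist_cmult_right[OF pCons.prems f, of a] by simp
    then show "(dist_scale a \<xi> + \<xi>2) f = \<xi> (\<lambda>z. poly (pCons a p) z * f z)"
      using 1 2 e f by simp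
  qed (use 2 pCons.prems in \<open>auto intro: all_dists_add all_dists_scale\<close>)
qed

lemma entire_op_polynomial:
  "entire f \<Longrightarrow> entire (op_eval (map_poly to_fract T) f)"
proof (induction T arbitrary: f)
  case 0
  then show ?case by (simp add: op_eval_def)
next
  case (pCons t T)
  have "op_eval (map_poly to_fract (pCons t T)) f = (\<lambda>z. poly t z * f z + op_eval (map_poly to_fract T) (deriv f) z)"
    by (auto simp: map_poly_to_fract_pCons op_eval_pCons)
  then show ?case using pCons by (auto intro!: holomorphic_intros entire_deriv)
qed

text \<open>Operators with polynomial coefficients act on distributions by transposition.\<close>

lemma polynomial_op_transpose:
  "\<xi> \<in> all_dists \<Longrightarrow> \<exists>\<eta>\<in>all_dists. \<forall>f. entire f \<longrightarrow> \<eta> f = \<xi> (op_eval (map_poly to_fract T) f)"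
proof (induction T arbitrary: \<xi>)
  case 0
  have "op_eval 0 f = (\<lambda>_. 0)" for f by auto
  then show ?case using 0 by (intro bexI[of _ 0]) auto
next
  case (pCons t T)
  obtain \<xi>1 where 1: "\<xi>1 \<in> all_dists" "\<forall>f. entire f \<longrightarrow> \<xi>1 f = \<xi> (op_eval (map_poly to_fract T) f)"
    using pCons by blast
  obtain \<xi>2 where 2: "\<xi>2 \<in> all_dists" "\<forall>f. entire f \<longrightarrow> \<xi>2 f = \<xi>1 (deriv f)"
    using deriv_transpose[OF 1(1)] by blast
  obtain \<xi>3 where 3: "\<xi>3 \<in> all_dists" "\<forall>f. entire f \<longrightarrow> \<xi>3 f = \<xi> (\<lambda>z. poly t z * f z)"
    using poly_mult_transpose[OF pCons.prems] by blast
  show ?case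
  proof (intro bexI[of _ "\<xi>3 + \<xi>2"] allI impI)
    fix f assume f: "entire f"
    have "op_eval (map_poly to_fract (pCons t T)) f = (\<lambda>z. poly t z * f z + op_eval (map_poly to_fract T) (deriv f) z)"
      by (auto simp: map_poly_to_fract_pCons op_eval_pCons)
    moreover have "entire (\<lambda>z. poly t z * f z)" using f by (intro holomorphic_intros)
    moreover have "entire (op_eval (map_poly to_fract T) (deriv f))"
      by (intro entire_op_polynomial entire_deriv f)
    ultimately have "\<xi> (op_eval (map_poly to_fract (pCons t T)) f)
      = \<xi> (\<lambda>z. poly t z * f z) + \<xi> (op_eval (map_poly to_fract T) (deriv f))"
      using dist_add_right[OF pCons.prems] by simp
    then show "(\<xi>3 + \<xi>2) f = \<xi> (op_eval (map_poly to_fract (pCons t T)) f)"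
      using 1 2 3 f entire_deriv by simp
  qed (use 2 3 in \<open>auto intro: all_dists_add\<close>)
qed

lemma delta_shift_surj:
  "\<exists>\<eta>\<in>all_dists. \<forall>f. entire f \<longrightarrow> \<eta> (\<lambda>z. (z - c) * f z) = delta k a f"
proof (cases "a = c")
  case True
  show ?thesis
  proof (rule bexI[of _ "dist_scale (- 1 / of_nat (Suc k)) (delta (Suc k) a)"])
    show "dist_scale (- 1 / of_nat (Suc k)) (delta (Suc k) a) \<in> all_dists"
      by (intro all_dists_scale delta_in_all_dists)
  qed (use True in \<open>simp add: delta_shift_mult del: of_nat_Suc\<close>)
next
  case False
  show ?thesis
  proof (induction k)
    case 0
    show ?case using False by (intro bexI[of _ "dist_scale (1 / (a - c)) (delta 0 a)"])
      (auto intro: all_dists_scale simp: delta_shift_mult)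
  next
    case (Suc k)
    then obtain \<eta> where n: "\<eta> \<in> all_dists" "\<forall>f. entire f \<longrightarrow> \<eta> (\<lambda>z. (z - c) * f z) = delta k a f" by blast
    show ?case
    proof (intro bexI[of _ "dist_scale (1 / (a - c)) (delta (Suc k) a + dist_scale (of_nat (Suc k)) \<eta>)"] allI impI)
      fix f assume f: "entire f"
      then show "dist_scale (1 / (a - c)) (delta (Suc k) a + dist_scale (of_nat (Suc k)) \<eta>) (\<lambda>z. (z - c) * f z)
          = delta (Suc k) a f"
        using False n by (simp add: delta_shift_mult del: of_nat_Suc)
    qed (intro all_dists_add all_dists_scale delta_in_all_dists n(1))
  qed
qed

text \<open>The transpose of multiplication by \<open>z - c\<close> is surjective. Together with factorization of
  polynomials this is what turns divisibility into a condition on distributions.\<close>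

lemma shift_transpose_surj:
  "\<xi> \<in> all_dists \<Longrightarrow> \<exists>\<eta>\<in>all_dists. \<forall>f. entire f \<longrightarrow> \<eta> (\<lambda>z. (z - c) * f z) = \<xi> f"
proof (induction rule: all_dists_induct)
  case zero
  show ?case by (rule bexI[of _ 0]) auto
next
  case (add \<xi> \<eta>)
  then obtain \<xi>' \<eta>' where "\<xi>' \<in> all_dists" "\<forall>f. entire f \<longrightarrow> \<xi>' (\<lambda>z. (z - c) * f z) = \<xi> f"
    "\<eta>' \<in> all_dists" "\<forall>f. entire f \<longrightarrow> \<eta>' (\<lambda>z. (z - c) * f z) = \<eta> f" by blast
  then show ?case by (intro bexI[of _ "\<xi>' + \<eta>'"]) (auto intro: all_dists_add)
next
  case (scale d \<xi>)
  then obtain \<xi>' where "\<xi>' \<in> all_dists" "\<forall>f. entire f \<longrightarrow> \<xi>' (\<lambda>z. (z - c) * f z) = \<xi> f" by blast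
  then show ?case by (intro bexI[of _ "dist_scale d \<xi>'"]) (auto intro: all_dists_scale)
next
  case (delta k a)
  show ?case by (rule delta_shift_surj)
qed

text \<open>Induction on the number of roots; this is where the complex numbers being algebraically closed
  enters.\<close>

lemma nonzero_poly_induct [consumes 1, case_names const root]:
  fixes g :: "complex poly"
  assumes "g \<noteq> 0" "\<And>c. c \<noteq> 0 \<Longrightarrow> P [:c:]" "\<And>a g. g \<noteq> 0 \<Longrightarrow> P g \<Longrightarrow> P ([:- a, 1:] * g)"
  shows "P g"
  using assms(1)
proof (induction "degree g" arbitrary: g)
  case 0
  then obtain c where "g = [:c:]" by (metis degree_eq_zeroE)
  then show ?case using 0 assms(2) by auto
next
  case (Suc n)
  then have "\<not> constant (poly g)" by (simp add: constant_degree)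
  then have "\<exists>a. poly g a = 0" by (rule Fundamental_Theorem_Algebra.fundamental_theorem_of_algebra)
  then obtain a where "poly g a = 0" ..
  then obtain h where g: "g = [:- a, 1:] * h" by (metis poly_eq_0_iff_dvd dvdE)
  then have h: "h \<noteq> 0" using Suc by auto
  have "degree g = Suc (degree h)" unfolding g using h by (subst degree_mult_eq) auto
  then have "P h" using Suc.hyps h by simp
  then show ?case unfolding g using h by (intro assms(3))
qed

lemma entire_divide_root:
  assumes "entire f"
  obtains h where "entire h" "\<And>z. f z = f a + (z - a) * h z"
proof
  show "entire (\<lambda>z. if z = a then deriv f a else (f z - f a) / (z-a))"
    using assms by (intro pole_lemma) auto
  show "f z = f a + (z - a) * (if z = a then deriv f a else (f z - f a) / (z - a))" for z
    by simp
qed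

text \<open>Interpolation: an entire function agrees with a polynomial to any given order at finitely many
  points.\<close>

lemma entire_poly_division:
  assumes "g \<noteq> 0" "entire f"
  shows "\<exists>p h. entire h \<and> (\<forall>z. f z = poly p z + poly g z * h z)"
  using assms(1)
proof (induction rule: nonzero_poly_induct)
  case (const c)
  then show ?case using assms(2)
    by (intro exI[of _ 0] exI[of _ "\<lambda>z. f z / c"]) (auto intro: holomorphic_intros)
next
  case (root a g)
  then obtain p h where h: "entire h" "\<And>z. f z = poly p z + poly g z * h z" by blast
  obtain k where k: "entire k" "\<And>z. h z = h a + (z - a) * k z" using entire_divide_root[OF h(1), of a] by blast
  have "f z = poly (p + smult (h a) g) z + poly ([:- a, 1:] * g) z * k z" for z
    unfolding h(2)[of z] by (subst k(2)) (simp add: algebra_simps)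
  then show ?case using k(1) by blast
qed

text \<open>Cancel a linear factor at a time; at its root the remaining identity holds by continuity.\<close>

lemma poly_quotient_entire:
  assumes "b \<noteq> 0" "entire f" "\<And>z. poly b z * f z = poly u z"
  shows "\<exists>s. f = poly s"
  using assms(1,3)
proof (induction arbitrary: u rule: nonzero_poly_induct)
  case (const c)
  have "f z = poly (smult (1 / c) u) z" for z
  proof -
    have "poly u z = c * f z" using const.prems[of z] by simp
    then have "poly (smult (1 / c) u) z = (1 / c) * (c * f z)" by (simp only: poly_smult)
    then show ?thesis using const.hyps by simp
  qed
  then show ?case by blast
next
  case (root a b)
  have "poly u a = 0" using root.prems[of a, symmetric] by simp
  then obtain v where v: "u = [:- a, 1:] * v" by (metis poly_eq_0_iff_dvd dvdE)
  have ne: "poly b z * f z = poly v z" if "z \<noteq> a" for z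
  proof -
    have "(z - a) * (poly b z * f z) = (z - a) * poly v z"
      using root.prems[of z] unfolding v by (simp add: algebra_simps)
    then show ?thesis using that by simp
  qed
  have "poly b z * f z = poly v z" for z
  proof (cases "z = a")
    case True
    have "(\<lambda>z. poly b z * f z - poly v z) \<midarrow>a\<rightarrow> poly b a * f a - poly v a"
      using assms(2) holomorphic_on_imp_continuous_on[OF assms(2)]
      by (intro isContD continuous_intros) (simp add: continuous_on_eq_continuous_at)
    moreover have "(\<lambda>z. poly b z * f z - poly v z) \<midarrow>a\<rightarrow> 0"
      by (rule tendsto_eventually) (auto simp: eventually_at_filter ne)
    ultimately show ?thesis using True LIM_unique by fastforce
  qed (use ne in auto)
  then show ?case by (rule root.IH)
qed

lemma poly_linear_factor: "poly [:- a, 1:] z = z - (a :: complex)" by simp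

text \<open>The function vanishes to order greater than \<open>k\<close> at \<open>a\<close>.\<close>

lemma delta_annihilator: "entire h \<Longrightarrow> delta k a (\<lambda>z. poly ([:- a, 1:] ^ Suc k) z * h z) = 0"
proof (induction k)
  case 0
  then show ?case using delta_shift_mult[of h 0 a a] by simp
next
  case (Suc k)
  have e: "entire (\<lambda>z. poly ([:- a, 1:] ^ Suc k) z * h z)" using Suc.prems by (intro holomorphic_intros)
  have "(\<lambda>z. poly ([:- a, 1:] ^ Suc (Suc k)) z * h z) = (\<lambda>z. (z - a) * (poly ([:- a, 1:] ^ Suc k) z * h z))"
    by (rule ext) (simp only: power_Suc[of _ "Suc k"] poly_mult poly_linear_factor mult.assoc)
  then show ?case using delta_shift_mult[OF e, of "Suc k" a a] Suc by simp
qed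

lemma dist_annihilator:
  "\<xi> \<in> all_dists \<Longrightarrow> \<exists>g. g \<noteq> 0 \<and> (\<forall>h. entire h \<longrightarrow> \<xi> (\<lambda>z. poly g z * h z) = 0)"
proof (induction rule: all_dists_induct)
  case zero
  show ?case by (intro exI[of _ 1]) auto
next
  case (add \<xi> \<eta>)
  then obtain g g' where "g \<noteq> 0" "\<forall>h. entire h \<longrightarrow> \<xi> (\<lambda>z. poly g z * h z) = 0"
    "g' \<noteq> 0" "\<forall>h. entire h \<longrightarrow> \<eta> (\<lambda>z. poly g' z * h z) = 0" by blast
  note g = this
  have "(\<xi> + \<eta>) (\<lambda>z. poly (g * g') z * h z) = 0" if "entire h" for h
  proof -
    have "entire (\<lambda>z. poly g z * h z)" "entire (\<lambda>z. poly g' z * h z)"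
      using that by (auto intro!: holomorphic_intros)
    then have "\<xi> (\<lambda>z. poly g z * (poly g' z * h z)) = 0" "\<eta> (\<lambda>z. poly g' z * (poly g z * h z)) = 0"
      using g by blast+
    then show ?thesis by (simp add: mult_ac)
  qed
  then show ?case using g by (intro exI[of _ "g * g'"]) auto
next
  case (scale c \<xi>)
  then show ?case by auto
next
  case (delta k a)
  show ?case using delta_annihilator by (intro exI[of _ "[:- a, 1:] ^ Suc k"]) (auto simp del: power_Suc)
qed

text \<open>A distribution only sees a function modulo the multiples of some polynomial \<open>g\<close>, and modulo \<open>g\<close>
  every entire function is a polynomial.\<close>

lemma dist_eq_0I_poly:
  assumes "\<xi> \<in> all_dists" "\<And>p. \<xi> (poly p) = 0"
  shows "\<xi> = 0"
proof
  fix f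
  show "\<xi> f = 0 f"
  proof (cases "entire f")
    case True
    obtain g where g: "g \<noteq> 0" "\<forall>h. entire h \<longrightarrow> \<xi> (\<lambda>z. poly g z * h z) = 0"
      using dist_annihilator[OF assms(1)] by blast
    obtain p h where h: "entire h" "\<And>z. f z = poly p z + poly g z * h z"
      using entire_poly_division[OF g(1) True] by blast
    have "f = (\<lambda>z. poly p z + poly g z * h z)" using h by auto
    moreover have "entire (\<lambda>z. poly g z * h z)" using h by (intro holomorphic_intros)
    ultimately show ?thesis using dist_add_right[OF assms(1), of "poly p" "\<lambda>z. poly g z * h z"] g h assms(2)
      by simp
  qed (use dist_not_entire[OF assms(1)] in auto)
qed

section \<open>Exponential transforms of distributions\<close>

lemma entire_poly_exp [simp]: "entire (\<lambda>z. poly p z * exp (x * z))"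
  by (intro holomorphic_intros)

lemma entire_exp_mult [simp]: "entire (\<lambda>z. exp (x * z))"
  by (intro holomorphic_intros)

text \<open>Differentiation in \<open>x\<close> under the pairing with \<open>\<delta>\<^sup>(\<^sup>k\<^sup>)\<close>. In the induction step, differentiating
  \<open>p(z) e\<^sup>x\<^sup>z\<close> in \<open>z\<close> gives \<open>p' e\<^sup>x\<^sup>z + x p e\<^sup>x\<^sup>z\<close>, and the derivative of the factor \<open>x\<close>
  matches the term \<open>p\<close> in \<open>(z p)' = z p' + p\<close>.\<close>

lemma delta_poly_exp_has_derivative:
  "((\<lambda>x. delta k a (\<lambda>z. poly p z * exp (x * z))) has_field_derivative
     delta k a (\<lambda>z. poly (pCons 0 p) z * exp (x * z))) (at x)"
proof (induction k arbitrary: p)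
  case 0
  have "((\<lambda>x. poly p a * exp (x * a)) has_field_derivative a * (poly p a * exp (x * a))) (at x)"
    by (auto intro!: derivative_eq_intros)
  moreover have e: "delta 0 a (\<lambda>z. poly q z * exp (x * z)) = poly q a * exp (x * a)" for q x
    unfolding delta_def if_P[OF entire_poly_exp] by simp
  ultimately show ?case unfolding e by (simp add: mult.assoc)
next
  case (Suc k)
  have d: "deriv (\<lambda>z. poly p z * exp (x * z)) = (\<lambda>z. poly (pderiv p) z * exp (x * z) + x * (poly p z * exp (x * z)))" for p x
    by (rule ext, rule DERIV_imp_deriv) (auto intro!: derivative_eq_intros)
  have e: "delta (Suc k) a (\<lambda>z. poly p z * exp (x * z))
      = - (delta k a (\<lambda>z. poly (pderiv p) z * exp (x * z)) + x * delta k a (\<lambda>z. poly p z * exp (x * z)))" for p x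
  proof -
    have e1: "entire (\<lambda>z. x * (poly p z * exp (x * z)))" by (intro holomorphic_intros)
    show ?thesis
      using delta_deriv[OF entire_poly_exp[of p x], of k a]
      by (simp add: d dist_add_right[OF delta_in_all_dists entire_poly_exp e1]
            dist_cmult_right[OF delta_in_all_dists entire_poly_exp])
  qed
  have "((\<lambda>x. - (delta k a (\<lambda>z. poly (pderiv p) z * exp (x * z)) + x * delta k a (\<lambda>z. poly p z * exp (x * z)))) has_field_derivative
    - (delta k a (\<lambda>z. poly (pCons 0 (pderiv p)) z * exp (x * z)) + (1 * delta k a (\<lambda>z. poly p z * exp (x * z)) + delta k a (\<lambda>z. poly (pCons 0 p) z * exp (x * z)) * x))) (at x)"
    by (intro DERIV_minus DERIV_add DERIV_mult DERIV_ident Suc)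
  moreover have "delta k a (\<lambda>z. poly (pderiv (pCons 0 p)) z * exp (x * z))
     = delta k a (\<lambda>z. poly (pCons 0 (pderiv p)) z * exp (x * z)) + delta k a (\<lambda>z. poly p z * exp (x * z))"
    using dist_add_right[OF delta_in_all_dists entire_poly_exp entire_poly_exp, of k a "pCons 0 (pderiv p)" x p x]
    by (simp add: pderiv_pCons algebra_simps)
  ultimately show ?case unfolding e by (simp add: algebra_simps)
qed

lemma dist_poly_exp_has_derivative:
  "\<xi> \<in> all_dists \<Longrightarrow> ((\<lambda>x. \<xi> (\<lambda>z. poly p z * exp (x * z))) has_field_derivative
     \<xi> (\<lambda>z. poly (pCons 0 p) z * exp (x * z))) (at x)"
proof (induction rule: all_dists_induct)
  case zero
  show ?case by simp
next
  case (add \<xi> \<eta>)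
  then show ?case unfolding plus_fun_apply by (intro DERIV_add)
next
  case (scale c \<xi>)
  then show ?case unfolding dist_scale_apply by (intro DERIV_cmult)
next
  case (delta k a)
  show ?case by (rule delta_poly_exp_has_derivative)
qed

lemma deriv_dist_poly_exp:
  "\<xi> \<in> all_dists \<Longrightarrow> deriv (\<lambda>x. \<xi> (\<lambda>z. poly p z * exp (x * z))) = (\<lambda>x. \<xi> (\<lambda>z. poly (pCons 0 p) z * exp (x * z)))"
  by (rule ext, rule DERIV_imp_deriv) (rule dist_poly_exp_has_derivative)

lemma entire_dist_poly_exp:
  "\<xi> \<in> all_dists \<Longrightarrow> entire (\<lambda>x. \<xi> (\<lambda>z. poly p z * exp (x * z)))"
  by (subst holomorphic_on_open) (auto intro: dist_poly_exp_has_derivative)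

definition exp_transform :: "dist \<Rightarrow> complex \<Rightarrow> complex" where
  "exp_transform \<xi> = (\<lambda>x. \<xi> (\<lambda>z. exp (x * z)))"

lemma exp_transform_poly: "exp_transform \<xi> = (\<lambda>x. \<xi> (\<lambda>z. poly 1 z * exp (x * z)))"
  by (simp add: exp_transform_def)

lemma entire_exp_transform: "\<xi> \<in> all_dists \<Longrightarrow> entire (exp_transform \<xi>)"
  unfolding exp_transform_poly by (rule entire_dist_poly_exp)

lemma exp_transform_add: "exp_transform (\<xi> + \<eta>) = (\<lambda>x. exp_transform \<xi> x + exp_transform \<eta> x)"
  by (simp add: exp_transform_def)

lemma exp_transform_scale: "exp_transform (dist_scale c \<xi>) = (\<lambda>x. c * exp_transform \<xi> x)"
  by (simp add: exp_transform_def)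

text \<open>The polynomial \<open>D(x,z)\<close> in \<open>z\<close> with \<open>D(x,\<partial>\<^sub>x)\<cdot>e\<^sup>x\<^sup>z = D(x,z) e\<^sup>x\<^sup>z\<close>.\<close>

definition op_symbol :: "diffop \<Rightarrow> complex \<Rightarrow> complex poly" where
  "op_symbol D x = map_poly (\<lambda>r. rat_eval r x) D"

lemma op_symbol_0 [simp]: "op_symbol 0 x = 0"
  by (simp add: op_symbol_def)

lemma op_symbol_pCons: "op_symbol (pCons r D) x = pCons (rat_eval r x) (op_symbol D x)"
  by (simp add: op_symbol_def map_poly_pCons)

lemma coeff_op_symbol: "coeff (op_symbol D x) i = rat_eval (coeff D i) x"
  by (simp add: op_symbol_def coeff_map_poly)

text \<open>Operators in \<open>x\<close> can be moved under the pairing: each \<open>\<partial>\<^sub>x\<close> becomes a factor \<open>z\<close>.\<close>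

lemma op_eval_dist_poly_exp:
  "\<xi> \<in> all_dists \<Longrightarrow> op_eval D (\<lambda>x. \<xi> (\<lambda>z. poly p z * exp (x * z))) x = \<xi> (\<lambda>z. poly (op_symbol D x * p) z * exp (x * z))"
proof (induction D arbitrary: p)
  case 0
  then show ?case by simp
next
  case (pCons r D)
  have e: "entire (\<lambda>z. rat_eval r x * (poly p z * exp (x * z)))" by (intro holomorphic_intros)
  have "\<xi> (\<lambda>z. poly (op_symbol (pCons r D) x * p) z * exp (x * z))
    = \<xi> (\<lambda>z. rat_eval r x * (poly p z * exp (x * z)) + poly (op_symbol D x * pCons 0 p) z * exp (x * z))"
    by (simp add: op_symbol_pCons algebra_simps)
  also have "\<dots> = rat_eval r x * \<xi> (\<lambda>z. poly p z * exp (x * z)) + \<xi> (\<lambda>z. poly (op_symbol D x * pCons 0 p) z * exp (x * z))"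
    by (simp only: dist_add_right[OF pCons.prems e entire_poly_exp]
        dist_cmult_right[OF pCons.prems entire_poly_exp])
  finally show ?case
    by (simp only: op_eval_pCons deriv_dist_poly_exp[OF pCons.prems] pCons.IH[OF pCons.prems])
qed

lemma op_eval_exp_transform:
  "\<xi> \<in> all_dists \<Longrightarrow> op_eval D (exp_transform \<xi>) x = \<xi> (\<lambda>z. poly (op_symbol D x) z * exp (x * z))"
  using op_eval_dist_poly_exp[of \<xi> D 1 x] by (simp add: exp_transform_def)

lemma op_eval_exp: "op_eval D (\<lambda>x. exp (x * z)) x = poly (op_symbol D x) z * exp (x * z)"
  using op_eval_exp_transform[of "delta 0 z" D x] by (simp add: exp_transform_def delta_def)

lemma dist_poly_exp_sum: "\<xi> \<in> all_dists \<Longrightarrow> \<xi> (\<lambda>z. poly (p + q) z * exp (x * z))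
   = \<xi> (\<lambda>z. poly p z * exp (x * z)) + \<xi> (\<lambda>z. poly q z * exp (x * z))"
  using dist_add_right[OF _ entire_poly_exp entire_poly_exp, of \<xi> p x q x] by (simp add: algebra_simps)

text \<open>The derivatives of the transform at \<open>0\<close> are the values on the monomials, and these determine
  the distribution.\<close>

lemma exp_transform_eq_0D:
  assumes "\<xi> \<in> all_dists" "exp_transform \<xi> = (\<lambda>_. 0)"
  shows "\<xi> = 0"
proof (rule dist_eq_0I_poly[OF assms(1)])
  have "(\<lambda>x. \<xi> (\<lambda>z. poly p z * exp (x * z))) = (\<lambda>_. 0)" for p
  proof (induction p)
    case 0
    then show ?case using assms by simp
  next
    case (pCons a p)
    have "(\<lambda>x. \<xi> (\<lambda>z. poly (pCons 0 p) z * exp (x * z))) = (\<lambda>_. 0)"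
      using deriv_dist_poly_exp[OF assms(1), of p] pCons.IH by simp
    then have 1: "\<xi> (\<lambda>z. poly (pCons 0 p) z * exp (x * z)) = 0" for x by metis
    have "exp_transform \<xi> x = 0" for x using assms(2) by metis
    then have 2: "\<xi> (\<lambda>z. a * exp (x * z)) = 0" for x
      using dist_cmult_right[OF assms(1) entire_exp_mult] by (simp add: exp_transform_def)
    have "\<xi> (\<lambda>z. poly (pCons a p) z * exp (x * z)) = 0" for x
      using dist_poly_exp_sum[OF assms(1), of "[:a:]" "pCons 0 p" x] 1[of x] 2[of x] by simp
    then show ?case by simp
  qed
  from fun_cong[OF this, of _ 0] show "\<xi> (poly p) = 0" for p by simp
qed

lemma exp_transform_dists_at:
  assumes "\<xi> \<in> dists_at a"
  shows "\<exists>p. exp_transform \<xi> = (\<lambda>x. poly p x * exp (a * x))"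
  using assms unfolding dists_at_def
proof (induction rule: dist.span_induct_alt)
  case base
  show ?case by (rule exI[of _ 0]) (simp add: exp_transform_def)
next
  case (step c \<xi> \<eta>)
  obtain k where k: "\<xi> = delta k a" using step(1) by blast
  obtain p where p: "exp_transform \<eta> = (\<lambda>x. poly p x * exp (a * x))" using step(2) by blast
  have "(deriv ^^ k) (\<lambda>z. exp (x * z)) = (\<lambda>z. x ^ k * exp (x * z))" for x :: complex
  proof (induction k)
    case (Suc k)
    have "deriv (\<lambda>z. x ^ k * exp (x * z)) = (\<lambda>z. x ^ Suc k * exp (x * z))"
      by (rule ext, rule DERIV_imp_deriv) (auto intro!: derivative_eq_intros)
    then show ?case using Suc by simp
  qed simp
  then have "exp_transform \<xi> = (\<lambda>x. poly (monom ((-1) ^ k) k) x * exp (a * x))"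
    by (simp add: exp_transform_def k delta_def poly_monom mult_ac)
  then show ?case
    by (intro exI[of _ "smult c (monom ((-1) ^ k) k) + p"])
      (simp only: exp_transform_add exp_transform_scale p poly_add poly_smult, simp add: algebra_simps)
qed

section \<open>Annihilators\<close>

text \<open>The usual argument for finitely many functionals: either the new functional \<open>\<zeta>\<close> already
  vanishes on the common kernel of the others, or a vector \<open>p0\<close> of that kernel with
  \<open>\<zeta>(p0) \<noteq> 0\<close> makes it possible to subtract a multiple of \<open>\<zeta>\<close> from \<open>\<xi>\<close>.\<close>

lemma dist_in_span_if_kills_common_kernel:
  assumes "finite B" "B \<subseteq> all_dists" "\<xi> \<in> all_dists" "\<And>p. (\<And>\<zeta>. \<zeta> \<in> B \<Longrightarrow> \<zeta> (poly p) = 0) \<Longrightarrow> \<xi> (poly p) = 0"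
  shows "\<xi> \<in> dist.span B"
  using assms
proof (induction B arbitrary: \<xi> rule: finite_induct)
  case empty
  then have "\<xi> = 0" by (intro dist_eq_0I_poly) auto
  then show ?case by (simp only: dist.span_empty singleton_iff)
next
  case (insert \<zeta> B)
  have sub: "dist.span B \<subseteq> dist.span (insert \<zeta> B)" by (intro dist.span_mono) auto
  have ch: "\<zeta> \<in> all_dists" using insert.prems by auto
  show ?case
  proof (cases "\<forall>p. (\<forall>\<eta>\<in>B. \<eta> (poly p) = 0) \<longrightarrow> \<zeta> (poly p) = 0")
    case True
    then have "\<xi> \<in> dist.span B"
      by (intro insert.IH) (use insert.prems True in blast)+
    then show ?thesis using sub by blast
  next
    case False
    then obtain p0 where p0: "\<forall>\<eta>\<in>B. \<eta> (poly p0) = 0" "\<zeta> (poly p0) \<noteq> 0" by blast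
    define c where "c = \<xi> (poly p0) / \<zeta> (poly p0)"
    have "\<xi> - dist_scale c \<zeta> \<in> dist.span B"
    proof (rule insert.IH)
      fix p assume p: "\<And>\<eta>. \<eta> \<in> B \<Longrightarrow> \<eta> (poly p) = 0"
      define t where "t = \<zeta> (poly p) / \<zeta> (poly p0)"
      have lin: "\<eta> (poly (p + smult (- t) p0)) = \<eta> (poly p) - t * \<eta> (poly p0)" if "\<eta> \<in> all_dists" for \<eta>
      proof -
        have "poly (p + smult (- t) p0) = (\<lambda>z. poly p z + (- t) * poly p0 z)" by auto
        moreover have "entire (\<lambda>z. (- t) * poly p0 z)" by (intro holomorphic_intros)
        ultimately have "\<eta> (poly (p + smult (- t) p0)) = \<eta> (poly p) + (- t) * \<eta> (poly p0)"
          using dist_add_right[OF that entire_poly] dist_cmult_right[OF that entire_poly, of "- t" p0] by metis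
        then show ?thesis by simp
      qed
      have "\<xi> (poly (p + smult (- t) p0)) = 0"
      proof (rule insert.prems(3))
        fix \<eta> assume "\<eta> \<in> insert \<zeta> B"
        then show "\<eta> (poly (p + smult (- t) p0)) = 0"
        proof
          assume "\<eta> = \<zeta>"
          then show ?thesis using lin[OF ch] p0 by (simp add: t_def)
        next
          assume B: "\<eta> \<in> B"
          then have "\<eta> \<in> all_dists" using insert.prems(1) by blast
          moreover have "\<eta> (poly p) = 0" "\<eta> (poly p0) = 0" using B p p0(1) by blast+
          ultimately show ?thesis using lin[of \<eta>] by simp
        qed
      qed
      then show "(\<xi> - dist_scale c \<zeta>) (poly p) = 0"
      proof -
        assume "\<xi> (poly (p + smult (- t) p0)) = 0"
        then have "\<xi> (poly p) - t * \<xi> (poly p0) = 0"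
          unfolding lin[OF insert.prems(2)] .
        then have "\<xi> (poly p) = t * \<xi> (poly p0)" by simp
        also have "\<dots> = c * \<zeta> (poly p)" by (simp add: t_def c_def)
        finally show ?thesis by simp
      qed
    next
      show "B \<subseteq> all_dists" using insert.prems(1) by blast
      show "\<xi> - dist_scale c \<zeta> \<in> all_dists" by (intro all_dists_diff all_dists_scale ch insert.prems(2))
    qed
    then have "\<xi> - dist_scale c \<zeta> \<in> dist.span (insert \<zeta> B)" using sub by blast
    moreover have "dist_scale c \<zeta> \<in> dist.span (insert \<zeta> B)"
      by (intro dist.span_scale dist.span_base) auto
    ultimately have "(\<xi> - dist_scale c \<zeta>) + dist_scale c \<zeta> \<in> dist.span (insert \<zeta> B)"
      by (rule dist.span_add)
    then show ?thesis by (simp only: diff_add_cancel)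
  qed
qed

text \<open>Being \<open>b\<close> times a function killed by \<open>C\<close> is itself the vanishing of a set of distributions, namely of
  all \<open>\<xi>\<close> whose pullback along multiplication by \<open>b\<close> lies in \<open>C\<close>. For \<open>b = (z - a) b'\<close>, the
  choice \<open>\<xi> = \<delta>(z - a)\<close>, whose pullback is \<open>0\<close>, shows that \<open>u\<close> vanishes at \<open>a\<close>;
  surjectivity of the transpose of \<open>z - a\<close> passes the condition to \<open>u / (z - a)\<close> and \<open>b'\<close>.\<close>

lemma divisible_with_killed_quotient:
  assumes b: "b \<noteq> 0" and C: "C \<subseteq> all_dists" "0 \<in> C" and u: "entire u"
    and kill: "\<And>\<xi> \<zeta>. \<xi> \<in> all_dists \<Longrightarrow> \<zeta> \<in> C \<Longrightarrow> (\<And>f. entire f \<Longrightarrow> \<xi> (\<lambda>z. poly b z * f z) = \<zeta> f) \<Longrightarrow> \<xi> u = 0"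
  shows "\<exists>f. entire f \<and> (\<forall>z. u z = poly b z * f z) \<and> (\<forall>\<zeta>\<in>C. \<zeta> f = 0)"
  using b u kill
proof (induction arbitrary: u rule: nonzero_poly_induct)
  case (const c)
  have e: "entire (\<lambda>z. (1 / c) * u z)" using const.prems by (intro holomorphic_intros)
  have "\<zeta> (\<lambda>z. (1 / c) * u z) = 0" if "\<zeta> \<in> C" for \<zeta>
  proof -
    have c: "\<zeta> \<in> all_dists" using that C by auto
    \<comment> \<open>The pullback of this distribution along multiplication by \<open>c\<close> is \<open>\<zeta>\<close>.\<close>
    have "dist_scale (1 / c) \<zeta> u = 0"
    proof (rule const.prems(2)[OF _ that])
      show "dist_scale (1 / c) \<zeta> (\<lambda>z. poly [:c:] z * f z) = \<zeta> f" if "entire f" for f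
        using const(1) dist_cmult_right[OF c that, of c] by simp
    qed (rule all_dists_scale[OF c])
    then have "\<zeta> u = 0" using const.hyps by simp
    then show ?thesis by (simp only: dist_cmult_right[OF c const.prems(1)] mult_zero_right)
  qed
  then show ?case using e const(1) by (intro exI[of _ "\<lambda>z. (1 / c) * u z"]) auto
next
  case (root a b)
  obtain h where h: "entire h" "\<And>z. u z = u a + (z - a) * h z" using entire_divide_root[OF root.prems(1), of a] by blast
  have "delta 0 a u = 0"
  proof (rule root.prems(2)[OF _ C(2)])
    fix f assume f: "entire f"
    have "entire (\<lambda>z. poly ([:- a, 1:] * b) z * f z)" using f by (intro holomorphic_intros)
    then show "delta 0 a (\<lambda>z. poly ([:- a, 1:] * b) z * f z) = 0 f" by (simp add: delta_def)
  qed simp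
  then have "u a = 0" using root.prems(1) by (simp add: delta_def)
  then have u: "u = (\<lambda>z. (z - a) * h z)" using h(2) by (intro ext) (metis add_0)
  have "\<exists>f. entire f \<and> (\<forall>z. h z = poly b z * f z) \<and> (\<forall>\<zeta>\<in>C. \<zeta> f = 0)"
  proof (rule root.IH[OF h(1)])
    fix \<xi> \<zeta> assume x: "\<xi> \<in> all_dists" "\<zeta> \<in> C" "\<And>f. entire f \<Longrightarrow> \<xi> (\<lambda>z. poly b z * f z) = \<zeta> f"
    obtain \<eta> where n: "\<eta> \<in> all_dists" "\<forall>f. entire f \<longrightarrow> \<eta> (\<lambda>z. (z - a) * f z) = \<xi> f"
      using shift_transpose_surj[OF x(1)] by blast
    have "\<eta> u = 0"
    proof (rule root.prems(2)[OF n(1) x(2)])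
      fix f assume f: "entire f"
      have "entire (\<lambda>z. poly b z * f z)" using f by (intro holomorphic_intros)
      moreover have "(\<lambda>z. poly ([:- a, 1:] * b) z * f z) = (\<lambda>z. (z - a) * (poly b z * f z))"
        by (simp add: algebra_simps)
      ultimately show "\<eta> (\<lambda>z. poly ([:- a, 1:] * b) z * f z) = \<zeta> f" using n x(3)[OF f] by simp
    qed
    then show "\<xi> h = 0" using n(2) h(1) u by simp
  qed
  then obtain f where f: "entire f" "\<forall>z. h z = poly b z * f z" "\<forall>\<zeta>\<in>C. \<zeta> f = 0" by blast
  have "u z = poly ([:- a, 1:] * b) z * f z" for z
  proof -
    have "u z = (z - a) * (poly b z * f z)" by (simp only: u f(2)[rule_format])
    then show ?thesis by (simp only: poly_mult poly_linear_factor mult.assoc)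
  qed
  then show ?case using f(1,3) by (intro exI[of _ f] conjI allI)
qed

section \<open>The operator with kernel prescribed by a space of distributions\<close>

text \<open>Identities with finitely many exceptions may be differentiated: at all but finitely many points
  they hold in a neighbourhood. From here on finite exceptional sets are handled by the
  cofinite filter.\<close>

lemma cofinite_nhds:
  assumes "\<forall>\<^sub>F x in cofinite. P x"
  shows "\<forall>\<^sub>F x in cofinite. \<forall>\<^sub>F y in nhds (x :: complex). P y"
proof -
  have "finite {x. \<not> P x}" using assms by (simp add: eventually_cofinite)
  then have "open (- {x. \<not> P x})" by (simp add: finite_imp_closed open_Compl)
  then have "P x \<Longrightarrow> \<forall>\<^sub>F y in nhds x. P y" for x
    unfolding eventually_nhds by (metis (mono_tags, lifting) ComplI ComplD mem_Collect_eq)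
  then show ?thesis using assms by (rule eventually_mono[rotated])
qed

lemma cofinite_rat_regular: "\<forall>\<^sub>F x in cofinite. rat_regular r x"
  by (simp add: eventually_cofinite finite_not_rat_regular)

lemma cofinite_op_regular: "\<forall>\<^sub>F x in cofinite. op_regular D x"
  by (simp add: eventually_cofinite finite_not_op_regular)

lemma cofinite_rat_nonzero: "r \<noteq> 0 \<Longrightarrow> \<forall>\<^sub>F x in cofinite. rat_eval r x \<noteq> 0"
  by (simp add: eventually_cofinite finite_rat_zeros)

lemma cofinite_rat_eq_0: "\<forall>\<^sub>F x in cofinite. rat_eval r x = 0 \<Longrightarrow> r = 0"
  unfolding eventually_cofinite by (rule ratfun_eq_0I) auto

lemma finite_exceptions_iff_cofinite: "(\<exists>F. finite F \<and> (\<forall>x. x \<notin> F \<longrightarrow> P x)) \<longleftrightarrow> eventually P cofinite"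
proof
  assume "\<exists>F. finite F \<and> (\<forall>x. x \<notin> F \<longrightarrow> P x)"
  then obtain F where F: "finite F" "\<forall>x. x \<notin> F \<longrightarrow> P x" by blast
  have "{x. \<not> P x} \<subseteq> F" using F by blast
  then show "eventually P cofinite" unfolding eventually_cofinite using F finite_subset by blast
next
  assume "eventually P cofinite"
  then show "\<exists>F. finite F \<and> (\<forall>x. x \<notin> F \<longrightarrow> P x)"
    unfolding eventually_cofinite by (intro exI[of _ "{x. \<not> P x}"]) auto
qed

lemma op_kernel_iff: "f \<in> op_kernel D \<longleftrightarrow> entire f \<and> (\<forall>\<^sub>F x in cofinite. op_eval D f x = 0)"
  unfolding op_kernel_def by (simp add: finite_exceptions_iff_cofinite)

lemma cofinite_at: "\<forall>\<^sub>F x in cofinite. P x \<Longrightarrow> \<forall>\<^sub>F y in at (x :: complex). P y"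
proof -
  assume "\<forall>\<^sub>F x in cofinite. P x"
  then have "finite ({x. \<not> P x} - {x})" by (simp add: eventually_cofinite)
  then have "open (- ({x. \<not> P x} - {x}))" by (intro open_Compl finite_imp_closed)
  then show ?thesis unfolding eventually_at_topological by blast
qed

lemma entire_eqI_cofinite:
  assumes "entire f" "entire g" "\<forall>\<^sub>F x in cofinite. f x = g x"
  shows "f = g"
proof
  fix x
  have "isCont f x" "isCont g x"
    using assms(1,2) holomorphic_on_imp_continuous_on continuous_on_eq_continuous_at open_UNIV by blast+
  then have 1: "f \<midarrow>x\<rightarrow> f x" and 2: "g \<midarrow>x\<rightarrow> g x" by (auto simp: isCont_def)
  have "g \<midarrow>x\<rightarrow> f x"
    by (rule Lim_transform_eventually[OF 1 cofinite_at[OF assms(3)]])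
  then show "f x = g x" using 2 LIM_unique by blast
qed

text \<open>Functions of the form rational times \<open>e\<^sup>a\<^sup>x\<close> are closed under differential operators. This
  keeps the coefficients of the operators constructed below rational.\<close>

lemma op_eval_rat_times_exp:
  "\<exists>s. \<forall>x. rat_regular r x \<longrightarrow> op_regular D x \<longrightarrow>
     rat_regular s x \<and> op_eval D (\<lambda>x. rat_eval r x * exp (a * x)) x = rat_eval s x * exp (a * x)"
proof (induction D arbitrary: r)
  case 0
  show ?case by (rule exI[of _ 0]) simp
next
  case (pCons c D)
  define r' where "r' = rat_deriv r + rat_const a * r"
  obtain s where s: "\<And>x. rat_regular r' x \<Longrightarrow> op_regular D x \<Longrightarrow>
     rat_regular s x \<and> op_eval D (\<lambda>x. rat_eval r' x * exp (a * x)) x = rat_eval s x * exp (a * x)"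
    using pCons.IH by blast
  show ?case
  proof (intro exI[of _ "c * r + s"] allI impI)
    fix x assume r: "rat_regular r x" and "op_regular (pCons c D) x"
    then have c: "rat_regular c x" and D: "op_regular D x" by (auto simp: op_regular_pCons)
    have rr: "rat_regular r' y" if "rat_regular r y" for y
      unfolding r'_def using that by (intro rat_regular_add rat_regular_mult rat_regular_deriv) auto
    have "\<forall>\<^sub>F y in nhds x. rat_regular r y"
      using open_rat_regular r by (auto simp: eventually_nhds)
    then have "\<forall>\<^sub>F y in nhds x. deriv (\<lambda>x. rat_eval r x * exp (a * x)) y = rat_eval r' y * exp (a * y)"
    proof eventually_elim
      case (elim y)
      have "((\<lambda>x. rat_eval r x * exp (a * x)) has_field_derivative
          rat_eval (rat_deriv r) y * exp (a * y) + (exp (a * y) * a) * rat_eval r y) (at y)"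
        by (intro DERIV_mult has_field_derivative_rat_eval elim) (auto intro!: derivative_eq_intros)
      moreover have "rat_eval r' y = rat_eval (rat_deriv r) y + a * rat_eval r y"
        unfolding r'_def using elim by (simp add: rat_eval_add rat_eval_mult rat_regular_mult rat_regular_deriv)
      ultimately show ?case by (simp add: DERIV_imp_deriv algebra_simps)
    qed
    then have "op_eval D (deriv (\<lambda>x. rat_eval r x * exp (a * x))) x = rat_eval s x * exp (a * x)"
      using s[OF rr[OF r] D] op_eval_cong_ev by metis
    moreover have "rat_eval (c * r + s) x = rat_eval c x * rat_eval r x + rat_eval s x"
      using s[OF rr[OF r] D] r c by (simp add: rat_eval_add rat_eval_mult rat_regular_mult)
    ultimately show "rat_regular (c * r + s) x \<and>
       op_eval (pCons c D) (\<lambda>x. rat_eval r x * exp (a * x)) x = rat_eval (c * r + s) x * exp (a * x)"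
      using s[OF rr[OF r] D] r c by (simp add: op_eval_pCons rat_regular_add rat_regular_mult algebra_simps)
  qed
qed

lemma finite_complement_connected: "finite F \<Longrightarrow> connected (- F :: complex set)"
  using connected_open_delete_finite[of UNIV F] convex_connected[OF convex_UNIV]
  by (simp add: Compl_eq_Diff_UNIV)

lemma exp_transform_inj:
  assumes "\<xi> \<in> all_dists" "\<eta> \<in> all_dists" "exp_transform \<xi> = exp_transform \<eta>"
  shows "\<xi> = \<eta>"
proof -
  have "exp_transform (\<xi> - \<eta>) = (\<lambda>_. 0)"
    using fun_cong[OF assms(3)] by (auto simp: exp_transform_def)
  then have "\<xi> - \<eta> = 0" by (intro exp_transform_eq_0D all_dists_diff assms(1,2))
  then show ?thesis by (rule eq_iff_diff_eq_0[THEN iffD2])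
qed

lemma span_in_all_dists: "B \<subseteq> all_dists \<Longrightarrow> dist.span B \<subseteq> all_dists"
  unfolding all_dists_def by (rule dist.span_minimal) auto

text \<open>The operator \<open>L = \<partial> - h'/h\<close> has rational coefficients for \<open>h = s e\<^sup>a\<^sup>x\<close>, since
  \<open>h'/h = s'/s + a\<close>.\<close>

lemma first_order_annihilator:
  fixes s :: ratfun and a :: complex
  assumes "s \<noteq> 0"
  defines "h \<equiv> \<lambda>x. rat_eval s x * exp (a * x)"
  defines "L \<equiv> [:- (rat_deriv s * inverse s + rat_const a), 1:]"
  shows "\<forall>\<^sub>F x in cofinite. h analytic_on {x} \<and> h x \<noteq> 0 \<and> op_eval L h x = 0 \<and>
    (\<forall>g. op_eval L g x = deriv g x - deriv h x / h x * g x)"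
  using cofinite_rat_regular[of s] cofinite_rat_nonzero[OF assms(1)]
proof eventually_elim
  case (elim x)
  have hd: "(h has_field_derivative rat_eval (rat_deriv s) x * exp (a * x) + (exp (a * x) * a) * rat_eval s x) (at x)"
    unfolding h_def
    by (intro DERIV_mult has_field_derivative_rat_eval elim) (auto intro!: derivative_eq_intros)
  have i: "rat_regular (inverse s) x" "rat_eval (inverse s) x = inverse (rat_eval s x)"
    using elim by (auto intro: rat_regular_inverse rat_eval_inverse)
  have v: "rat_regular (rat_deriv s * inverse s + rat_const a) x"
    using elim i by (intro rat_regular_add rat_regular_mult rat_regular_deriv) auto
  have "rat_eval (- (rat_deriv s * inverse s + rat_const a)) x
     = rat_eval (rat_const (-1)) x * rat_eval (rat_deriv s * inverse s + rat_const a) x"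
  proof -
    have "[:- 1 :: complex:] = - 1" by (simp add: one_pCons)
    then have "rat_const (-1) = - 1" by (simp add: rat_const_def)
    then have "- (rat_deriv s * inverse s + rat_const a) = rat_const (-1) * (rat_deriv s * inverse s + rat_const a)"
      by simp
    then show ?thesis using v rat_eval_mult[OF rat_regular_const v] by metis
  qed
  also have "\<dots> = - (rat_eval (rat_deriv s) x / rat_eval s x + a)"
    using elim i by (simp add: rat_eval_add rat_eval_mult rat_regular_mult rat_regular_deriv divide_inverse)
  also have "\<dots> = - (deriv h x / h x)"
  proof -
    have "deriv h x = (rat_eval (rat_deriv s) x / rat_eval s x + a) * h x"
      unfolding DERIV_imp_deriv[OF hd] using elim by (simp add: h_def distrib_right)
    moreover have "h x \<noteq> 0" using elim by (simp add: h_def)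
    ultimately show ?thesis by simp
  qed
  finally have L: "op_eval L g x = deriv g x - deriv h x / h x * g x" for g
    by (simp add: L_def op_eval_pCons)
  have "h analytic_on {x}"
    unfolding h_def using elim by (intro analytic_intros analytic_rat_eval)
  then show ?case using L elim by (simp add: h_def)
qed

text \<open>The quotient \<open>g/h\<close> has derivative zero, and the complement of a finite set in the plane is connected.\<close>

lemma first_order_solutions_proportional:
  assumes h: "\<forall>\<^sub>F x in cofinite. h analytic_on {x} \<and> h x \<noteq> 0"
    and g: "\<forall>\<^sub>F x in cofinite. g analytic_on {x} \<and> deriv g x = deriv h x / h x * g x"
  shows "\<exists>c. \<forall>\<^sub>F x in cofinite. g x = c * h x"
proof -
  define F where "F = {x. \<not> ((h analytic_on {x} \<and> h x \<noteq> 0) \<and> (g analytic_on {x} \<and> deriv g x = deriv h x / h x * g x))}"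
  have "finite F" using eventually_conj[OF h g] unfolding F_def eventually_cofinite .
  then have co: "connected (- F)" and op: "open (- F)"
    by (simp_all add: finite_complement_connected finite_imp_closed open_Compl)
  have "((\<lambda>x. g x / h x) has_field_derivative 0) (at x)" if "x \<in> - F" for x
  proof -
    have x: "h analytic_on {x}" "h x \<noteq> 0" "g analytic_on {x}" "deriv g x = deriv h x / h x * g x"
      using that unfolding F_def by blast+
    have "(h has_field_derivative deriv h x) (at x)" "(g has_field_derivative deriv g x) (at x)"
      using x analytic_on_imp_differentiable_at DERIV_deriv_iff_field_differentiable by blast+
    then have "((\<lambda>x. g x / h x) has_field_derivative (deriv g x * h x - g x * deriv h x) / (h x * h x)) (at x)"
      using x(2) by (intro DERIV_divide)
    then show ?thesis using x by simp
  qed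
  then have "(\<lambda>x. g x / h x) constant_on - F"
    using co op by (rule has_field_derivative_0_imp_constant_on)
  then obtain c where "\<And>x. x \<in> - F \<Longrightarrow> g x / h x = c" unfolding constant_on_def by blast
  moreover have "h x \<noteq> 0" if "x \<notin> F" for x
    using that unfolding F_def by blast
  ultimately have "g x = c * h x" if "x \<notin> F" for x
    using that by (metis ComplI nonzero_mult_div_cancel_right times_divide_eq_left)
  then have "\<forall>\<^sub>F x in cofinite. g x = c * h x" unfolding finite_exceptions_iff_cofinite[symmetric] using \<open>finite F\<close> by blast
  then show ?thesis ..
qed

text \<open>Annihilation is understood up to finitely many points, as the coefficients of \<open>E\<close> may have poles.\<close>

definition op_annihilates :: "diffop \<Rightarrow> dist \<Rightarrow> bool" where
  "op_annihilates E \<xi> \<longleftrightarrow> (\<forall>\<^sub>F x in cofinite. op_eval E (exp_transform \<xi>) x = 0)"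

text \<open>The operator is built one basis element at a time. If \<open>D\<close> belongs to \<open>B\<close> and \<open>\<xi>\<close> is a further
  distribution supported at \<open>a\<close>, then \<open>D\<close> maps the transform of \<open>\<xi>\<close> to \<open>h = s e\<^sup>a\<^sup>x\<close> with \<open>s\<close>
  rational and nonzero, and \<open>(\<partial> - h'/h) D\<close> is the next operator. A function killed by it is sent
  by \<open>D\<close> to a multiple of \<open>h\<close>, so it differs from a multiple of the transform of \<open>\<xi>\<close> by an
  element of the kernel of \<open>D\<close>. Carrying right divisibility through the same induction also yields
  uniqueness of the operator.\<close>

lemma ex_monic_operator:
  assumes "finite B" "B \<subseteq> (\<Union>a. dists_at a)" "\<not> dist.dependent B"
  shows "\<exists>D. lead_coeff D = 1 \<and> degree D = card B \<and> op_kernel D = exp_transform ` dist.span B \<and>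
     (\<forall>E. (\<forall>\<xi>\<in>B. op_annihilates E \<xi>) \<longrightarrow> (\<exists>Q. E = op_mult Q D))"
  using assms
proof (induction B rule: finite_induct)
  case empty
  have k1: "op_kernel 1 = exp_transform ` dist.span {}"
  proof -
    have "exp_transform 0 = (\<lambda>_. 0)" by (rule ext) (simp only: exp_transform_def zero_fun_apply)
    then have z: "exp_transform ` dist.span {} = {\<lambda>_. 0}" by (simp only: dist.span_empty image_insert image_empty)
    have "f \<in> op_kernel 1 \<longleftrightarrow> f = (\<lambda>_. 0)" for f
    proof
      assume "f \<in> op_kernel 1"
      then have "entire f" "\<forall>\<^sub>F x in cofinite. f x = 0" by (simp_all add: op_kernel_iff)
      then show "f = (\<lambda>_. 0)" by (intro entire_eqI_cofinite holomorphic_on_const)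
    qed (auto simp: op_kernel_iff)
    then show ?thesis unfolding z by blast
  qed
  show ?case
  proof (rule exI[of _ 1], intro conjI allI impI k1)
    show "\<exists>Q. E = op_mult Q 1" for E by (rule exI[of _ E]) simp
  qed simp_all
next
  case (insert \<xi> B)
  have "\<not> dist.dependent (insert \<xi> B) \<longleftrightarrow> \<not> dist.dependent B \<and> \<xi> \<notin> dist.span B"
    using dist.independent_insert[of \<xi> B] unfolding if_not_P[OF insert.hyps(2)] .
  then have ind: "\<not> dist.dependent B" and nin: "\<xi> \<notin> dist.span B"
    using insert.prems(2) by iprover+
  have sub: "insert \<xi> B \<subseteq> all_dists" using insert.prems(1) dists_at_subset by blast
  then have xi: "\<xi> \<in> all_dists" and spanB: "dist.span B \<subseteq> all_dists" using span_in_all_dists by blast+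
  obtain D where D: "lead_coeff D = 1" "degree D = card B" "op_kernel D = exp_transform ` dist.span B"
    "\<And>E. (\<forall>\<xi>\<in>B. op_annihilates E \<xi>) \<Longrightarrow> \<exists>Q. E = op_mult Q D"
    using insert.IH insert.prems(1) ind by (metis (no_types, lifting) insert_subset)
  obtain a where a: "\<xi> \<in> dists_at a" using insert.prems(1) by blast
  obtain p where p: "exp_transform \<xi> = (\<lambda>x. rat_eval (to_fract p) x * exp (a * x))"
    using exp_transform_dists_at[OF a] by auto
  obtain s where s: "\<And>x. op_regular D x \<Longrightarrow>
     rat_regular s x \<and> op_eval D (exp_transform \<xi>) x = rat_eval s x * exp (a * x)"
    using op_eval_rat_times_exp[of "to_fract p" D a] unfolding p by auto
  have Dxi: "\<forall>\<^sub>F x in cofinite. op_eval D (exp_transform \<xi>) x = rat_eval s x * exp (a * x)"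
    using cofinite_op_regular[of D] by eventually_elim (use s in blast)
  \<comment> \<open>Otherwise the transform of \<open>\<xi>\<close> would be that of an element of the span of \<open>B\<close>.\<close>
  have s0: "s \<noteq> 0"
  proof
    assume "s = 0"
    then have "exp_transform \<xi> \<in> op_kernel D" using Dxi entire_exp_transform[OF xi] by (simp add: op_kernel_iff)
    then obtain \<eta> where "\<eta> \<in> dist.span B" "exp_transform \<xi> = exp_transform \<eta>" using D(3) by blast
    then show False using exp_transform_inj xi spanB nin by blast
  qed
  define h where "h = (\<lambda>x. rat_eval s x * exp (a * x))"
  define L where "L = [:- (rat_deriv s * inverse s + rat_const a), 1:]"
  have Lh: "\<forall>\<^sub>F x in cofinite. h analytic_on {x} \<and> h x \<noteq> 0 \<and> op_eval L h x = 0 \<and>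
    (\<forall>g. op_eval L g x = deriv g x - deriv h x / h x * g x)"
    unfolding h_def L_def by (rule first_order_annihilator[OF s0])
  have Dxi: "\<forall>\<^sub>F x in cofinite. op_eval D (exp_transform \<xi>) x = h x" using Dxi by (simp add: h_def)
  have D0: "D \<noteq> 0" using D(1) by auto
  have deg: "degree (op_mult L D) = Suc (card B)"
    using degree_op_mult[of L D] D0 D(2) by (simp add: L_def)
  have lead: "lead_coeff (op_mult L D) = 1"
    using coeff_op_mult_top[of L D] deg D(1,2) by (simp add: L_def)
  have LD: "\<forall>\<^sub>F x in cofinite. \<forall>f. entire f \<longrightarrow> op_eval (op_mult L D) f x = op_eval L (op_eval D f) x"
    using cofinite_op_regular[of D] cofinite_op_regular[of L]
    by eventually_elim (auto simp: op_eval_mult entire_analytic_at)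
  have ker: "op_kernel (op_mult L D) = exp_transform ` dist.span (insert \<xi> B)"
  proof safe
    fix f assume "f \<in> op_kernel (op_mult L D)"
    then have f: "entire f" "\<forall>\<^sub>F x in cofinite. op_eval (op_mult L D) f x = 0" by (auto simp: op_kernel_iff)
    have "\<exists>c. \<forall>\<^sub>F x in cofinite. op_eval D f x = c * h x"
    proof (rule first_order_solutions_proportional)
      show "\<forall>\<^sub>F x in cofinite. h analytic_on {x} \<and> h x \<noteq> 0"
        using Lh by eventually_elim blast
      show "\<forall>\<^sub>F x in cofinite. op_eval D f analytic_on {x} \<and> deriv (op_eval D f) x = deriv h x / h x * op_eval D f x"
        using Lh LD f(2) cofinite_op_regular[of D]
      proof eventually_elim
        case (elim x)
        then have "op_eval L (op_eval D f) x = 0" using f(1) by simp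
        then show ?case using elim f(1) analytic_op_eval entire_analytic_at
          by (metis (no_types, lifting) eq_iff_diff_eq_0)
      qed
    qed
    then obtain c where c: "\<forall>\<^sub>F x in cofinite. op_eval D f x = c * h x" by blast
    have e: "entire (\<lambda>x. f x + (- c) * exp_transform \<xi> x)"
      using f(1) entire_exp_transform[OF xi] by (intro holomorphic_intros)
    have "\<forall>\<^sub>F x in cofinite. op_eval D (\<lambda>x. f x + (- c) * exp_transform \<xi> x) x = 0"
      using c Dxi
    proof eventually_elim
      case (elim x)
      have an: "exp_transform \<xi> analytic_on {x}" "f analytic_on {x}"
        using f(1) entire_exp_transform[OF xi] by (auto intro: entire_analytic_at)
      then have "(\<lambda>x. (- c) * exp_transform \<xi> x) analytic_on {x}" by (intro analytic_intros)
      then have "op_eval D (\<lambda>x. f x + (- c) * exp_transform \<xi> x) x = op_eval D f x + (- c) * op_eval D (exp_transform \<xi>) x"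
        using op_eval_add_right[OF an(2)] op_eval_cmult_right[OF an(1)] by metis
      then show ?case using elim by simp
    qed
    then have "(\<lambda>x. f x + (- c) * exp_transform \<xi> x) \<in> op_kernel D" using e by (simp add: op_kernel_iff)
    then obtain \<eta> where n: "\<eta> \<in> dist.span B" "(\<lambda>x. f x + (- c) * exp_transform \<xi> x) = exp_transform \<eta>"
      using D(3) by auto
    have "f = exp_transform (\<eta> + dist_scale c \<xi>)"
      unfolding exp_transform_add exp_transform_scale n(2)[symmetric] by simp
    moreover have "\<eta> + dist_scale c \<xi> \<in> dist.span (insert \<xi> B)"
    proof (intro dist.span_add dist.span_scale)
      show "\<eta> \<in> dist.span (insert \<xi> B)" using n(1) dist.span_mono[of B "insert \<xi> B"] by blast
      show "\<xi> \<in> dist.span (insert \<xi> B)" by (intro dist.span_base insertI1)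
    qed
    ultimately show "f \<in> exp_transform ` dist.span (insert \<xi> B)" by blast
  next
    fix \<eta> assume n: "\<eta> \<in> dist.span (insert \<xi> B)"
    then obtain c where c: "\<eta> - dist_scale c \<xi> \<in> dist.span B" using dist.span_breakdown_eq by blast
    define \<kappa> where "\<kappa> = \<eta> - dist_scale c \<xi>"
    have ka: "\<kappa> \<in> all_dists" using c spanB \<kappa>_def by blast
    have eta: "\<eta> \<in> all_dists" using n span_in_all_dists[OF sub] by blast
    have e: "exp_transform \<eta> = (\<lambda>x. exp_transform \<kappa> x + c * exp_transform \<xi> x)"
      by (simp add: \<kappa>_def exp_transform_def)
    have "exp_transform \<kappa> \<in> op_kernel D" using c D(3) unfolding \<kappa>_def by blast
    then have "\<forall>\<^sub>F x in cofinite. op_eval D (exp_transform \<kappa>) x = 0" by (simp add: op_kernel_iff)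
    then have De: "\<forall>\<^sub>F x in cofinite. op_eval D (exp_transform \<eta>) x = c * h x"
      using Dxi
    proof eventually_elim
      case (elim x)
      have an: "exp_transform \<xi> analytic_on {x}" "exp_transform \<kappa> analytic_on {x}"
        using ka xi by (auto intro: entire_analytic_at entire_exp_transform)
      then have "(\<lambda>x. c * exp_transform \<xi> x) analytic_on {x}" by (intro analytic_intros)
      then have "op_eval D (exp_transform \<eta>) x = op_eval D (exp_transform \<kappa>) x + c * op_eval D (exp_transform \<xi>) x"
        unfolding e using op_eval_add_right[OF an(2)] op_eval_cmult_right[OF an(1)] by metis
      then show ?case using elim by simp
    qed
    have "\<forall>\<^sub>F x in cofinite. op_eval (op_mult L D) (exp_transform \<eta>) x = 0"
      using cofinite_nhds[OF De] Lh LD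
    proof eventually_elim
      case (elim x)
      have "op_eval (op_mult L D) (exp_transform \<eta>) x = op_eval L (op_eval D (exp_transform \<eta>)) x"
        using elim entire_exp_transform[OF eta] by blast
      also have "\<dots> = op_eval L (\<lambda>x. c * h x) x" using elim by (intro op_eval_cong_ev) blast
      also have "\<dots> = c * op_eval L h x" using elim by (intro op_eval_cmult_right) blast
      finally show ?case using elim by simp
    qed
    then show "exp_transform \<eta> \<in> op_kernel (op_mult L D)"
      using entire_exp_transform[OF eta] by (simp add: op_kernel_iff)
  qed
  have div: "\<exists>Q. E = op_mult Q (op_mult L D)" if E: "\<forall>\<xi>\<in>insert \<xi> B. op_annihilates E \<xi>" for E
  proof -
    obtain Q where Q: "E = op_mult Q D" using D(4) E by blast
    obtain Q' c where Q': "Q = op_mult Q' L + [:c:]" using op_right_division_first_order unfolding L_def by blast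
    have Lh0: "\<forall>\<^sub>F x in cofinite. op_eval L h x = 0" using Lh by eventually_elim blast
    have "\<forall>\<^sub>F x in cofinite. op_eval E (exp_transform \<xi>) x = 0" using E by (simp add: op_annihilates_def)
    then have "\<forall>\<^sub>F x in cofinite. rat_eval c x = 0"
      using cofinite_nhds[OF Dxi] cofinite_nhds[OF Lh0] Lh cofinite_op_regular[of Q] cofinite_op_regular[of D]
        cofinite_op_regular[of Q'] cofinite_op_regular[of L] cofinite_rat_regular[of c]
    proof eventually_elim
      case (elim x)
      have "0 = op_eval Q (op_eval D (exp_transform \<xi>)) x"
        using elim unfolding Q
        by (subst op_eval_mult[symmetric]) (auto intro: entire_analytic_at entire_exp_transform xi)
      also have "\<dots> = op_eval Q h x" using elim by (intro op_eval_cong_ev) blast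
      also have "\<dots> = op_eval (op_mult Q' L) h x + rat_eval c x * h x"
        unfolding Q' using elim
        by (subst op_eval_add) (auto simp: op_regular_mult op_regular_pCons op_eval_pCons)
      also have "op_eval (op_mult Q' L) h x = op_eval Q' (op_eval L h) x"
        using elim by (intro op_eval_mult) blast+
      also have "\<dots> = op_eval Q' (\<lambda>_. 0) x" using elim by (intro op_eval_cong_ev) blast
      finally show ?case using elim by simp
    qed
    then have "c = 0" by (rule cofinite_rat_eq_0)
    then have "E = op_mult Q' (op_mult L D)" using Q Q' by (simp add: op_mult_assoc)
    then show ?thesis by blast
  qed
  show ?case
  proof (rule exI[of _ "op_mult L D"], intro conjI allI impI lead ker)
    show "degree (op_mult L D) = card (insert \<xi> B)" unfolding deg card_insert_disjoint[OF insert.hyps] ..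
  qed (rule div)
qed

lemma homogeneous_basis:
  assumes "finite_dimensional C" "homogeneous C"
  obtains B where "finite B" "B \<subseteq> C" "B \<subseteq> (\<Union>a. dists_at a)" "\<not> dist.dependent B" "dist.span B = C" "card B = dist.dim C"
proof -
  define S where "S = (\<Union>a. C \<inter> dists_at a)"
  have S: "C = dist.span S" using assms(2) unfolding homogeneous_def S_def .
  obtain B where B: "B \<subseteq> S" "\<not> dist.dependent B" "S \<subseteq> dist.span B" "card B = dist.dim S"
    using dist.basis_exists[of S] by blast
  obtain B0 where B0: "finite B0" "C = dist.span B0" using assms(1) by (auto simp: finite_dimensional_def)
  have SC: "S \<subseteq> C" by (auto simp: S_def)
  have "finite B" using dist.independent_span_bound[OF B0(1) B(2)] B(1) SC B0(2) by blast
  moreover have "dist.span B = C"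
  proof
    show "dist.span B \<subseteq> C" unfolding S by (rule dist.span_mono[OF B(1)])
    show "C \<subseteq> dist.span B" unfolding S using B(3) dist.span_minimal dist.subspace_span by blast
  qed
  moreover have "dist.dim C = dist.dim S" unfolding S by (rule dist.dim_span)
  ultimately show ?thesis using B SC that[of B] by (auto simp: S_def)
qed

lemma D_op_properties:
  assumes "finite_dimensional C" "homogeneous C"
  shows "op_kernel (D_op C) = exp_transform ` C"
    and "\<forall>\<xi>\<in>C. op_annihilates E \<xi> \<Longrightarrow> \<exists>Q. E = op_mult Q (D_op C)"
proof -
  obtain B where B: "finite B" "B \<subseteq> C" "B \<subseteq> (\<Union>a. dists_at a)" "\<not> dist.dependent B" "dist.span B = C" "card B = dist.dim C"
    using homogeneous_basis[OF assms] .
  obtain D where D: "lead_coeff D = 1" "degree D = dist.dim C" "op_kernel D = exp_transform ` C"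
    "\<And>E. (\<forall>\<xi>\<in>B. op_annihilates E \<xi>) \<Longrightarrow> (\<exists>Q. E = op_mult Q D)"
    using ex_monic_operator[OF B(1,3,4)] B(5,6) by auto
  have et: "(\<lambda>\<xi> x. \<xi> (\<lambda>z. exp (x * z))) = exp_transform" by (simp add: exp_transform_def fun_eq_iff)
  have "D_op C = D"
    unfolding D_op_def et
  proof (rule the_equality)
    show "lead_coeff D = 1 \<and> degree D = dist.dim C \<and> op_kernel D = exp_transform ` C" using D by blast
    fix D' assume D': "lead_coeff D' = 1 \<and> degree D' = dist.dim C \<and> op_kernel D' = exp_transform ` C"
    have "op_annihilates D' \<xi>" if "\<xi> \<in> B" for \<xi>
      using that B(2) D' op_kernel_iff unfolding op_annihilates_def by blast
    then obtain Q where Q: "D' = op_mult Q D" using D(4) by blast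
    have "Q \<noteq> 0" "D \<noteq> 0" using Q D' D(1) by auto
    then have "degree Q = 0" using degree_op_mult[of Q D] Q D' D(2) by simp
    then obtain c where c: "Q = [:c:]" by (metis degree_eq_zeroE)
    then have "D' = smult c D" using Q by (simp add: op_mult_fun_left)
    moreover have "c \<noteq> 0" using c \<open>Q \<noteq> 0\<close> by auto
    ultimately have "c = 1" using D' D(1) by simp
    then show "D' = D" using \<open>D' = smult c D\<close> by simp
  qed
  then show "op_kernel (D_op C) = exp_transform ` C"
    and "\<forall>\<xi>\<in>C. op_annihilates E \<xi> \<Longrightarrow> \<exists>Q. E = op_mult Q (D_op C)"
    using D(3,4) B(2) by blast+
qed

section \<open>Operators in z acting on the wave function\<close>

text \<open>From here on an element of \<open>\<complex>(x)[z]\<close> is represented by the operator of which it is the symbol;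
  the product used is the commutative one of polynomials in \<open>z\<close>.\<close>

lemma op_regular_times: "op_regular A x \<Longrightarrow> op_regular B x \<Longrightarrow> op_regular (A * B) x"
  unfolding op_regular_def coeff_mult
  by (intro allI rat_eval_sum[THEN conjunct1] rat_regular_mult) auto

lemma op_symbol_times:
  assumes "op_regular A x" "op_regular B x"
  shows "op_symbol (A * B) x = op_symbol A x * op_symbol B x"
proof (rule poly_eqI)
  fix n
  have r: "rat_regular (coeff A i * coeff B (n - i)) x" for i
    using assms by (auto simp: op_regular_def intro: rat_regular_mult)
  have "coeff (op_symbol (A * B) x) n = (\<Sum>i\<le>n. rat_eval (coeff A i * coeff B (n - i)) x)"
    unfolding coeff_op_symbol coeff_mult using rat_eval_sum[of "{..n}" "\<lambda>i. coeff A i * coeff B (n - i)" x] r by blast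
  also have "\<dots> = coeff (op_symbol A x * op_symbol B x) n"
    unfolding coeff_mult coeff_op_symbol using assms
    by (intro sum.cong refl rat_eval_mult) (auto simp: op_regular_def)
  finally show "coeff (op_symbol (A * B) x) n = coeff (op_symbol A x * op_symbol B x) n" .
qed

lemma op_symbol_add:
  "op_regular A x \<Longrightarrow> op_regular B x \<Longrightarrow> op_symbol (A + B) x = op_symbol A x + op_symbol B x"
  by (rule poly_eqI) (simp add: coeff_op_symbol rat_eval_add op_regular_def)

lemma rat_const_0 [simp]: "rat_const 0 = 0"
  by (simp add: rat_const_def)

lemma rat_const_eq_0_iff [simp]: "rat_const c = 0 \<longleftrightarrow> c = 0"
  by (simp add: rat_const_def)

lemma op_regular_map_const [simp]: "op_regular (map_poly rat_const t) x"
  by (simp add: op_regular_def coeff_map_poly)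

lemma op_symbol_map_const [simp]: "op_symbol (map_poly rat_const t) x = t"
  by (rule poly_eqI) (simp add: coeff_op_symbol coeff_map_poly)

lemma rat_of_nat_eval: "rat_regular (of_nat n) x \<and> rat_eval (of_nat n) x = of_nat n"
  unfolding to_fract_of_nat[symmetric] by simp

lemma op_regular_pderiv: "op_regular G x \<Longrightarrow> op_regular (pderiv G) x"
  unfolding op_regular_def coeff_pderiv using rat_of_nat_eval rat_regular_mult by blast

lemma op_symbol_pderiv: "op_regular G x \<Longrightarrow> op_symbol (pderiv G) x = pderiv (op_symbol G x)"
  by (rule poly_eqI)
    (simp add: coeff_op_symbol coeff_pderiv rat_eval_mult rat_of_nat_eval op_regular_def del: of_nat_Suc)

lemma op_symbol_smult:
  "rat_regular r x \<Longrightarrow> op_regular G x \<Longrightarrow> op_symbol (smult r G) x = smult (rat_eval r x) (op_symbol G x)"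
  by (rule poly_eqI) (simp add: coeff_op_symbol rat_eval_mult op_regular_def)

text \<open>An operator in \<open>z\<close> with polynomial coefficients maps a polynomial in \<open>z\<close> times \<open>e\<^sup>x\<^sup>z\<close> to a function of
  the same kind, with coefficients still rational in \<open>x\<close>: the derivative \<open>\<partial>\<^sub>z\<close> turns \<open>G\<close> into
  \<open>\<partial>\<^sub>z G + x G\<close>.\<close>

lemma polynomial_op_on_symbol:
  "\<exists>G'. \<forall>x. op_regular G x \<longrightarrow> op_regular G' x \<and>
     op_eval (map_poly to_fract T) (\<lambda>z. poly (op_symbol G x) z * exp (x * z)) = (\<lambda>z. poly (op_symbol G' x) z * exp (x * z))"
proof (induction T arbitrary: G)
  case 0
  show ?case by (rule exI[of _ 0]) (simp add: fun_eq_iff)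
next
  case (pCons t T)
  define X where "X = to_fract [:0, 1::complex:]"
  define H where "H = pderiv G + smult X G"
  obtain G' where G': "\<And>x. op_regular H x \<Longrightarrow> op_regular G' x \<and>
     op_eval (map_poly to_fract T) (\<lambda>z. poly (op_symbol H x) z * exp (x * z)) = (\<lambda>z. poly (op_symbol G' x) z * exp (x * z))"
    using pCons.IH[of H] by blast
  show ?case
  proof (intro exI[of _ "map_poly rat_const t * G + G'"] allI impI)
    fix x assume G: "op_regular G x"
    have X: "rat_regular X x" "rat_eval X x = x" by (simp_all add: X_def)
    have H: "op_regular H x" unfolding H_def
      by (intro op_regular_add op_regular_pderiv op_regular_smult G X)
    have Hs: "op_symbol H x = pderiv (op_symbol G x) + smult x (op_symbol G x)"
      unfolding H_def using G X by (simp add: op_symbol_add op_symbol_pderiv op_symbol_smult op_regular_pderiv op_regular_smult)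
    have d: "deriv (\<lambda>z. poly (op_symbol G x) z * exp (x * z)) = (\<lambda>z. poly (op_symbol H x) z * exp (x * z))"
      unfolding Hs by (rule ext, rule DERIV_imp_deriv) (auto intro!: derivative_eq_intros simp: algebra_simps)
    have r: "op_regular (map_poly rat_const t * G) x" by (intro op_regular_times G) simp
    have s: "op_symbol (map_poly rat_const t * G + G') x = t * op_symbol G x + op_symbol G' x"
      using r G' H by (simp add: op_symbol_add op_symbol_times G)
    have "op_eval (map_poly to_fract (pCons t T)) (\<lambda>z. poly (op_symbol G x) z * exp (x * z)) z
       = poly (op_symbol (map_poly rat_const t * G + G') x) z * exp (x * z)" for z
      unfolding map_poly_to_fract_pCons op_eval_pCons d s using G'[OF H] by (simp add: algebra_simps)
    then show "op_regular (map_poly rat_const t * G + G') x \<and>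
       op_eval (map_poly to_fract (pCons t T)) (\<lambda>z. poly (op_symbol G x) z * exp (x * z))
       = (\<lambda>z. poly (op_symbol (map_poly rat_const t * G + G') x) z * exp (x * z))"
      using r G'[OF H] op_regular_add by blast
  qed
qed

lemma q_poly_nonzero: "q_poly C \<noteq> 0"
proof (cases "finite {a. dist.dim (C \<inter> dists_at a) \<noteq> 0}")
  case True
  then show ?thesis unfolding q_poly_def by (subst prod_zero_iff) auto
next
  case False
  then show ?thesis unfolding q_poly_def by (subst prod.infinite) auto
qed

lemma homogeneous_in_all_dists: "homogeneous C \<Longrightarrow> C \<subseteq> all_dists"
proof -
  assume "homogeneous C"
  then have "C = dist.span (\<Union>a. C \<inter> dists_at a)" unfolding homogeneous_def .
  moreover have "dist.span (\<Union>a. C \<inter> dists_at a) \<subseteq> all_dists"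
    by (rule span_in_all_dists) (use dists_at_subset in blast)
  ultimately show ?thesis by blast
qed

lemma finite_dimensional_0: "finite_dimensional C \<Longrightarrow> 0 \<in> C"
  unfolding finite_dimensional_def using dist.span_zero by blast

lemma span_vanishes:
  assumes "\<And>\<xi>. \<xi> \<in> B \<Longrightarrow> \<xi> f = 0" "\<xi> \<in> dist.span B"
  shows "\<xi> f = 0"
  using assms(2) by (induction rule: dist.span_induct_alt) (auto simp: assms(1))

lemma V_space_duality:
  assumes "finite_dimensional C" "homogeneous C" "\<xi> \<in> all_dists" "\<And>p. p \<in> V_space C \<Longrightarrow> \<xi> (poly p) = 0"
  shows "\<xi> \<in> C"
proof -
  obtain B where B: "finite B" "C = dist.span B" using assms(1) unfolding finite_dimensional_def by blast
  have BC: "B \<subseteq> C" unfolding B(2) by (rule dist.span_superset)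
  have "\<xi> \<in> dist.span B"
  proof (rule dist_in_span_if_kills_common_kernel[OF B(1) _ assms(3)])
    show "B \<subseteq> all_dists" using BC homogeneous_in_all_dists[OF assms(2)] by blast
    fix p assume "\<And>\<zeta>. \<zeta> \<in> B \<Longrightarrow> \<zeta> (poly p) = 0"
    then have "p \<in> V_space C" unfolding V_space_def B(2) using span_vanishes by blast
    then show "\<xi> (poly p) = 0" by (rule assms(4))
  qed
  then show ?thesis unfolding B(2) .
qed

text \<open>The function \<open>f\<^sub>x(z) = q(z) \<psi>(x,z)\<close>, which unlike \<open>\<psi>\<close> is entire in \<open>z\<close> and so can be paired
  with distributions.\<close>

definition wave_numerator :: "dist set \<Rightarrow> complex \<Rightarrow> complex \<Rightarrow> complex" where
  "wave_numerator C x z = poly (op_symbol (D_op C) x) z * exp (x * z)"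

lemma entire_wave_numerator [simp]: "entire (wave_numerator C x)"
  unfolding wave_numerator_def by (rule entire_poly_exp)

lemma wave_numerator_eq: "wave_numerator C x z = op_eval (D_op C) (\<lambda>x. exp (x * z)) x"
  by (simp add: wave_numerator_def op_eval_exp)

lemma wave_function_eq: "wave_function C x z = 1 / poly (q_poly C) z * wave_numerator C x z"
  by (simp add: wave_function_def wave_numerator_eq)

lemma dist_wave_numerator:
  "\<xi> \<in> all_dists \<Longrightarrow> \<xi> (wave_numerator C x) = op_eval (D_op C) (exp_transform \<xi>) x"
  unfolding wave_numerator_def by (rule op_eval_exp_transform[symmetric])

text \<open>The pairing with \<open>f\<^sub>x\<close> is \<open>D_op C\<close> applied to the transform of \<open>\<xi>\<close>, and the kernel of
  \<open>D_op C\<close> contains only transforms of elements of \<open>C\<close>.\<close>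

lemma wave_numerator_duality:
  assumes "finite_dimensional C" "homogeneous C" "\<xi> \<in> all_dists"
    "\<forall>\<^sub>F x in cofinite. \<xi> (wave_numerator C x) = 0"
  shows "\<xi> \<in> C"
proof -
  have "exp_transform \<xi> \<in> op_kernel (D_op C)"
    using assms(4) entire_exp_transform[OF assms(3)] by (simp add: op_kernel_iff dist_wave_numerator[OF assms(3)])
  then obtain \<eta> where "\<eta> \<in> C" "exp_transform \<xi> = exp_transform \<eta>"
    using D_op_properties(1)[OF assms(1,2)] by auto
  then show ?thesis using exp_transform_inj[OF assms(3)] homogeneous_in_all_dists[OF assms(2)] by blast
qed

lemma D_op_annihilates:
  assumes "finite_dimensional C" "homogeneous C" "\<xi> \<in> C"
  shows "\<forall>\<^sub>F x in cofinite. op_eval (D_op C) (exp_transform \<xi>) x = 0"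
proof -
  have "exp_transform \<xi> \<in> op_kernel (D_op C)" using D_op_properties(1)[OF assms(1,2)] assms(3) by blast
  then show ?thesis by (simp add: op_kernel_iff)
qed

text \<open>The exceptional set is that of the operator alone and does not depend on \<open>\<xi>\<close>: where the
  coefficients are regular, the vanishing extends by continuity. So for a single \<open>x\<close> all of
  \<open>C\<close>, and all transposed distributions that lie in \<open>C\<close>, can be applied to \<open>f\<^sub>x\<close>.\<close>

lemma wave_numerator_killed:
  assumes C: "finite_dimensional C" "homogeneous C" and xi: "\<xi> \<in> C" and x: "op_regular (D_op C) x"
  shows "\<xi> (wave_numerator C x) = 0"
proof -
  have xi': "\<xi> \<in> all_dists" using xi homogeneous_in_all_dists[OF C(2)] by blast
  define g where "g = op_eval (D_op C) (exp_transform \<xi>)"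
  have "g analytic_on {x}" unfolding g_def
    by (intro analytic_op_eval x entire_analytic_at entire_exp_transform xi')
  then have "isCont g x" by (rule analytic_at_imp_isCont)
  then have "g \<midarrow>x\<rightarrow> g x" by (simp add: isCont_def)
  moreover have "g \<midarrow>x\<rightarrow> 0"
    using cofinite_at[OF D_op_annihilates[OF C xi]] unfolding g_def by (rule tendsto_eventually)
  ultimately have "g x = 0" using LIM_unique by blast
  then show ?thesis by (simp add: dist_wave_numerator[OF xi'] g_def)
qed

text \<open>This says \<open>q R q\<^sup>-\<^sup>1 = b\<^sup>-\<^sup>1 T\<close>.\<close>

definition clears_denominators :: "complex poly \<Rightarrow> diffop \<Rightarrow> complex poly \<Rightarrow> complex poly poly \<Rightarrow> bool" where
  "clears_denominators q R b T \<longleftrightarrow> b \<noteq> 0 \<and>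
     map_poly to_fract T = smult (to_fract (b * q)) (op_mult R [:1 / to_fract q:])"

lemma ex_clears_denominators:
  obtains b T where "clears_denominators q R b T"
proof -
  obtain b T where "b \<noteq> 0" "smult (to_fract b) (smult (to_fract q) (op_mult R [:1 / to_fract q:])) = map_poly to_fract T"
    using common_denominator by blast
  then show ?thesis by (intro that[of b T]) (simp add: clears_denominators_def)
qed

lemma clears_denominators_apply:
  assumes "clears_denominators q R b T" "q \<noteq> 0"
  shows "op_apply R (to_fract v / to_fract q) = op_apply (map_poly to_fract T) (to_fract v) / to_fract (b * q)"
  using assms by (simp add: clears_denominators_def op_apply_smult op_apply_mult op_apply_pCons)

lemma clears_denominators_eval:
  assumes "clears_denominators q R b T" "poly q z \<noteq> 0" "op_regular R z" "entire f"
  shows "op_eval (map_poly to_fract T) f z = poly b z * poly q z * op_eval R (\<lambda>z. 1 / poly q z * f z) z"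
proof -
  define E where "E = [:1 / to_fract q:]"
  have rq: "1 / to_fract q = Fract 1 q" by (simp add: Fract_conv_to_fract)
  have E: "op_regular E y \<and> op_eval E f y = 1 / poly q y * f y" if "poly q y \<noteq> 0" for y
    using that unfolding E_def rq by (simp add: op_regular_pCons rat_regular_Fract op_eval_pCons rat_eval_Fract)
  have "open {y. poly q y \<noteq> 0}" by (intro open_Collect_neq continuous_intros)
  then have "\<forall>\<^sub>F y in nhds z. op_eval E f y = 1 / poly q y * f y"
    using assms(2) E by (auto simp: eventually_nhds)
  then have "op_eval R (op_eval E f) z = op_eval R (\<lambda>z. 1 / poly q z * f z) z"
    by (rule op_eval_cong_ev)
  moreover have "op_eval (map_poly to_fract T) f z = poly (b * q) z * op_eval (op_mult R E) f z"
    using assms E unfolding clears_denominators_def E_def[symmetric]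
    by (simp add: op_eval_smult op_regular_mult del: to_fract_mult poly_mult)
  moreover have "op_eval (op_mult R E) f z = op_eval R (op_eval E f) z"
    using assms E by (intro op_eval_mult entire_analytic_at) auto
  ultimately show ?thesis by simp
qed

text \<open>After multiplication by \<open>b q\<close> both sides of \<open>S\<cdot>\<psi> = R\<cdot>\<psi>\<close> are entire in \<open>z\<close>, so that the
  exceptional values of \<open>z\<close> disappear and distributions in \<open>z\<close> can be applied.\<close>

lemma fourier_algebra_iff:
  assumes cd: "clears_denominators (q_poly C) R b T"
  shows "R \<in> right_fourier_algebra (wave_function C) \<longleftrightarrow>
    (\<exists>S. \<forall>\<^sub>F x in cofinite. \<forall>z. op_eval (map_poly to_fract T) (wave_numerator C x) z
       = poly b z * (poly (op_symbol (op_mult S (D_op C)) x) z * exp (x * z)))"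
proof -
  define q where "q = q_poly C"
  define P where "P = D_op C"
  have q0: "q \<noteq> 0" by (simp add: q_def q_poly_nonzero)
  have b0: "b \<noteq> 0" using cd by (simp add: clears_denominators_def)
  have left: "op_eval S (\<lambda>x. wave_function C x z) x = 1 / poly q z * (poly (op_symbol (op_mult S P) x) z * exp (x * z))"
    if "op_regular P x" "op_regular S x" for S x z
  proof -
    have an: "(\<lambda>x. exp (x * z)) analytic_on {x}" by (intro analytic_intros)
    have w: "(\<lambda>x. wave_function C x z) = (\<lambda>x. 1 / poly q z * op_eval P (\<lambda>x. exp (x * z)) x)"
      by (simp add: wave_function_def q_def P_def)
    show ?thesis
      unfolding w op_eval_cmult_right[OF analytic_op_eval[OF that(1) an]]
        op_eval_mult[OF that(2,1) an, symmetric] op_eval_exp[of "op_mult S P"] ..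
  qed
  have right: "poly b z * poly q z * op_eval R (\<lambda>z. wave_function C x z) z = op_eval (map_poly to_fract T) (wave_numerator C x) z"
    if "poly q z \<noteq> 0" "op_regular R z" for x z
    unfolding wave_function_eq
    using clears_denominators_eval[OF cd _ that(2) entire_wave_numerator, of C x] that(1) by (simp add: q_def)
  show ?thesis
  proof
    assume "R \<in> right_fourier_algebra (wave_function C)"
    then obtain S F where F: "finite F" "\<And>x z. x \<notin> F \<Longrightarrow> z \<notin> F \<Longrightarrow>
        op_eval S (\<lambda>x. wave_function C x z) x = op_eval R (\<lambda>z. wave_function C x z) z"
      unfolding right_fourier_algebra_def by blast
    have cF: "\<forall>\<^sub>F x in cofinite. x \<notin> F" using F(1) by (simp add: eventually_cofinite)
    have "\<forall>\<^sub>F x in cofinite. \<forall>z. op_eval (map_poly to_fract T) (wave_numerator C x) z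
       = poly b z * (poly (op_symbol (op_mult S P) x) z * exp (x * z))"
      using cF cofinite_op_regular[of P] cofinite_op_regular[of S]
    proof eventually_elim
      case (elim x)
      have "\<forall>\<^sub>F z in cofinite. poly q z \<noteq> 0"
        using q0 by (simp add: eventually_cofinite poly_roots_finite)
      then have "\<forall>\<^sub>F z in cofinite. op_eval (map_poly to_fract T) (wave_numerator C x) z
          = poly b z * (poly (op_symbol (op_mult S P) x) z * exp (x * z))"
        using cF cofinite_op_regular[of R]
      proof eventually_elim
        case (elim z)
        then show ?case
          using right[of z x] left[of x S z] F(2)[of x z] \<open>x \<notin> F\<close> \<open>op_regular P x\<close> \<open>op_regular S x\<close>
          by simp
      qed
      then have "op_eval (map_poly to_fract T) (wave_numerator C x)
         = (\<lambda>z. poly b z * (poly (op_symbol (op_mult S P) x) z * exp (x * z)))"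
        by (intro entire_eqI_cofinite entire_op_polynomial holomorphic_intros) simp_all
      then show ?case by metis
    qed
    then show "\<exists>S. \<forall>\<^sub>F x in cofinite. \<forall>z. op_eval (map_poly to_fract T) (wave_numerator C x) z
       = poly b z * (poly (op_symbol (op_mult S (D_op C)) x) z * exp (x * z))"
      unfolding P_def by blast
  next
    assume "\<exists>S. \<forall>\<^sub>F x in cofinite. \<forall>z. op_eval (map_poly to_fract T) (wave_numerator C x) z
       = poly b z * (poly (op_symbol (op_mult S (D_op C)) x) z * exp (x * z))"
    then obtain S where S: "\<forall>\<^sub>F x in cofinite. \<forall>z. op_eval (map_poly to_fract T) (wave_numerator C x) z
       = poly b z * (poly (op_symbol (op_mult S P) x) z * exp (x * z))"
      unfolding P_def by blast
    define gx where "gx x \<longleftrightarrow> op_regular P x \<and> op_regular S x \<and> (\<forall>z. op_eval (map_poly to_fract T) (wave_numerator C x) z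
       = poly b z * (poly (op_symbol (op_mult S P) x) z * exp (x * z)))" for x
    define gz where "gz z \<longleftrightarrow> poly q z \<noteq> 0 \<and> poly b z \<noteq> 0 \<and> op_regular R z" for z
    have "\<forall>\<^sub>F x in cofinite. gx x"
      unfolding gx_def using S cofinite_op_regular[of P] cofinite_op_regular[of S] by eventually_elim blast
    moreover have "\<forall>\<^sub>F z in cofinite. poly q z \<noteq> 0" "\<forall>\<^sub>F z in cofinite. poly b z \<noteq> 0"
      using q0 b0 by (simp_all add: eventually_cofinite poly_roots_finite)
    then have "\<forall>\<^sub>F z in cofinite. gz z"
      unfolding gz_def using cofinite_op_regular[of R] by eventually_elim blast
    ultimately have fin: "finite ({x. \<not> gx x} \<union> {z. \<not> gz z})" by (simp add: eventually_cofinite)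
    have "op_eval S (\<lambda>x. wave_function C x z) x = op_eval R (\<lambda>z. wave_function C x z) z" if "gx x" "gz z" for x z
    proof -
      have "poly b z * poly q z * op_eval R (\<lambda>z. wave_function C x z) z = poly b z * (poly (op_symbol (op_mult S P) x) z * exp (x * z))"
        using right[of z x] that by (simp add: gx_def gz_def)
      also have "\<dots> = poly b z * poly q z * op_eval S (\<lambda>x. wave_function C x z) x"
        using left[of x S z] that by (simp add: gx_def gz_def)
      finally show ?thesis using that by (simp add: gz_def)
    qed
    then show "R \<in> right_fourier_algebra (wave_function C)"
      unfolding right_fourier_algebra_def using fin
      by (intro CollectI exI[of _ S] exI[of _ "{x. \<not> gx x} \<union> {z. \<not> gz z}"]) auto
  qed
qed

section \<open>The right Fourier algebra consists of the operators preserving W\<close>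

text \<open>For every \<open>\<xi>\<close> with \<open>\<xi> \<circ> b = \<zeta> \<in> C\<close> the transposed distribution \<open>\<eta> = \<xi> \<circ> T\<close> satisfies
  \<open>\<langle>\<eta>, f\<^sub>x\<rangle> = \<langle>\<zeta>, S P\<cdot>e\<^sup>x\<^sup>z\<rangle> = S P\<cdot>\<langle>\<zeta>, e\<^sup>x\<^sup>z\<rangle> = 0\<close>. Hence \<open>\<eta> \<in> C\<close>, so \<open>\<xi>\<close> kills \<open>T v\<close> for
  \<open>v \<in> V\<^sub>C\<close>, and \<open>T v \<in> b V\<^sub>C\<close>.\<close>

lemma right_fourier_algebra_preserves:
  assumes "presents C W" "R \<in> right_fourier_algebra (wave_function C)"
  shows "R \<in> diffops_preserving W"
proof -
  define q where "q = q_poly C"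
  have q0: "q \<noteq> 0" by (simp add: q_def q_poly_nonzero)
  have C: "finite_dimensional C" "homogeneous C" and W: "W = (\<lambda>p. to_fract p / to_fract q) ` V_space C"
    using assms(1) by (auto simp: presents_def q_def)
  have CD: "C \<subseteq> all_dists" using homogeneous_in_all_dists[OF C(2)] .
  obtain b T where bT: "clears_denominators q R b T" by (rule ex_clears_denominators)
  have b0: "b \<noteq> 0" using bT by (simp add: clears_denominators_def)
  define P where "P = D_op C"
  obtain S where S: "\<forall>\<^sub>F x in cofinite. \<forall>z. op_eval (map_poly to_fract T) (wave_numerator C x) z
       = poly b z * (poly (op_symbol (op_mult S P) x) z * exp (x * z))"
    using fourier_algebra_iff[OF bT[unfolded q_def]] assms(2) unfolding P_def by blast
  have main: "op_apply R (to_fract v / to_fract q) \<in> W" if v: "v \<in> V_space C" for v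
  proof -
    obtain u where u: "op_apply (map_poly to_fract T) (to_fract v) = to_fract u"
      "poly u = op_eval (map_poly to_fract T) (poly v)" using op_polynomial_on_polynomial by blast
    have "\<exists>f. entire f \<and> (\<forall>z. poly u z = poly b z * f z) \<and> (\<forall>\<zeta>\<in>C. \<zeta> f = 0)"
    proof (rule divisible_with_killed_quotient[OF b0 CD finite_dimensional_0[OF C(1)] entire_poly])
      fix \<xi> \<zeta> assume x: "\<xi> \<in> all_dists" "\<zeta> \<in> C" "\<And>f. entire f \<Longrightarrow> \<xi> (\<lambda>z. poly b z * f z) = \<zeta> f"
      have z: "\<zeta> \<in> all_dists" using x(2) CD by blast
      obtain \<eta> where n: "\<eta> \<in> all_dists" "\<And>f. entire f \<Longrightarrow> \<eta> f = \<xi> (op_eval (map_poly to_fract T) f)"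
        using polynomial_op_transpose[OF x(1)] by blast
      have "\<forall>\<^sub>F x in cofinite. \<eta> (wave_numerator C x) = 0"
        using S cofinite_op_regular[of P] cofinite_op_regular[of S]
          cofinite_nhds[OF D_op_annihilates[OF C x(2)], folded P_def]
      proof eventually_elim
        case (elim y)
        have "op_eval (map_poly to_fract T) (wave_numerator C y)
           = (\<lambda>z. poly b z * (poly (op_symbol (op_mult S P) y) z * exp (y * z)))"
          using elim by blast
        then have "\<eta> (wave_numerator C y) = \<zeta> (\<lambda>z. poly (op_symbol (op_mult S P) y) z * exp (y * z))"
          using n(2)[OF entire_wave_numerator] x(3)[OF entire_poly_exp] by simp
        also have "\<dots> = op_eval (op_mult S P) (exp_transform \<zeta>) y"
          by (rule op_eval_exp_transform[OF z, symmetric])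
        also have "\<dots> = op_eval S (op_eval P (exp_transform \<zeta>)) y"
          using elim by (intro op_eval_mult entire_analytic_at entire_exp_transform z)
        also have "\<dots> = op_eval S (\<lambda>_. 0) y"
          using elim by (intro op_eval_cong_ev) blast
        finally show ?case by simp
      qed
      then have "\<eta> \<in> C" by (rule wave_numerator_duality[OF C n(1)])
      then have "\<eta> (poly v) = 0" using v by (simp add: V_space_def)
      then show "\<xi> (poly u) = 0" unfolding u(2) using n(2)[OF entire_poly] by simp
    qed
    then obtain f where f: "entire f" "\<And>z. poly u z = poly b z * f z" "\<And>\<zeta>. \<zeta> \<in> C \<Longrightarrow> \<zeta> f = 0" by blast
    obtain s where s: "f = poly s" using poly_quotient_entire[OF b0 f(1), of u] f(2) by metis
    have "s \<in> V_space C" using f(3) s by (simp add: V_space_def)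
    moreover have "u = b * s"
      by (rule poly_ext) (use f(2) s in simp)
    then have "op_apply R (to_fract v / to_fract q) = to_fract s / to_fract q"
      using clears_denominators_apply[OF bT q0, of v] u(1) b0 by simp
    ultimately show ?thesis using W by blast
  qed
  show ?thesis unfolding diffops_preserving_def using main W by auto
qed

text \<open>Now \<open>\<eta> = \<xi> \<circ> T\<close> lies in \<open>C\<close> because it kills \<open>V\<^sub>C\<close>, so \<open>T f\<^sub>x\<close> is \<open>b\<close> times a function
  killed by \<open>C\<close>. Dividing its symbol \<open>G \<in> \<complex>(x)[z]\<close> by \<open>b\<close> leaves a remainder that vanishes for almost
  all \<open>x\<close>, and the quotient is an operator in \<open>x\<close> that annihilates the transforms of \<open>C\<close>.\<close>

lemma preserving_in_right_fourier_algebra: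
  assumes "presents C W" "R \<in> diffops_preserving W"
  shows "R \<in> right_fourier_algebra (wave_function C)"
proof -
  define q where "q = q_poly C"
  have q0: "q \<noteq> 0" by (simp add: q_def q_poly_nonzero)
  have C: "finite_dimensional C" "homogeneous C" and W: "W = (\<lambda>p. to_fract p / to_fract q) ` V_space C"
    using assms(1) by (auto simp: presents_def q_def)
  have CD: "C \<subseteq> all_dists" using homogeneous_in_all_dists[OF C(2)] .
  obtain b T where bT: "clears_denominators q R b T" by (rule ex_clears_denominators)
  have b0: "b \<noteq> 0" using bT by (simp add: clears_denominators_def)
  define P where "P = D_op C"
  have transpose: "\<eta> \<in> C" if "\<eta> \<in> all_dists" "\<xi> \<in> all_dists" "\<zeta> \<in> C"
    "\<And>f. entire f \<Longrightarrow> \<xi> (\<lambda>z. poly b z * f z) = \<zeta> f"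
    "\<And>f. entire f \<Longrightarrow> \<eta> f = \<xi> (op_eval (map_poly to_fract T) f)" for \<eta> \<xi> \<zeta>
  proof (rule V_space_duality[OF C that(1)])
    fix v assume v: "v \<in> V_space C"
    obtain u where u: "op_apply (map_poly to_fract T) (to_fract v) = to_fract u"
      "poly u = op_eval (map_poly to_fract T) (poly v)" using op_polynomial_on_polynomial by blast
    have "op_apply R (to_fract v / to_fract q) \<in> W"
      using assms(2) v W unfolding diffops_preserving_def by blast
    then obtain s where s: "s \<in> V_space C" "op_apply R (to_fract v / to_fract q) = to_fract s / to_fract q"
      unfolding W by blast
    then have "to_fract u / to_fract (b * q) = to_fract s / to_fract q"
      using clears_denominators_apply[OF bT q0, of v] u(1) by simp
    then have "to_fract u = to_fract (b * s)" using b0 q0 by (simp add: field_simps)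
    then have "u = b * s" by (simp only: to_fract_eq_iff)
    then have "poly u = (\<lambda>z. poly b z * poly s z)" by auto
    then have "\<eta> (poly v) = \<zeta> (poly s)" using that(4,5)[OF entire_poly] u(2) by metis
    then show "\<eta> (poly v) = 0" using s(1) that(3) by (simp add: V_space_def)
  qed
  have h: "\<exists>h. entire h \<and> (\<forall>z. op_eval (map_poly to_fract T) (wave_numerator C x) z = poly b z * h z) \<and> (\<forall>\<zeta>\<in>C. \<zeta> h = 0)"
    if x: "op_regular P x" for x
  proof (rule divisible_with_killed_quotient[OF b0 CD finite_dimensional_0[OF C(1)] entire_op_polynomial[OF entire_wave_numerator]])
    fix \<xi> \<zeta> assume *: "\<xi> \<in> all_dists" "\<zeta> \<in> C" "\<And>f. entire f \<Longrightarrow> \<xi> (\<lambda>z. poly b z * f z) = \<zeta> f"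
    obtain \<eta> where n: "\<eta> \<in> all_dists" "\<And>f. entire f \<Longrightarrow> \<eta> f = \<xi> (op_eval (map_poly to_fract T) f)"
      using polynomial_op_transpose[OF *(1)] by blast
    have "\<eta> \<in> C" by (rule transpose[OF n(1) *(1,2)]) (use * n in auto)
    then have "\<eta> (wave_numerator C x) = 0" using wave_numerator_killed[OF C] x unfolding P_def by blast
    then show "\<xi> (op_eval (map_poly to_fract T) (wave_numerator C x)) = 0"
      using n(2)[OF entire_wave_numerator] by simp
  qed
  obtain G where G: "\<And>x. op_regular P x \<Longrightarrow> op_regular G x \<and>
     op_eval (map_poly to_fract T) (wave_numerator C x) = (\<lambda>z. poly (op_symbol G x) z * exp (x * z))"
    using polynomial_op_on_symbol[of P T] unfolding wave_numerator_def P_def by blast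
  define B where "B = map_poly rat_const b"
  have B0: "B \<noteq> 0" and Bdeg: "degree B = degree b"
    using b0 by (auto simp: B_def degree_map_poly map_poly_eq_0_iff)
  define Q where "Q = G div B"
  define M where "M = G mod B"
  have GQM: "G = B * Q + M" unfolding Q_def M_def by simp
  have Mdeg: "M = 0 \<or> degree M < degree b" unfolding M_def using degree_mod_less[OF B0, of G] Bdeg by simp
  \<comment> \<open>At a fixed regular \<open>x\<close> the quotient is a polynomial, so uniqueness of division with remainder applies.\<close>
  have key: "op_symbol M x = 0 \<and> (\<forall>\<zeta>\<in>C. \<zeta> (\<lambda>z. poly (op_symbol Q x) z * exp (x * z)) = 0)"
    if x: "op_regular P x" "op_regular Q x" "op_regular M x" for x
  proof -
    obtain h where h: "entire h" "\<And>z. op_eval (map_poly to_fract T) (wave_numerator C x) z = poly b z * h z"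
      "\<And>\<zeta>. \<zeta> \<in> C \<Longrightarrow> \<zeta> h = 0" using h[OF x(1)] by blast
    have "entire (\<lambda>z. h z * exp (- (x * z)))" using h(1) by (intro holomorphic_intros)
    moreover have "poly b z * (h z * exp (- (x * z))) = poly (op_symbol G x) z" for z
    proof -
      have "poly b z * h z = poly (op_symbol G x) z * exp (x * z)" using h(2)[of z] G[OF x(1)] by metis
      then have "poly b z * (h z * exp (- (x * z))) = poly (op_symbol G x) z * (exp (x * z) * exp (- (x * z)))"
        by (simp only: mult.assoc[symmetric])
      then show ?thesis by (simp add: exp_minus_inverse)
    qed
    ultimately obtain H where H: "(\<lambda>z. h z * exp (- (x * z))) = poly H"
      using poly_quotient_entire[OF b0] by blast
    have "op_symbol G x = b * H"
    proof (rule poly_ext)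
      fix z
      have "h z * exp (- (x * z)) = poly H z" using H by metis
      then show "poly (op_symbol G x) z = poly (b * H) z"
        using \<open>\<And>z. poly b z * (h z * exp (- (x * z))) = poly (op_symbol G x) z\<close>[of z] by simp
    qed
    moreover have "op_symbol G x = b * op_symbol Q x + op_symbol M x"
      unfolding GQM using x by (simp add: op_symbol_add op_symbol_times op_regular_times B_def)
    ultimately have M: "op_symbol M x = b * (H - op_symbol Q x)" by (simp add: algebra_simps)
    have "degree (op_symbol M x) \<le> degree M"
      by (rule degree_le) (simp add: coeff_op_symbol coeff_eq_0)
    then have HQ: "H = op_symbol Q x"
      using M Mdeg b0 by (cases "H = op_symbol Q x") (auto simp: degree_mult_eq op_symbol_0)
    have "h z = poly (op_symbol Q x) z * exp (x * z)" for z
    proof -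
      have "h z * exp (- (x * z)) = poly H z" using H by metis
      then have "poly (op_symbol Q x) z * exp (x * z) = h z * (exp (- (x * z)) * exp (x * z))"
        unfolding HQ by simp
      then show ?thesis by (simp add: exp_add[symmetric])
    qed
    then have "h = (\<lambda>z. poly (op_symbol Q x) z * exp (x * z))" by blast
    then show ?thesis using M HQ h(3) by simp
  qed
  have good: "\<forall>\<^sub>F x in cofinite. op_regular P x \<and> op_regular Q x \<and> op_regular M x"
    using cofinite_op_regular[of P] cofinite_op_regular[of Q] cofinite_op_regular[of M] by eventually_elim blast
  have "coeff M i = 0" for i
  proof (rule cofinite_rat_eq_0)
    show "\<forall>\<^sub>F x in cofinite. rat_eval (coeff M i) x = 0"
      using good by eventually_elim (metis key coeff_op_symbol coeff_0)
  qed
  then have M0: "M = 0" by (intro poly_eqI) simp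
  have "op_annihilates Q \<zeta>" if z: "\<zeta> \<in> C" for \<zeta>
    unfolding op_annihilates_def using good
  proof eventually_elim
    case (elim x)
    have "\<zeta> \<in> all_dists" using z CD by blast
    then show ?case using key[of x] elim z op_eval_exp_transform by simp
  qed
  then obtain S where S: "Q = op_mult S P" using D_op_properties(2)[OF C] unfolding P_def by blast
  have "\<forall>\<^sub>F x in cofinite. \<forall>z. op_eval (map_poly to_fract T) (wave_numerator C x) z
       = poly b z * (poly (op_symbol (op_mult S (D_op C)) x) z * exp (x * z))"
    using good
  proof eventually_elim
    case (elim x)
    have "op_symbol G x = b * op_symbol Q x"
      unfolding GQM M0 using elim by (simp add: op_symbol_times B_def)
    then show ?case using G[of x] elim S unfolding P_def by simp
  qed
  then show ?thesis using fourier_algebra_iff[OF bT[unfolded q_def]] by blast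
qed

section \<open>Maps with nilpotent commutators\<close>

text \<open>The commutator with \<open>c\<close> of a map from \<open>\<complex>[z]\<close> to \<open>\<complex>(z)\<close>. The target is larger than the source so
  that values can be divided by polynomials.\<close>

definition poly_ad :: "complex poly \<Rightarrow> (complex poly \<Rightarrow> ratfun) \<Rightarrow> complex poly \<Rightarrow> ratfun" where
  "poly_ad c \<Phi> = (\<lambda>p. to_fract c * \<Phi> p - \<Phi> (c * p))"

lemma funpow_commute:
  assumes "\<And>x. f (h x) = h (f x)"
  shows "(f ^^ n) (h x) = h ((f ^^ n) x)"
  by (induction n) (simp_all add: assms)

lemma poly_ad_commute: "poly_ad c (poly_ad d \<Phi>) = poly_ad d (poly_ad c \<Phi>)"
  by (rule ext) (simp add: poly_ad_def algebra_simps)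

lemma poly_ad_scale: "poly_ad c (\<lambda>p. r * \<Phi> p) = (\<lambda>p. r * poly_ad c \<Phi> p)"
  by (rule ext) (simp add: poly_ad_def algebra_simps)

lemma poly_ad_shift: "poly_ad c (\<lambda>p. \<Phi> (d * p)) = (\<lambda>p. poly_ad c \<Phi> (d * p))"
  by (rule ext) (simp add: poly_ad_def algebra_simps)

lemma poly_ad_diff: "poly_ad c (\<lambda>p. \<Phi> p - \<Psi> p) = (\<lambda>p. poly_ad c \<Phi> p - poly_ad c \<Psi> p)"
  by (rule ext) (simp add: poly_ad_def algebra_simps)

lemma poly_ad_zero: "poly_ad c (\<lambda>_. 0) = (\<lambda>_. 0)"
  by (rule ext) (simp add: poly_ad_def)

lemma poly_ad_funpow_zero: "(poly_ad c ^^ n) (\<lambda>_. 0) = (\<lambda>_. 0)"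
  by (induction n) (simp_all add: poly_ad_zero)

lemma poly_ad_funpow_diff:
  "(poly_ad c ^^ n) (\<lambda>p. \<Phi> p - \<Psi> p) = (\<lambda>p. (poly_ad c ^^ n) \<Phi> p - (poly_ad c ^^ n) \<Psi> p)"
  by (induction n) (simp_all add: poly_ad_diff)

lemma poly_ad_funpow_scale:
  "(poly_ad c ^^ n) (\<lambda>p. r * \<Phi> p) = (\<lambda>p. r * (poly_ad c ^^ n) \<Phi> p)"
  by (induction n) (simp_all add: poly_ad_scale)

lemma poly_ad_funpow_shift:
  "(poly_ad c ^^ n) (\<lambda>p. \<Phi> (d * p)) = (\<lambda>p. (poly_ad c ^^ n) \<Phi> (d * p))"
  by (induction n) (simp_all add: poly_ad_shift)

text \<open>With \<open>M\<close> for multiplication of the argument by \<open>d\<close>, this is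
  \<open>ad\<^sub>d \<Phi> = g\<^sup>-\<^sup>1 (ad\<^sub>g\<^sub>d \<Phi> - (ad\<^sub>g \<Phi>) \<circ> M)\<close>.\<close>

lemma poly_ad_localize:
  assumes "g \<noteq> 0"
  shows "poly_ad d \<Phi> = (\<lambda>p. inverse (to_fract g) * poly_ad (g * d) \<Phi> p - inverse (to_fract g) * poly_ad g \<Phi> (d * p))"
proof
  fix p
  have i: "inverse (to_fract g) * (to_fract g * x) = x" for x
    using assms by (simp add: mult.assoc[symmetric])
  then show "poly_ad d \<Phi> p = inverse (to_fract g) * poly_ad (g * d) \<Phi> p - inverse (to_fract g) * poly_ad g \<Phi> (d * p)"
    unfolding poly_ad_def to_fract_mult mult.assoc right_diff_distrib i by (simp add: algebra_simps)
qed

text \<open>By the previous lemma \<open>ad\<^sub>d\<close> is a combination of \<open>ad\<^sub>g\<^sub>d\<close> and \<open>ad\<^sub>g\<close> with coefficients that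
  commute with both; nilpotency of these two on \<open>\<Phi>\<close> is inherited as for sums of commuting
  nilpotent operators.\<close>

lemma poly_ad_nilpotent_localize:
  assumes "g \<noteq> 0"
  shows "(poly_ad (g * d) ^^ a) \<Phi> = (\<lambda>_. 0) \<Longrightarrow> (poly_ad g ^^ b) \<Phi> = (\<lambda>_. 0) \<Longrightarrow> (poly_ad d ^^ (a + b)) \<Phi> = (\<lambda>_. 0)"
proof (induction "a + b" arbitrary: a b \<Phi>)
  case 0
  then show ?case by simp
next
  case (Suc n)
  show ?case
  proof (cases "a = 0 \<or> b = 0")
    case True
    then have "\<Phi> = (\<lambda>_. 0)" using Suc.prems by auto
    then show ?thesis by (simp only: poly_ad_funpow_zero)
  next
    case False
    then obtain a' b' where ab: "a = Suc a'" "b = Suc b'" by (metis not0_implies_Suc)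
    let ?i = "inverse (to_fract g)"
    have U: "(poly_ad d ^^ n) (\<lambda>p. ?i * poly_ad (g * d) \<Phi> p) = (\<lambda>_. 0)"
    proof -
      have "(poly_ad (g * d) ^^ a') (\<lambda>p. ?i * poly_ad (g * d) \<Phi> p) = (\<lambda>_. 0)"
        using Suc.prems(1) unfolding poly_ad_funpow_scale ab funpow_Suc_right o_def by (simp add: fun_eq_iff)
      moreover have "(poly_ad g ^^ b) (\<lambda>p. ?i * poly_ad (g * d) \<Phi> p) = (\<lambda>_. 0)"
        unfolding poly_ad_funpow_scale funpow_commute[of "poly_ad g" "poly_ad (g * d)", OF poly_ad_commute] Suc.prems(2) poly_ad_zero
        by simp
      moreover have "n = a' + b" using Suc.hyps(2) ab by simp
      ultimately show ?thesis using Suc.hyps(1)[of a' b] by simp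
    qed
    have V: "(poly_ad d ^^ n) (\<lambda>p. ?i * poly_ad g \<Phi> (d * p)) = (\<lambda>_. 0)"
    proof -
      have "(poly_ad g ^^ b') (\<lambda>p. ?i * poly_ad g \<Phi> (d * p)) = (\<lambda>_. 0)"
        using Suc.prems(2) unfolding poly_ad_funpow_scale poly_ad_funpow_shift ab funpow_Suc_right o_def
        by (simp add: fun_eq_iff)
      moreover have "(poly_ad (g * d) ^^ a) (\<lambda>p. ?i * poly_ad g \<Phi> (d * p)) = (\<lambda>_. 0)"
        unfolding poly_ad_funpow_scale poly_ad_funpow_shift
          funpow_commute[of "poly_ad (g * d)" "poly_ad g", OF poly_ad_commute] Suc.prems(1) poly_ad_zero
        by simp
      moreover have "n = a + b'" using Suc.hyps(2) ab by simp
      ultimately show ?thesis using Suc.hyps(1)[of a b'] by simp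
    qed
    have "(poly_ad d ^^ (a + b)) \<Phi> = (poly_ad d ^^ n) (poly_ad d \<Phi>)"
      unfolding Suc.hyps(2)[symmetric] funpow_Suc_right o_def ..
    also have "\<dots> = (\<lambda>_. 0)"
      unfolding poly_ad_localize[OF assms, of d \<Phi>] poly_ad_funpow_diff U V by simp
    finally show ?thesis .
  qed
qed

definition complex_linear :: "(complex poly \<Rightarrow> ratfun) \<Rightarrow> bool" where
  "complex_linear \<Phi> \<longleftrightarrow> (\<forall>p r. \<Phi> (p + r) = \<Phi> p + \<Phi> r) \<and> (\<forall>c p. \<Phi> (smult c p) = rat_const c * \<Phi> p)"

lemma to_fract_smult: "to_fract (smult c p) = rat_const c * to_fract p"
proof -
  have "smult c p = [:c:] * p" by simp
  then show ?thesis unfolding rat_const_def by (simp only: to_fract_mult)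
qed

lemma to_fract_pCons: "to_fract (pCons a p) = rat_const a + to_fract [:0, 1:] * to_fract p"
proof -
  have "pCons a p = [:a:] + [:0, 1:] * p" by simp
  then show ?thesis unfolding rat_const_def by (simp only: to_fract_mult to_fract_add)
qed

lemma complex_linear_poly_ad: "complex_linear \<Phi> \<Longrightarrow> complex_linear (poly_ad c \<Phi>)"
  by (simp add: complex_linear_def poly_ad_def distrib_left mult_smult_right right_diff_distrib mult.left_commute)

text \<open>If \<open>ad\<^sub>z \<Phi>\<close> is the operator \<open>E\<close>, subtract from \<open>\<Phi>\<close> an operator \<open>D\<close> with the same
  bracket. The difference commutes with \<open>z\<close>, hence is multiplication by its value at \<open>1\<close>.\<close>

lemma poly_ad_nilpotent_imp_op:
  assumes "complex_linear \<Phi>" "(poly_ad [:0, 1:] ^^ n) \<Phi> = (\<lambda>_. 0)"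
  shows "\<exists>D. \<forall>p. \<Phi> p = op_apply D (to_fract p)"
  using assms
proof (induction n arbitrary: \<Phi>)
  case 0
  then show ?case by (intro exI[of _ 0]) simp
next
  case (Suc n)
  let ?z = "to_fract [:0, 1::complex:]"
  have "(poly_ad [:0, 1:] ^^ n) (poly_ad [:0, 1:] \<Phi>) = (\<lambda>_. 0)"
    using Suc.prems(2) unfolding funpow_Suc_right o_def .
  then obtain E where E: "\<And>p. poly_ad [:0, 1:] \<Phi> p = op_apply E (to_fract p)"
    using Suc.IH[OF complex_linear_poly_ad[OF Suc.prems(1)]] by blast
  obtain D where D: "pderiv D = - E" using ex_pderiv_eq by blast
  define \<Psi> where "\<Psi> p = \<Phi> p - op_apply D (to_fract p)" for p
  have shift: "\<Psi> ([:0, 1:] * p) = ?z * \<Psi> p" for p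
  proof -
    have "\<Phi> ([:0, 1:] * p) = ?z * \<Phi> p - op_apply E (to_fract p)"
      using E[of p] unfolding poly_ad_def by (simp only: diff_eq_eq eq_diff_eq add.commute)
    moreover have "op_apply D (to_fract ([:0, 1:] * p)) = ?z * op_apply D (to_fract p) - op_apply E (to_fract p)"
      by (simp only: to_fract_mult op_apply_X_mult D op_apply_minus add_uminus_conv_diff)
    ultimately show ?thesis unfolding \<Psi>_def by (simp only: right_diff_distrib) simp
  qed
  have add: "\<Psi> (p + r) = \<Psi> p + \<Psi> r" and scale: "\<Psi> (smult c p) = rat_const c * \<Psi> p" for p r c
    using Suc.prems(1) unfolding \<Psi>_def complex_linear_def
    by (simp_all add: op_apply_add_right to_fract_smult op_apply_const_mult right_diff_distrib)
  have "\<Psi> p = to_fract p * \<Psi> 1" for p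
  proof (induction p)
    case 0
    show ?case using scale[of 0 0] by simp
  next
    case (pCons a p)
    have "pCons a p = smult a 1 + [:0, 1:] * p" by (simp add: one_pCons)
    then have "\<Psi> (pCons a p) = rat_const a * \<Psi> 1 + ?z * \<Psi> p" by (simp only: add scale shift)
    then show ?case by (simp only: pCons.IH to_fract_pCons[of a p] distrib_right mult.assoc)
  qed
  then have "\<Phi> p = op_apply (D + [:\<Psi> 1:]) (to_fract p)" for p
    by (simp add: op_apply_add op_apply_pCons \<Psi>_def algebra_simps)
  then show ?case by blast
qed

section \<open>Differential operators on the line bundle\<close>

text \<open>These assumptions say that \<open>W\<close> is a complex subspace between \<open>g q\<^sup>-\<^sup>1 \<complex>[z]\<close> and \<open>q\<^sup>-\<^sup>1 \<complex>[z]\<close>.\<close>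

locale lattice_subspace =
  fixes W :: "ratfun set" and g q :: "complex poly"
  assumes g_nonzero: "g \<noteq> 0" and q_nonzero: "q \<noteq> 0"
    and multiples: "\<And>p. to_fract (g * p) / to_fract q \<in> W"
    and denominators: "\<And>w. w \<in> W \<Longrightarrow> \<exists>v. w = to_fract v / to_fract q"
    and add_closed: "\<And>u v. u \<in> W \<Longrightarrow> v \<in> W \<Longrightarrow> u + v \<in> W"
    and scale_closed: "\<And>c u. u \<in> W \<Longrightarrow> rat_const c * u \<in> W"
begin

lemma op_extends_unique:
  assumes "op_extends W \<phi> D" "op_extends W \<phi> E"
  shows "D = E"
proof (rule op_eqI_on_multiples[of "to_fract g / to_fract q"])
  show "to_fract g / to_fract q \<noteq> 0" using g_nonzero q_nonzero by simp
  show "op_apply D (to_fract g / to_fract q * to_fract p) = op_apply E (to_fract g / to_fract q * to_fract p)" for p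
    using assms multiples[of p] unfolding op_extends_def by simp
qed

lemma canonical_embedding_eqI: "op_extends W \<phi> D \<Longrightarrow> canonical_embedding W \<phi> = D"
  unfolding canonical_embedding_def using op_extends_unique by blast

text \<open>
  Multiplication by \<open>g p\<close> maps \<open>q\<^sup>-\<^sup>1 \<complex>[z]\<close> into \<open>g q\<^sup>-\<^sup>1 \<complex>[z]\<close>, so it stabilizes \<open>W\<close>.
\<close>

lemma A_ring_multiple: "rat_to_laurent (to_fract (g * p)) \<in> A_ring W"
  unfolding A_ring_def
proof (intro CollectI ballI)
  fix w assume "w \<in> W"
  then obtain v where "w = to_fract v / to_fract q" using denominators by blast
  then have "to_fract (g * p) * w = to_fract (g * (p * v)) / to_fract q" by simp
  then have "to_fract (g * p) * w \<in> W" using multiples by metis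
  then show "rat_to_laurent (to_fract (g * p)) * rat_to_laurent w \<in> rat_to_laurent ` W"
    unfolding rat_to_laurent_mult[symmetric] by (rule imageI)
qed

text \<open>A Laurent series that maps some nonzero \<open>w0 \<in> W\<close> into \<open>W\<close> is a quotient of two rational functions.\<close>

lemma A_ring_cases:
  assumes "f \<in> A_ring W"
  obtains a where "f = rat_to_laurent a" "\<And>w. w \<in> W \<Longrightarrow> a * w \<in> W"
proof -
  define w0 where "w0 = to_fract g / to_fract q"
  have w0: "w0 \<in> W" "w0 \<noteq> 0" using multiples[of 1] g_nonzero q_nonzero by (auto simp: w0_def)
  then obtain w' where w': "w' \<in> W" "f * rat_to_laurent w0 = rat_to_laurent w'"
    using assms unfolding A_ring_def by blast
  have "rat_to_laurent 0 = 0" using rat_to_laurent_mult[of 0 0] rat_to_laurent_Fract[of 1 0] by (simp add: fract_collapse)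
  then have ne: "rat_to_laurent w0 \<noteq> 0" using w0(2) inj_rat_to_laurent by (metis injD)
  have "rat_to_laurent (w' / w0) * rat_to_laurent w0 = f * rat_to_laurent w0"
    unfolding w'(2) rat_to_laurent_mult[symmetric] using w0(2) by simp
  then have f: "f = rat_to_laurent (w' / w0)" using ne by simp
  have "w' / w0 * w \<in> W" if "w \<in> W" for w
  proof -
    have "f * rat_to_laurent w \<in> rat_to_laurent ` W" using assms that unfolding A_ring_def by blast
    then show ?thesis unfolding f rat_to_laurent_mult[symmetric] using inj_rat_to_laurent by (simp add: inj_image_mem_iff)
  qed
  then show ?thesis using that f by blast
qed

lemma ad_op_funpow_op_apply:
  assumes "\<And>w. w \<in> W \<Longrightarrow> a * w \<in> W"
  shows "(ad_op W (A_act (rat_to_laurent a)) ^^ k) (\<lambda>w\<in>W. op_apply D w) = (\<lambda>w\<in>W. op_apply ((op_ad a ^^ k) D) w)"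
proof (induction k)
  case (Suc k)
  show ?case
    unfolding funpow.simps o_def Suc
    by (rule ext) (simp add: ad_op_def A_act_rat_to_laurent assms op_apply_ad restrict_def)
qed simp

lemma preserving_restrict_diffop:
  assumes "D \<in> diffops_preserving W"
  shows "(\<lambda>w\<in>W. op_apply D w) \<in> line_bundle_diffops W"
proof -
  have "(\<lambda>w\<in>W. op_apply D w) \<in> linear_endos (\<lambda>c f. rat_const c * f) W"
    using assms add_closed scale_closed
    by (auto simp: linear_endos_def diffops_preserving_def op_apply_add_right op_apply_const_mult)
  moreover have "(ad_op W (A_act r) ^^ Suc (degree D)) (\<lambda>w\<in>W. op_apply D w) = (\<lambda>u\<in>W. 0)" if r: "r \<in> A_ring W" for r
  proof -
    obtain a where a: "r = rat_to_laurent a" "\<And>w. w \<in> W \<Longrightarrow> a * w \<in> W" using A_ring_cases[OF r] by blast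
    have "(op_ad a ^^ Suc (degree D)) D = 0" by (rule op_ad_nilpotent) simp
    moreover have "(ad_op W (A_act (rat_to_laurent a)) ^^ Suc (degree D)) (\<lambda>w\<in>W. op_apply D w)
        = (\<lambda>w\<in>W. op_apply ((op_ad a ^^ Suc (degree D)) D) w)"
      by (rule ad_op_funpow_op_apply) (rule a(2))
    ultimately show ?thesis unfolding a(1) by (simp only: op_apply_0)
  qed
  ultimately show ?thesis
    unfolding line_bundle_diffops_def module_diffops_def module_diffops_le_def by blast
qed

text \<open>Transport \<open>\<phi>\<close> to \<open>\<complex>[z]\<close> by \<open>p \<mapsto> \<phi>(g p / q)\<close>; this gives an operator \<open>D\<close> that agrees with \<open>\<phi>\<close> on
  \<open>g q\<^sup>-\<^sup>1 \<complex>[z]\<close>. The difference \<open>\<phi> - D\<close> vanishes on \<open>g W\<close>, so its \<open>k\<close>-fold commutator with \<open>g\<close>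
  is \<open>g\<^sup>k (\<phi> - D)\<close> on \<open>W\<close>; for large \<open>k\<close> that commutator is zero.\<close>

lemma line_bundle_diffop_extends:
  assumes "\<phi> \<in> line_bundle_diffops W"
  shows "\<exists>D. op_extends W \<phi> D"
proof -
  obtain m where lin: "\<phi> \<in> linear_endos (\<lambda>c f. rat_const c * f) W"
    and nil: "\<And>r. r \<in> A_ring W \<Longrightarrow> (ad_op W (A_act r) ^^ Suc m) \<phi> = (\<lambda>u\<in>W. 0)"
    using assms unfolding line_bundle_diffops_def module_diffops_def module_diffops_le_def by blast
  have phi_add: "\<phi> (u + v) = \<phi> u + \<phi> v" if "u \<in> W" "v \<in> W" for u v
    using lin that unfolding linear_endos_def by blast
  have phi_scale: "\<phi> (rat_const c * u) = rat_const c * \<phi> u" if "u \<in> W" for c u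
    using lin that unfolding linear_endos_def by blast
  define \<Phi> where "\<Phi> p = \<phi> (to_fract (g * p) / to_fract q)" for p
  have linear: "complex_linear \<Phi>"
    unfolding complex_linear_def
  proof (intro conjI allI)
    fix p r c
    have "to_fract (g * (p + r)) / to_fract q = to_fract (g * p) / to_fract q + to_fract (g * r) / to_fract q"
      by (simp add: distrib_left add_divide_distrib)
    then show "\<Phi> (p + r) = \<Phi> p + \<Phi> r" unfolding \<Phi>_def using phi_add[OF multiples multiples] by metis
    have "to_fract (g * smult c p) / to_fract q = rat_const c * (to_fract (g * p) / to_fract q)"
      by (simp add: to_fract_smult)
    then show "\<Phi> (smult c p) = rat_const c * \<Phi> p" unfolding \<Phi>_def using phi_scale[OF multiples] by metis
  qed
  have ad: "(ad_op W (A_act (rat_to_laurent (to_fract (g * s)))) ^^ k) \<phi> (to_fract (g * p) / to_fract q) = (poly_ad (g * s) ^^ k) \<Phi> p" for s k p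
  proof (induction k arbitrary: p)
    case 0
    then show ?case by (simp add: \<Phi>_def)
  next
    case (Suc k)
    have "to_fract (g * s) * (to_fract (g * p) / to_fract q) = to_fract (g * ((g * s) * p)) / to_fract q" by (simp add: mult_ac)
    then show ?case
      unfolding funpow.simps o_def poly_ad_def[of "g * s" "(poly_ad (g * s) ^^ k) \<Phi>"] Suc.IH[symmetric]
      using multiples[of p] by (simp only: ad_op_def restrict_apply' A_act_rat_to_laurent)
  qed
  have nil': "(poly_ad (g * s) ^^ Suc m) \<Phi> = (\<lambda>_. 0)" for s
  proof
    fix p
    show "(poly_ad (g * s) ^^ Suc m) \<Phi> p = 0"
      unfolding ad[symmetric] nil[OF A_ring_multiple] using multiples by (simp only: restrict_apply')
  qed
  have "(poly_ad [:0, 1:] ^^ (Suc m + Suc m)) \<Phi> = (\<lambda>_. 0)"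
    using poly_ad_nilpotent_localize[OF g_nonzero nil'[of "[:0, 1:]"], of "Suc m"] nil'[of 1] by (simp only: mult_1_right)
  then obtain D0 where D0: "\<And>p. \<Phi> p = op_apply D0 (to_fract p)" using poly_ad_nilpotent_imp_op[OF linear] by blast
  define D where "D = op_mult D0 [:to_fract q / to_fract g:]"
  have D: "\<phi> (to_fract (g * p) / to_fract q) = op_apply D (to_fract (g * p) / to_fract q)" for p
    using D0[of p] g_nonzero q_nonzero unfolding \<Phi>_def D_def by (simp add: op_apply_mult op_apply_pCons)
  define X where "X k = (ad_op W (A_act (rat_to_laurent (to_fract (g * 1)))) ^^ k) \<phi>" for k
  have X_Suc: "X (Suc k) w = to_fract g * X k w - X k (to_fract g * w)" if "w \<in> W" for k w
    using that unfolding X_def by (simp add: ad_op_def A_act_rat_to_laurent)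
  have agree: "X k (to_fract (g * p) / to_fract q) = op_apply ((op_ad (to_fract g) ^^ k) D) (to_fract (g * p) / to_fract q)" for k p
  proof (induction k arbitrary: p)
    case 0
    then show ?case by (simp add: X_def D del: to_fract_mult)
  next
    case (Suc k)
    have "to_fract g * (to_fract (g * p) / to_fract q) = to_fract (g * (g * p)) / to_fract q" by simp
    then show ?case using Suc.IH by (simp only: X_Suc[OF multiples] funpow.simps o_def op_apply_ad)
  qed
  have diff: "X k w - op_apply ((op_ad (to_fract g) ^^ k) D) w = to_fract g ^ k * (\<phi> w - op_apply D w)" if w: "w \<in> W" for k w
  proof (induction k)
    case 0
    then show ?case by (simp add: X_def)
  next
    case (Suc k)
    obtain v where "w = to_fract v / to_fract q" using denominators[OF w] by blast
    then have "to_fract g * w = to_fract (g * v) / to_fract q" by simp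
    then have "X k (to_fract g * w) = op_apply ((op_ad (to_fract g) ^^ k) D) (to_fract g * w)" using agree by metis
    then have "X (Suc k) w - op_apply ((op_ad (to_fract g) ^^ Suc k) D) w
        = to_fract g * (X k w - op_apply ((op_ad (to_fract g) ^^ k) D) w)"
      by (simp add: X_Suc[OF w] op_apply_ad right_diff_distrib)
    then show ?case unfolding Suc by simp
  qed
  have zero: "X (k + Suc m) w = 0" if w: "w \<in> W" for k w
    using w
  proof (induction k arbitrary: w)
    case 0
    have "X (0 + Suc m) = (\<lambda>u\<in>W. 0)" unfolding X_def add_0 using nil[OF A_ring_multiple[of 1]] .
    then show ?case using 0 by simp
  next
    case (Suc k)
    obtain v where "w = to_fract v / to_fract q" using denominators[OF Suc.prems] by blast
    then have "to_fract g * w = to_fract (g * v) / to_fract q" by simp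
    then have "to_fract g * w \<in> W" using multiples by metis
    then show ?case using X_Suc[OF Suc.prems, of "k + Suc m"] Suc.IH Suc.prems by simp
  qed
  have "op_extends W \<phi> D"
    unfolding op_extends_def
  proof
    fix w assume w: "w \<in> W"
    \<comment> \<open>Large enough for the commutators of both the map and the operator to vanish.\<close>
    define k where "k = Suc (degree D) + Suc m"
    have "(op_ad (to_fract g) ^^ k) D = 0" by (rule op_ad_nilpotent) (simp add: k_def)
    then have "to_fract g ^ k * (\<phi> w - op_apply D w) = 0"
      using diff[OF w, of k] zero[OF w, of "Suc (degree D)"] unfolding k_def by simp
    then show "op_apply D w = \<phi> w" using g_nonzero by simp
  qed
  then show ?thesis by blast
qed

lemma line_bundle_diffops_extensional: "\<phi> \<in> line_bundle_diffops W \<Longrightarrow> \<phi> \<in> W \<rightarrow>\<^sub>E W"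
  unfolding line_bundle_diffops_def module_diffops_def module_diffops_le_def linear_endos_def by blast

lemma ex1_op_extends: "\<phi> \<in> line_bundle_diffops W \<Longrightarrow> \<exists>!D. op_extends W \<phi> D"
  using line_bundle_diffop_extends op_extends_unique by blast

lemma canonical_embedding_extends:
  "\<phi> \<in> line_bundle_diffops W \<Longrightarrow> op_extends W \<phi> (canonical_embedding W \<phi>)"
  using line_bundle_diffop_extends canonical_embedding_eqI by metis

lemma bij_betw_canonical_embedding:
  "bij_betw (canonical_embedding W) (line_bundle_diffops W) (diffops_preserving W)"
proof (rule bij_betwI')
  fix \<phi> \<phi>' assume *: "\<phi> \<in> line_bundle_diffops W" "\<phi>' \<in> line_bundle_diffops W"
  show "canonical_embedding W \<phi> = canonical_embedding W \<phi>' \<longleftrightarrow> \<phi> = \<phi>'"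
  proof
    assume "canonical_embedding W \<phi> = canonical_embedding W \<phi>'"
    then have "\<phi> w = \<phi>' w" if "w \<in> W" for w
    proof -
      have "op_apply (canonical_embedding W \<phi>) w = \<phi> w" "op_apply (canonical_embedding W \<phi>') w = \<phi>' w"
        using canonical_embedding_extends[OF *(1)] canonical_embedding_extends[OF *(2)] that
        unfolding op_extends_def by blast+
      then show ?thesis using \<open>canonical_embedding W \<phi> = canonical_embedding W \<phi>'\<close> by simp
    qed
    then show "\<phi> = \<phi>'" using line_bundle_diffops_extensional * by (metis PiE_ext)
  qed simp
next
  fix \<phi> assume *: "\<phi> \<in> line_bundle_diffops W"
  then show "canonical_embedding W \<phi> \<in> diffops_preserving W"
    using canonical_embedding_extends[OF *] line_bundle_diffops_extensional[OF *]
    unfolding op_extends_def diffops_preserving_def by (auto simp: PiE_iff)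
next
  fix D assume "D \<in> diffops_preserving W"
  then have "(\<lambda>w\<in>W. op_apply D w) \<in> line_bundle_diffops W" by (rule preserving_restrict_diffop)
  moreover have "canonical_embedding W (\<lambda>w\<in>W. op_apply D w) = D"
    by (rule canonical_embedding_eqI) (simp add: op_extends_def)
  ultimately show "\<exists>\<phi>\<in>line_bundle_diffops W. D = canonical_embedding W \<phi>" by metis
qed

lemma canonical_embedding_hom:
  "is_algebra_hom_into_diffops W (line_bundle_diffops W) (canonical_embedding W)"
  unfolding is_algebra_hom_into_diffops_def
proof (intro conjI ballI allI)
  show "canonical_embedding W (\<lambda>w\<in>W. w) = 1"
    by (rule canonical_embedding_eqI) (simp add: op_extends_def)
next
  fix \<phi> \<phi>' assume *: "\<phi> \<in> line_bundle_diffops W" "\<phi>' \<in> line_bundle_diffops W"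
  note e = canonical_embedding_extends[OF *(1), unfolded op_extends_def]
    canonical_embedding_extends[OF *(2), unfolded op_extends_def]
  have W: "\<phi>' w \<in> W" if "w \<in> W" for w
    using line_bundle_diffops_extensional[OF *(2)] that by (auto simp: PiE_iff)
  show "canonical_embedding W (\<lambda>w\<in>W. \<phi> w + \<phi>' w) = canonical_embedding W \<phi> + canonical_embedding W \<phi>'"
    by (rule canonical_embedding_eqI) (simp add: op_extends_def op_apply_add e)
  show "canonical_embedding W (compose W \<phi> \<phi>') = op_mult (canonical_embedding W \<phi>) (canonical_embedding W \<phi>')"
    by (rule canonical_embedding_eqI) (simp add: op_extends_def op_apply_mult e W compose_eq)
next
  fix c \<phi> assume *: "\<phi> \<in> line_bundle_diffops W"
  note e = canonical_embedding_extends[OF *, unfolded op_extends_def]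
  show "canonical_embedding W (\<lambda>w\<in>W. rat_const c * \<phi> w) = smult (rat_const c) (canonical_embedding W \<phi>)"
    by (rule canonical_embedding_eqI) (simp add: op_extends_def op_apply_smult e)
qed

end

lemma finite_common_annihilator:
  assumes "finite B" "B \<subseteq> all_dists"
  shows "\<exists>g. g \<noteq> 0 \<and> (\<forall>\<xi>\<in>B. \<forall>h. entire h \<longrightarrow> \<xi> (\<lambda>z. poly g z * h z) = 0)"
  using assms
proof (induction B rule: finite_induct)
  case empty
  show ?case by (intro exI[of _ 1]) simp
next
  case (insert \<xi> B)
  have "B \<subseteq> all_dists" using insert.prems by blast
  from insert.IH[OF this] obtain g where
    "g \<noteq> 0 \<and> (\<forall>\<xi>\<in>B. \<forall>h. entire h \<longrightarrow> \<xi> (\<lambda>z. poly g z * h z) = 0)" ..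
  then have g: "g \<noteq> 0" "\<And>\<eta> h. \<eta> \<in> B \<Longrightarrow> entire h \<Longrightarrow> \<eta> (\<lambda>z. poly g z * h z) = 0"
    by blast+
  obtain g' where g': "g' \<noteq> 0" "\<And>h. entire h \<Longrightarrow> \<xi> (\<lambda>z. poly g' z * h z) = 0"
    using dist_annihilator[of \<xi>] insert.prems by auto
  have "\<eta> (\<lambda>z. poly (g * g') z * h z) = 0" if e: "\<eta> \<in> insert \<xi> B" "entire h" for \<eta> h
  proof -
    have eq: "(\<lambda>z. poly (g * g') z * h z) = (\<lambda>z. poly g z * (poly g' z * h z))"
      "(\<lambda>z. poly (g * g') z * h z) = (\<lambda>z. poly g' z * (poly g z * h z))"
      by (simp_all add: mult_ac)
    have "entire (\<lambda>z. poly g z * h z)" "entire (\<lambda>z. poly g' z * h z)"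
      using e(2) by (auto intro!: holomorphic_intros)
    then show ?thesis using e(1) g(2) g'(2) eq by (metis insertE)
  qed
  then show ?case using g(1) g'(1) by (intro exI[of _ "g * g'"]) simp
qed

text \<open>Take for \<open>g\<close> a polynomial whose multiples are killed by all of \<open>C\<close>, which exists since \<open>C\<close> is
  spanned by finitely many distributions.\<close>

lemma presents_lattice_subspace:
  assumes "presents C W"
  shows "\<exists>g. lattice_subspace W g (q_poly C)"
proof -
  define q where "q = q_poly C"
  have q0: "q \<noteq> 0" by (simp add: q_def q_poly_nonzero)
  have C: "finite_dimensional C" "homogeneous C" and W: "W = (\<lambda>p. to_fract p / to_fract q) ` V_space C"
    using assms by (auto simp: presents_def q_def)
  have CD: "C \<subseteq> all_dists" using homogeneous_in_all_dists[OF C(2)] .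
  obtain B where B: "finite B" "C = dist.span B" using C(1) unfolding finite_dimensional_def by blast
  have "B \<subseteq> all_dists" using dist.span_superset[of B] CD unfolding B(2) by blast
  then obtain g where g: "g \<noteq> 0" "\<And>\<xi> h. \<xi> \<in> B \<Longrightarrow> entire h \<Longrightarrow> \<xi> (\<lambda>z. poly g z * h z) = 0"
    using finite_common_annihilator[OF B(1)] by blast
  have gV: "g * p \<in> V_space C" for p
  proof -
    have "\<xi> (\<lambda>z. poly g z * poly p z) = 0" if "\<xi> \<in> C" for \<xi>
      using that unfolding B(2) by (rule span_vanishes[rotated]) (use g(2) in simp)
    moreover have "poly (g * p) = (\<lambda>z. poly g z * poly p z)" by auto
    ultimately show ?thesis unfolding V_space_def by simp
  qed
  have Vadd: "p + r \<in> V_space C" if "p \<in> V_space C" "r \<in> V_space C" for p r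
  proof -
    have "poly (p + r) = (\<lambda>z. poly p z + poly r z)" by auto
    then show ?thesis using that CD dist_add_right[OF _ entire_poly entire_poly] unfolding V_space_def by fastforce
  qed
  have Vscale: "smult c p \<in> V_space C" if "p \<in> V_space C" for c p
  proof -
    have "poly (smult c p) = (\<lambda>z. c * poly p z)" by auto
    then show ?thesis using that CD dist_cmult_right[OF _ entire_poly] unfolding V_space_def by fastforce
  qed
  have "lattice_subspace W g q"
  proof
    show "g \<noteq> 0" "q \<noteq> 0" by (rule g(1), rule q0)
    show "to_fract (g * p) / to_fract q \<in> W" for p unfolding W using gV by blast
    show "\<exists>v. w = to_fract v / to_fract q" if "w \<in> W" for w using that unfolding W by blast
    show "u + v \<in> W" if uv: "u \<in> W" "v \<in> W" for u v
    proof -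
      obtain a b where "a \<in> V_space C" "b \<in> V_space C" "u = to_fract a / to_fract q" "v = to_fract b / to_fract q"
        using uv unfolding W by blast
      then have "u + v = to_fract (a + b) / to_fract q" "a + b \<in> V_space C"
        by (simp_all add: add_divide_distrib Vadd)
      then show ?thesis unfolding W by blast
    qed
    show "rat_const c * u \<in> W" if u: "u \<in> W" for c u
    proof -
      obtain a where "a \<in> V_space C" "u = to_fract a / to_fract q" using u unfolding W by blast
      then have "rat_const c * u = to_fract (smult c a) / to_fract q" "smult c a \<in> V_space C"
        by (simp_all add: to_fract_smult Vscale)
      then show ?thesis unfolding W by blast
    qed
  qed
  then show ?thesis unfolding q_def by blast
qed

theorem theorem4p4:
  fixes W :: "ratfun set" and \<psi> :: "complex \<Rightarrow> complex \<Rightarrow> complex"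
  assumes "W \<in> Gr_ad" and "is_wave_function W \<psi>"
  shows "right_fourier_algebra \<psi> = diffops_preserving W \<and>
         (\<forall>\<phi>\<in>line_bundle_diffops W. \<exists>!D. op_extends W \<phi> D) \<and>
         bij_betw (canonical_embedding W) (line_bundle_diffops W) (diffops_preserving W) \<and>
         is_algebra_hom_into_diffops W (line_bundle_diffops W) (canonical_embedding W)"
proof -
  obtain C where C: "presents C W" and psi: "\<psi> = wave_function C"
    using assms(2) unfolding is_wave_function_def by blast
  obtain g where "lattice_subspace W g (q_poly C)" using presents_lattice_subspace[OF C] by blast
  then interpret lattice_subspace W g "q_poly C" .
  show ?thesis
    using right_fourier_algebra_preserves[OF C] preserving_in_right_fourier_algebra[OF C] ex1_op_extends
      bij_betw_canonical_embedding canonical_embedding_hom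
    unfolding psi by blast
qed

end
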